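(* Let $(W,S)$ be a Coxeter system of finite rank with a fixed symmetrizable generalized Cartan matrix, let $c$ be a Coxeter element, and let $v$ be $c$-sortable. Then for $w\in W$, $\pi_\downarrow^c(w)=v$ if and only if $wD\subseteq\mathrm{Cone}_c(v)$.
   Context: $S$ finite; $T$ = reflections; $\mathrm{inv}(w)=\{t\in T:\ell(tw)<\ell(w)\}$; weak order $v\le w$ iff $\mathrm{inv}(v)\subseteq\mathrm{inv}(w)$. $W_J=\langle J\rangle$ for $J\subseteq S$, $w_J\in W_J$ defined by $\mathrm{inv}(w_J)=\mathrm{inv}(w)\cap W_J$, $\langle s\rangle=S\setminus\{s\}$. Coxeter element $c=s_1\cdots s_n$ (all of $S$ in some order); $s$ initial in $c$ if a reduced word of $c$ begins with $s$; then $scs$ is a Coxeter element and $sc$ is a Coxeter element of $W_{\langle s\rangle}$. $c$-sortable: the $c$-sorting word of $w$ is the lexicographically first (by positions) subword of $(s_1\cdots s_n)^\infty$ that is a reduced word for $w$; $w$ is $c$-sortable if the sets of letters in successive copies of $s_1\cdots s_n$ weakly decrease under inclusion. $\pi_\downarrow^c$: $\pi_\downarrow^c(e)=e$, and for $s$ initial in $c$, $\pi_\downarrow^c(w)=s\pi_\downarrow^{scs}(sw)$ if $w\ge s$ and $\pi_\downarrow^{sc}(w_{\langle s\rangle})$ (computed in $W_{\langle s\rangle}$) otherwise; independent of choices. Root data: symmetrizable generalized Cartan matrix $A=(a_{ss'})$ ($a_{ss}=2$; for $s\ne s'$, $a_{ss'}\le0$, $a_{ss'}a_{s's}=4\cos^2(\pi/m(s,s'))$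 if $m(s,s')<\infty$ and $\ge4$ otherwise; $a_{ss'}=0\iff a_{s's}=0$; positive $\delta$ on $S$ with $\delta(s)a_{ss'}=\delta(s')a_{s's}$, constant on conjugate simple reflections). $V$ has basis $\{\alpha_s\}$ with $s\alpha_{s'}=\alpha_{s'}-a_{ss'}\alpha_s$; $W_J$ acts on $\mathrm{span}\{\alpha_s:s\in J\}$ as its own representation. $V^*$ is the dual with pairing $\langle\cdot,\cdot\rangle$ and dual action; $D=\{x^*\in V^*:\langle x^*,\alpha_s\rangle\ge0\ \forall s\in S\}$. $C_c(v)$ for $c$-sortable $v$: for rank $0$, $C_c(e)=\emptyset$; otherwise, for $s$ initial in $c$, $C_c(v)=C_{sc}(v)\cup\{\alpha_s\}$ if $v\not\ge s$ (with $C_{sc}(v)$ computed in $W_{\langle s\rangle}$) and $C_c(v)=s\,C_{scs}(sv)$ if $v\ge s$; independent of choices. $\mathrm{Cone}_c(v)=\{x^*\in V^*:\langle x^*,\beta\rangle\ge0\ \forall\beta\in C_c(v)\}$. *)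

theory Defs
  imports Complex_Main "HOL-Algebra.Multiplicative_Group" "HOL-Algebra.Generated_Groups"
begin

section \<open>Coxeter systems\<close>

definition word_prod :: "('w, 'r) monoid_scheme \<Rightarrow> 'w list \<Rightarrow> 'w" where
  "word_prod G u = foldr (mult G) u \<one>\<^bsub>G\<^esub>"

text \<open>
  The congruence on words that presents the group with generators \<open>S\<close> and relations
  \<open>(st)^m(s,t) = 1\<close>, where \<open>m(s,t)\<close> is the order of \<open>st\<close>
  (\<open>group.ord\<close> is 0 for elements of infinite order, for which there is no relation).  The case
  \<open>s = t\<close> gives \<open>ss = 1\<close>, so the monoid presented in this way is the group presented.
\<close>

inductive coxeter_cong :: "('w, 'r) monoid_scheme \<Rightarrow> 'w set \<Rightarrow> 'w list \<Rightarrow> 'w list \<Rightarrow> bool"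
  for G S where
  relator: "\<lbrakk>s \<in> S; t \<in> S; group.ord G (s \<otimes>\<^bsub>G\<^esub> t) \<noteq> 0\<rbrakk> \<Longrightarrow>
    coxeter_cong G S (x @ concat (replicate (group.ord G (s \<otimes>\<^bsub>G\<^esub> t)) [s, t]) @ y) (x @ y)"
| refl: "coxeter_cong G S u u"
| sym: "coxeter_cong G S u v \<Longrightarrow> coxeter_cong G S v u"
| trans: "coxeter_cong G S u v \<Longrightarrow> coxeter_cong G S v w \<Longrightarrow> coxeter_cong G S u w"

definition coxeter_system :: "('w, 'r) monoid_scheme \<Rightarrow> 'w set \<Rightarrow> bool" where
  "coxeter_system G S \<longleftrightarrow>
     group G \<and> finite S \<and> S \<subseteq> carrier G \<and> generate G S = carrier G \<and>
     (\<forall>s\<in>S. group.ord G s = 2) \<and>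
     (\<forall>u\<in>lists S. \<forall>v\<in>lists S. word_prod G u = word_prod G v \<longrightarrow> coxeter_cong G S u v)"

text \<open>
  All notions below take a subset \<open>K\<close> of the simple reflections and refer to the Coxeter system
  \<open>(W\<^sub>K, K)\<close> with \<open>W\<^sub>K = generate G K\<close>; the whole system is the case \<open>K = S\<close>.  Length and
  inversions in \<open>W\<^sub>K\<close> are those of that system.
\<close>

definition cox_length :: "('w, 'r) monoid_scheme \<Rightarrow> 'w set \<Rightarrow> 'w \<Rightarrow> nat" where
  "cox_length G K w = (LEAST n. \<exists>u\<in>lists K. word_prod G u = w \<and> length u = n)"

definition reduced_word :: "('w, 'r) monoid_scheme \<Rightarrow> 'w set \<Rightarrow> 'w \<Rightarrow> 'w list \<Rightarrow> bool" where
  "reduced_word G K w u \<longleftrightarrow>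
     u \<in> lists K \<and> word_prod G u = w \<and> length u = cox_length G K w"

definition reflections :: "('w, 'r) monoid_scheme \<Rightarrow> 'w set \<Rightarrow> 'w set" where
  "reflections G K = {x \<otimes>\<^bsub>G\<^esub> s \<otimes>\<^bsub>G\<^esub> inv\<^bsub>G\<^esub> x | x s. x \<in> generate G K \<and> s \<in> K}"

definition inversions :: "('w, 'r) monoid_scheme \<Rightarrow> 'w set \<Rightarrow> 'w \<Rightarrow> 'w set" where
  "inversions G K w =
     {t \<in> reflections G K. cox_length G K (t \<otimes>\<^bsub>G\<^esub> w) < cox_length G K w}"

definition weak_le :: "('w, 'r) monoid_scheme \<Rightarrow> 'w set \<Rightarrow> 'w \<Rightarrow> 'w \<Rightarrow> bool" where
  "weak_le G K v w \<longleftrightarrow> inversions G K v \<subseteq> inversions G K w"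

text \<open>The element \<open>w\<^sub>J\<close> of \<open>W\<^sub>J\<close>, for \<open>J \<subseteq> K\<close> and \<open>w \<in> W\<^sub>K\<close>.\<close>

definition parabolic_part :: "('w, 'r) monoid_scheme \<Rightarrow> 'w set \<Rightarrow> 'w set \<Rightarrow> 'w \<Rightarrow> 'w" where
  "parabolic_part G K J w =
     (THE x. x \<in> generate G J \<and> inversions G K x = inversions G K w \<inter> generate G J)"

section \<open>Coxeter elements and sortable elements\<close>

definition coxeter_word :: "('w, 'r) monoid_scheme \<Rightarrow> 'w set \<Rightarrow> 'w \<Rightarrow> 'w list \<Rightarrow> bool" where
  "coxeter_word G K c cs \<longleftrightarrow> distinct cs \<and> set cs = K \<and> word_prod G cs = c"

definition coxeter_element :: "('w, 'r) monoid_scheme \<Rightarrow> 'w set \<Rightarrow> 'w \<Rightarrow> bool" where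
  "coxeter_element G K c \<longleftrightarrow> (\<exists>cs. coxeter_word G K c cs)"

definition initial_in :: "('w, 'r) monoid_scheme \<Rightarrow> 'w set \<Rightarrow> 'w \<Rightarrow> 'w \<Rightarrow> bool" where
  "initial_in G K c s \<longleftrightarrow> (\<exists>u. reduced_word G K c (s # u))"

text \<open>
  Subwords of the infinite word \<open>cs cs cs \<dots>\<close> are given by strictly increasing lists of positions,
  counted from 0; position \<open>p\<close> lies in copy number \<open>p div length cs\<close>.
\<close>

definition subword_at :: "'w list \<Rightarrow> nat list \<Rightarrow> 'w list" where
  "subword_at cs ps = map (\<lambda>p. cs ! (p mod length cs)) ps"

definition sorting_positions ::
    "('w, 'r) monoid_scheme \<Rightarrow> 'w set \<Rightarrow> 'w list \<Rightarrow> 'w \<Rightarrow> nat list \<Rightarrow> bool" where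
  "sorting_positions G K cs w ps \<longleftrightarrow>
     sorted_wrt (<) ps \<and> reduced_word G K w (subword_at cs ps) \<and>
     (\<forall>qs. sorted_wrt (<) qs \<and> reduced_word G K w (subword_at cs qs) \<longrightarrow>
        ps = qs \<or> (ps, qs) \<in> lex less_than)"

definition copy_letters :: "'w list \<Rightarrow> nat list \<Rightarrow> nat \<Rightarrow> 'w set" where
  "copy_letters cs ps k = {cs ! (p mod length cs) | p. p \<in> set ps \<and> p div length cs = k}"

text \<open>
  Sortability does not depend on the word \<open>cs\<close> for \<open>c\<close>, since any two such words differ by
  transpositions of adjacent commuting letters.
\<close>

definition sortable :: "('w, 'r) monoid_scheme \<Rightarrow> 'w set \<Rightarrow> 'w \<Rightarrow> 'w \<Rightarrow> bool" where
  "sortable G K c w \<longleftrightarrow>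
     (\<exists>cs ps. coxeter_word G K c cs \<and> sorting_positions G K cs w ps \<and>
        (\<forall>k. copy_letters cs ps (Suc k) \<subseteq> copy_letters cs ps k))"

section \<open>The projection onto sortable elements\<close>

text \<open>
  The recursion involves a choice of an initial letter.  It is therefore given as a relation that
  allows every choice, and the value is the unique element so obtained.
\<close>

inductive pi_down_rel :: "('w, 'r) monoid_scheme \<Rightarrow> 'w set \<Rightarrow> 'w \<Rightarrow> 'w \<Rightarrow> 'w \<Rightarrow> bool"
  for G where
  one: "pi_down_rel G K c \<one>\<^bsub>G\<^esub> \<one>\<^bsub>G\<^esub>"
| above: "\<lbrakk>initial_in G K c s; weak_le G K s w;
     pi_down_rel G K (s \<otimes>\<^bsub>G\<^esub> c \<otimes>\<^bsub>G\<^esub> s) (s \<otimes>\<^bsub>G\<^esub> w) v\<rbrakk> \<Longrightarrow>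
     pi_down_rel G K c w (s \<otimes>\<^bsub>G\<^esub> v)"
| not_above: "\<lbrakk>initial_in G K c s; \<not> weak_le G K s w;
     pi_down_rel G (K - {s}) (s \<otimes>\<^bsub>G\<^esub> c) (parabolic_part G K (K - {s}) w) v\<rbrakk> \<Longrightarrow>
     pi_down_rel G K c w v"

definition pi_down :: "('w, 'r) monoid_scheme \<Rightarrow> 'w set \<Rightarrow> 'w \<Rightarrow> 'w \<Rightarrow> 'w" where
  "pi_down G K c w = (THE v. pi_down_rel G K c w v)"

section \<open>Root data\<close>

definition symmetrizable_gcm ::
    "('w, 'r) monoid_scheme \<Rightarrow> 'w set \<Rightarrow> ('w \<Rightarrow> 'w \<Rightarrow> real) \<Rightarrow> bool" where
  "symmetrizable_gcm G S A \<longleftrightarrow>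
     (\<forall>s\<in>S. A s s = 2) \<and>
     (\<forall>s\<in>S. \<forall>t\<in>S. s \<noteq> t \<longrightarrow>
        A s t \<le> 0 \<and>
        (let m = group.ord G (s \<otimes>\<^bsub>G\<^esub> t) in
           if m \<noteq> 0 then A s t * A t s = 4 * (cos (pi / real m))\<^sup>2 else A s t * A t s \<ge> 4) \<and>
        (A s t = 0 \<longleftrightarrow> A t s = 0)) \<and>
     (\<exists>\<delta>. (\<forall>s\<in>S. \<delta> s > (0::real)) \<and>
        (\<forall>s\<in>S. \<forall>t\<in>S. \<delta> s * A s t = \<delta> t * A t s) \<and>
        (\<forall>s\<in>S. \<forall>t\<in>S. (\<exists>x\<in>carrier G. t = x \<otimes>\<^bsub>G\<^esub> s \<otimes>\<^bsub>G\<^esub> inv\<^bsub>G\<^esub> x) \<longrightarrow> \<delta> s = \<delta> t))"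

text \<open>
  The simple roots \<open>\<alpha> s\<close>, \<open>s \<in> S\<close>, are a basis of the space \<open>V\<close>, which is the type \<open>'v\<close>.
\<close>

definition root_basis :: "'w set \<Rightarrow> ('w \<Rightarrow> 'v::real_vector) \<Rightarrow> bool" where
  "root_basis S \<alpha> \<longleftrightarrow> inj_on \<alpha> S \<and> independent (\<alpha> ` S) \<and> span (\<alpha> ` S) = UNIV"

text \<open>
  The linear extension of \<open>s \<alpha>\<^sub>t = \<alpha>\<^sub>t - a\<^sub>s\<^sub>t \<alpha>\<^sub>s\<close> (\<open>t \<in> K\<close>) to the span of the
  \<open>\<alpha>\<^sub>t\<close>, \<open>t \<in> K\<close>, i.e. the action of \<open>s\<close> in the representation of \<open>W\<^sub>K\<close>.
\<close>

definition simple_refl ::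
    "('w \<Rightarrow> 'w \<Rightarrow> real) \<Rightarrow> ('w \<Rightarrow> 'v::real_vector) \<Rightarrow> 'w set \<Rightarrow> 'w \<Rightarrow> 'v \<Rightarrow> 'v" where
  "simple_refl A \<alpha> K s x =
     x - (\<Sum>t\<in>K. A s t * representation (\<alpha> ` K) x (\<alpha> t)) *\<^sub>R \<alpha> s"

text \<open>
  The action on \<open>V\<close> of an arbitrary element: write it as a product of simple reflections and let
  these act in turn; the result depends only on the element.
\<close>

definition act ::
    "('w, 'r) monoid_scheme \<Rightarrow> 'w set \<Rightarrow> ('w \<Rightarrow> 'w \<Rightarrow> real) \<Rightarrow> ('w \<Rightarrow> 'v::real_vector)
       \<Rightarrow> 'w \<Rightarrow> 'v \<Rightarrow> 'v" where
  "act G S A \<alpha> w x =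
     (THE y. \<exists>u\<in>lists S. word_prod G u = w \<and> y = foldr (simple_refl A \<alpha> S) u x)"

section \<open>The dual space and the cones\<close>

text \<open>The dual space consists of the functions \<open>f :: 'v \<Rightarrow> real\<close> with \<open>linear f\<close>.\<close>

definition dual_act ::
    "('w, 'r) monoid_scheme \<Rightarrow> 'w set \<Rightarrow> ('w \<Rightarrow> 'w \<Rightarrow> real) \<Rightarrow> ('w \<Rightarrow> 'v::real_vector)
       \<Rightarrow> 'w \<Rightarrow> ('v \<Rightarrow> real) \<Rightarrow> ('v \<Rightarrow> real)" where
  "dual_act G S A \<alpha> w f = (\<lambda>x. f (act G S A \<alpha> (inv\<^bsub>G\<^esub> w) x))"

definition dominant_chamber :: "'w set \<Rightarrow> ('w \<Rightarrow> 'v::real_vector) \<Rightarrow> ('v \<Rightarrow> real) set" where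
  "dominant_chamber S \<alpha> = {f. linear f \<and> (\<forall>s\<in>S. f (\<alpha> s) \<ge> 0)}"

text \<open>As for \<open>pi_down\<close>, the relation allows every choice of an initial letter.\<close>

inductive C_rel ::
    "('w, 'r) monoid_scheme \<Rightarrow> ('w \<Rightarrow> 'w \<Rightarrow> real) \<Rightarrow> ('w \<Rightarrow> 'v::real_vector)
       \<Rightarrow> 'w set \<Rightarrow> 'w \<Rightarrow> 'w \<Rightarrow> 'v set \<Rightarrow> bool"
  for G A \<alpha> where
  rank_zero: "C_rel G A \<alpha> {} \<one>\<^bsub>G\<^esub> \<one>\<^bsub>G\<^esub> {}"
| not_above: "\<lbrakk>initial_in G K c s; \<not> weak_le G K s v;
     C_rel G A \<alpha> (K - {s}) (s \<otimes>\<^bsub>G\<^esub> c) v X\<rbrakk> \<Longrightarrow>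
     C_rel G A \<alpha> K c v (X \<union> {\<alpha> s})"
| above: "\<lbrakk>initial_in G K c s; weak_le G K s v;
     C_rel G A \<alpha> K (s \<otimes>\<^bsub>G\<^esub> c \<otimes>\<^bsub>G\<^esub> s) (s \<otimes>\<^bsub>G\<^esub> v) X\<rbrakk> \<Longrightarrow>
     C_rel G A \<alpha> K c v (simple_refl A \<alpha> K s ` X)"

definition C_set ::
    "('w, 'r) monoid_scheme \<Rightarrow> ('w \<Rightarrow> 'w \<Rightarrow> real) \<Rightarrow> ('w \<Rightarrow> 'v::real_vector)
       \<Rightarrow> 'w set \<Rightarrow> 'w \<Rightarrow> 'w \<Rightarrow> 'v set" where
  "C_set G A \<alpha> K c v = (THE X. C_rel G A \<alpha> K c v X)"

definition Cone ::
    "('w, 'r) monoid_scheme \<Rightarrow> ('w \<Rightarrow> 'w \<Rightarrow> real) \<Rightarrow> ('w \<Rightarrow> 'v::real_vector)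
       \<Rightarrow> 'w set \<Rightarrow> 'w \<Rightarrow> 'w \<Rightarrow> ('v \<Rightarrow> real) set" where
  "Cone G A \<alpha> K c v = {f. linear f \<and> (\<forall>\<beta>\<in>C_set G A \<alpha> K c v. f \<beta> \<ge> 0)}"

end

theory Submission
  imports Defs
begin

text \<open>
  By induction along the recursion, \<open>\<pi>(w) = v\<close> implies that \<open>w\<inverse>\<beta>\<close> is positive for
  every \<open>\<beta> \<in> C(v)\<close>.  For the converse, let \<open>v\<close> be fixed by the projection and walk from
  \<open>v\<close> to \<open>w\<close> along a reduced gallery.  A root that is positive at both ends is positive all
  along, so it suffices to see that the projection does not change between adjacent chambers that
  both lie in the cone.  Following the recursion for such a pair \<open>w, wq\<close>, the two elements behave
  alike until \<open>w \<ge> s\<close> and \<open>wq = sw\<close> for the initial letter \<open>s\<close>; there one is reduced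
  to showing that \<open>y < sy\<close> never have the same projection when \<open>yq = sy\<close> is a cover.

  For this one studies which covers are contracted by the projection.  In a finite rank two interval
  \<open>x W\<^sub>q\<^sub>r\<close>, a contracted edge at the top forces the opposite edge at the bottom to be
  contracted.  Moving down along a wall through such intervals, one finds that contraction is
  inherited by standard parabolic subgroups, and in the subgroup generated by \<open>s\<close> alone the
  edge from \<open>1\<close> to \<open>s\<close> is not contracted.
\<close>

section \<open>Chebyshev polynomials and alternating words\<close>

text \<open>The group may be infinite: there is no longest element, and a rank two coset need not
  have a top. Contraction is therefore treated edge by edge in finite intervals, by induction on
  length. The obstacle is an initial letter \<open>s\<close> whose root is extreme in an interval:
  division by \<open>s\<close> then reflects one side of the interval onto the other, and a top edge
  of one side becomes an inner edge of the other. An inner edge forces a contracted bottom edge on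
  only one of the two sides, and which one depends on \<open>c\<close>. This is recorded by the sign
  of a skew form attached to \<open>c\<close>, whose values are preserved both by the passage to
  \<open>scs\<close> and by restriction, so that it can be carried through the recursion. Coxeter
  words replace Coxeter elements, which turns the choice of an initial letter into a function on
  lists; independence of the word is proved separately. Roots are rescaled to norm 1, since the
  cones see them only up to positive factors.\<close>

fun chebyshev :: "real \<Rightarrow> nat \<Rightarrow> real" where
  "chebyshev C 0 = 0"
| "chebyshev C (Suc 0) = 1"
| "chebyshev C (Suc (Suc k)) = C * chebyshev C (Suc k) - chebyshev C k"

text \<open>These are Chebyshev polynomials of the second kind with the index shifted by one; the
  recursion is the addition formula for \<open>sin\<close>.\<close>

lemma chebyshev_cos:
  assumes "sin \<theta> \<noteq> 0"
  shows "chebyshev (2 * cos \<theta>) k = sin (real k * \<theta>) / sin \<theta>"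
  using assms
proof (induction "2 * cos \<theta>" k rule: chebyshev.induct)
  case (3 k)
  have "sin (real (Suc k) * \<theta> + \<theta>) + sin (real (Suc k) * \<theta> - \<theta>)
      = 2 * cos \<theta> * sin (real (Suc k) * \<theta>)"
    by (simp only: sin_add sin_diff) simp
  moreover have "real (Suc k) * \<theta> + \<theta> = real (Suc (Suc k)) * \<theta>" "real (Suc k) * \<theta> - \<theta> = real k * \<theta>"
    by (simp_all add: algebra_simps)
  ultimately have "sin (real (Suc (Suc k)) * \<theta>) + sin (real k * \<theta>)
      = 2 * cos \<theta> * sin (real (Suc k) * \<theta>)" by simp
  then show ?case using 3 by (simp add: field_simps)
qed auto

text \<open>Serves the infinite dihedral subgroups. The increment is part of the induction because
  growth by at least one is what \<open>C * u - v \<ge> 2 * u - v\<close> reproduces.\<close>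

lemma chebyshev_ge:
  assumes "C \<ge> 2" shows "chebyshev C k \<ge> real k \<and> chebyshev C (Suc k) \<ge> chebyshev C k + 1"
proof (induction k)
  case (Suc k)
  have "chebyshev C (Suc k) \<ge> 0" using Suc by simp
  then have "C * chebyshev C (Suc k) \<ge> 2 * chebyshev C (Suc k)"
    using assms by (intro mult_right_mono)
  then show ?case using Suc by (simp only: chebyshev.simps of_nat_Suc) linarith
qed simp

primrec alt :: "'a \<Rightarrow> 'a \<Rightarrow> nat \<Rightarrow> 'a list" where
  "alt p q 0 = []"
| "alt p q (Suc k) = p # alt q p k"

text \<open>The letter at position \<open>k\<close>, counted from 0, of the alternating word
  starting with \<open>p\<close>; for \<open>k > 0\<close>, \<open>next_letter q p k\<close> is thus
  the last letter of \<open>alt p q k\<close>.\<close>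

definition next_letter :: "'a \<Rightarrow> 'a \<Rightarrow> nat \<Rightarrow> 'a" where
  "next_letter p q k = (if even k then p else q)"

lemma next_letter_simps [simp]: "next_letter p q 0 = p" "next_letter p q (Suc k) = next_letter q p k"
  by (auto simp: next_letter_def)

lemma length_alt [simp]: "length (alt p q k) = k"
  by (induction k arbitrary: p q) auto

lemma set_alt: "set (alt p q k) \<subseteq> {p, q}"
  by (induction k arbitrary: p q) auto

lemma alt_append: "alt p q (i + j) = alt p q i @ alt (next_letter p q i) (next_letter q p i) j"
  by (induction i arbitrary: p q) auto

lemma alt_Suc_right: "alt p q (Suc k) = alt p q k @ [next_letter p q k]"
  using alt_append[of p q k 1] by simp

lemma rev_alt: "rev (alt p q k) = alt (next_letter q p k) (next_letter p q k) k"
proof (induction k arbitrary: p q)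
  case (Suc k)
  have "rev (alt p q (Suc k)) = alt (next_letter p q k) (next_letter q p k) k @ [p]"
    using Suc[of q p] by simp
  also have "\<dots> = alt (next_letter p q k) (next_letter q p k) k @ [next_letter (next_letter p q k) (next_letter q p k) k]"
    by (simp add: next_letter_def)
  also have "\<dots> = alt (next_letter p q k) (next_letter q p k) (Suc k)"
    by (simp only: alt_Suc_right)
  finally show ?case by simp
qed simp

lemma alt_double: "concat (replicate k [p, q]) = alt p q (2 * k)"
  by (induction k) auto

text \<open>
  The vectors \<open>n s\<close> are the simple roots scaled by \<open>1 / sqrt (\<delta> s)\<close>: on these the
  generalized Cartan matrix becomes the symmetric matrix \<open>2 * b s t\<close> and all roots have norm 1.
\<close>

locale coxeter_rep = group G for G :: "('w, 'r) monoid_scheme" (structure) +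
  fixes S :: "'w set" and n :: "'w \<Rightarrow> 'v::real_vector" and cf :: "'w \<Rightarrow> 'v \<Rightarrow> real"
    and b :: "'w \<Rightarrow> 'w \<Rightarrow> real"
  assumes system: "coxeter_system G S"
    and linear_cf: "s \<in> S \<Longrightarrow> linear (cf s)"
    and cf_n: "s \<in> S \<Longrightarrow> t \<in> S \<Longrightarrow> cf s (n t) = (if s = t then 1 else 0)"
    and expand: "x = (\<Sum>s\<in>S. cf s x *\<^sub>R n s)"
    and b_sym: "b s t = b t s"
    and b_self: "s \<in> S \<Longrightarrow> b s s = 1"
    and b_finite: "s \<in> S \<Longrightarrow> t \<in> S \<Longrightarrow> s \<noteq> t \<Longrightarrow> ord (s \<otimes> t) \<noteq> 0 \<Longrightarrow>
      b s t = - cos (pi / real (ord (s \<otimes> t)))"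
    and b_infinite: "s \<in> S \<Longrightarrow> t \<in> S \<Longrightarrow> s \<noteq> t \<Longrightarrow> ord (s \<otimes> t) = 0 \<Longrightarrow> b s t \<le> - 1"
begin

abbreviation "wp \<equiv> word_prod G"
abbreviation len :: "'w \<Rightarrow> nat" ("\<ell>") where "\<ell> \<equiv> cox_length G S"

section \<open>Words and length\<close>

lemma finite_S: "finite S" and S_carrier: "S \<subseteq> carrier G" and gen_S: "generate G S = carrier G"
  and ord_S: "s \<in> S \<Longrightarrow> ord s = 2"
  and presentation: "u \<in> lists S \<Longrightarrow> v \<in> lists S \<Longrightarrow> wp u = wp v \<Longrightarrow> coxeter_cong G S u v"
  using system unfolding coxeter_system_def by (fast | (simp only: lists_eq_set; blast))+

lemma S_in_carrier [simp]: "s \<in> S \<Longrightarrow> s \<in> carrier G"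
  using S_carrier by auto

lemma sq_one [simp]: "s \<in> S \<Longrightarrow> s \<otimes> s = \<one>"
  using pow_ord_eq_1[of s] ord_S[of s] by (simp add: numeral_2_eq_2)

lemma S_ne_one: "s \<in> S \<Longrightarrow> s \<noteq> \<one>"
  using ord_S[of s] ord_eq_1[of \<one>] by auto

lemma inv_S [simp]: "s \<in> S \<Longrightarrow> inv s = s"
  by (rule inv_equality) auto

lemma S_cancel_left [simp]: "s \<in> S \<Longrightarrow> x \<in> carrier G \<Longrightarrow> s \<otimes> (s \<otimes> x) = x"
  by (simp add: m_assoc[symmetric])

lemma S_cancel_right [simp]: "s \<in> S \<Longrightarrow> x \<in> carrier G \<Longrightarrow> x \<otimes> s \<otimes> s = x"
  by (simp add: m_assoc)

lemma wp_Nil [simp]: "wp [] = \<one>" and wp_Cons [simp]: "wp (s # u) = s \<otimes> wp u"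
  by (simp_all add: word_prod_def)

lemma wp_closed [simp]: "set u \<subseteq> carrier G \<Longrightarrow> wp u \<in> carrier G"
  by (induction u) auto

lemma wp_closed_S: "set u \<subseteq> S \<Longrightarrow> wp u \<in> carrier G"
  using S_carrier by (intro wp_closed) auto

lemma wp_append: "set u \<subseteq> carrier G \<Longrightarrow> set v \<subseteq> carrier G \<Longrightarrow> wp (u @ v) = wp u \<otimes> wp v"
  by (induction u) (auto simp: m_assoc)

lemma wp_append_S: "set u \<subseteq> S \<Longrightarrow> set v \<subseteq> S \<Longrightarrow> wp (u @ v) = wp u \<otimes> wp v"
  using S_carrier by (intro wp_append) auto

lemma wp_rev: "set u \<subseteq> S \<Longrightarrow> wp (rev u) = inv (wp u)"
proof (induction u)
  case (Cons a u)
  then show ?case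
    by (simp add: wp_append_S wp_closed_S inv_mult_group)
qed simp

lemma generate_words:
  assumes "J \<subseteq> S" shows "generate G J = wp ` lists J"
proof
  show "generate G J \<subseteq> wp ` lists J"
  proof
    fix x assume "x \<in> generate G J"
    then show "x \<in> wp ` lists J"
    proof induction
      case one
      then show ?case by (auto intro!: image_eqI[of _ _ "[]"])
    next
      case (incl h)
      then show ?case using assms by (auto intro!: image_eqI[of _ _ "[h]"])
    next
      case (inv h)
      then show ?case using assms by (auto intro!: image_eqI[of _ _ "[h]"])
    next
      case (eng h1 h2)
      then obtain u v where "h1 = wp u" "h2 = wp v" "u \<in> lists J" "v \<in> lists J" by auto
      then show ?case using assms
        by (intro image_eqI[of _ _ "u @ v"]) (auto simp: wp_append_S subset_iff in_lists_conv_set)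
    qed
  qed
next
  have "wp u \<in> generate G J" if "set u \<subseteq> J" for u
    using that by (induction u) (auto intro: generate.intros)
  then show "wp ` lists J \<subseteq> generate G J" by (auto simp: in_lists_conv_set subset_iff)
qed

lemma carrier_words:
  assumes "x \<in> carrier G" obtains u where "set u \<subseteq> S" "x = wp u"
proof -
  have "x \<in> wp ` lists S" using assms generate_words[of S] gen_S by simp
  then show thesis using that by (auto simp: in_lists_conv_set)
qed

text \<open>Every relator has even length \<open>2 * m\<close>. So the parity of a word depends only
  on its product, which rules out that multiplication by a simple reflection preserves the
  length.\<close>

lemma coxeter_cong_parity:
  "coxeter_cong G S u v \<Longrightarrow> even (length u) = even (length v)"
proof (induction rule: coxeter_cong.induct)
  case (relator s t x y)
  have "length (concat (replicate k [s, t])) = 2 * k" for k by (induction k) auto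
  then show ?case by simp
qed auto

lemma parity:
  "set u \<subseteq> S \<Longrightarrow> set v \<subseteq> S \<Longrightarrow> wp u = wp v \<Longrightarrow> even (length u) = even (length v)"
  using presentation[of u v] coxeter_cong_parity by (auto simp: in_lists_conv_set subset_iff)

lemma len_le: "set u \<subseteq> S \<Longrightarrow> \<ell> (wp u) \<le> length u"
  unfolding cox_length_def by (rule Least_le) (auto simp: in_lists_conv_set subset_iff)

lemma reduced_exists:
  assumes "x \<in> carrier G" obtains u where "set u \<subseteq> S" "wp u = x" "length u = \<ell> x"
proof -
  obtain u where "set u \<subseteq> S" "x = wp u" using assms carrier_words by blast
  then have "\<exists>k. \<exists>u\<in>lists S. wp u = x \<and> length u = k" by (auto simp: in_lists_conv_set subset_iff)
  then have "\<exists>u\<in>lists S. wp u = x \<and> length u = \<ell> x"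
    unfolding cox_length_def by (rule LeastI_ex)
  then show thesis using that by (auto simp: in_lists_conv_set subset_iff)
qed

lemma len_one [simp]: "\<ell> \<one> = 0"
  using len_le[of "[]"] by simp

lemma len_0_iff: "x \<in> carrier G \<Longrightarrow> \<ell> x = 0 \<longleftrightarrow> x = \<one>"
  using reduced_exists[of x] by (metis len_one length_0_conv wp_Nil)

lemma len_mult_le:
  assumes "x \<in> carrier G" "y \<in> carrier G" shows "\<ell> (x \<otimes> y) \<le> \<ell> x + \<ell> y"
proof -
  obtain u v where "set u \<subseteq> S" "wp u = x" "length u = \<ell> x" "set v \<subseteq> S" "wp v = y" "length v = \<ell> y"
    using assms reduced_exists by metis
  then show ?thesis using len_le[of "u @ v"] by (simp add: wp_append_S)
qed

lemma len_inv [simp]: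
  assumes "x \<in> carrier G" shows "\<ell> (inv x) = \<ell> x"
proof -
  have le: "\<ell> (inv y) \<le> \<ell> y" if "y \<in> carrier G" for y
  proof -
    obtain u where "set u \<subseteq> S" "wp u = y" "length u = \<ell> y"
      by (rule reduced_exists[OF \<open>y \<in> carrier G\<close>])
    then show ?thesis using len_le[of "rev u"] wp_rev[of u] by (metis length_rev set_rev)
  qed
  show ?thesis using le[OF assms] le[OF inv_closed[OF assms]] inv_inv[OF assms] by (metis le_antisym)
qed

lemma len_S: "s \<in> S \<Longrightarrow> \<ell> s = 1"
  using len_le[of "[s]"] len_0_iff[of s] S_ne_one[of s] by simp

lemma len_mult_S_parity:
  assumes "x \<in> carrier G" "s \<in> S" shows "even (\<ell> (x \<otimes> s)) \<noteq> even (\<ell> x)"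
proof -
  obtain u v where u: "set u \<subseteq> S" "wp u = x" "length u = \<ell> x"
    and v: "set v \<subseteq> S" "wp v = x \<otimes> s" "length v = \<ell> (x \<otimes> s)"
    using assms reduced_exists[of x] reduced_exists[of "x \<otimes> s"] S_in_carrier m_closed by metis
  have "even (length v) = even (length (u @ [s]))"
    using u v assms by (intro parity) (auto simp: wp_append_S)
  then show ?thesis using u v by simp
qed

lemma len_mult_S_cases:
  assumes "x \<in> carrier G" "s \<in> S"
  shows "\<ell> (x \<otimes> s) = \<ell> x + 1 \<or> \<ell> x = \<ell> (x \<otimes> s) + 1"
proof -
  have "\<ell> (x \<otimes> s) \<le> \<ell> x + 1" using len_mult_le[of x s] assms by (simp add: len_S)
  moreover have "\<ell> (x \<otimes> s \<otimes> s) \<le> \<ell> (x \<otimes> s) + 1"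
    using len_mult_le[of "x \<otimes> s" s] assms by (simp add: len_S del: S_cancel_right)
  moreover have "x \<otimes> s \<otimes> s = x" using assms by simp
  moreover have "\<ell> (x \<otimes> s) \<noteq> \<ell> x" using len_mult_S_parity[OF assms] by auto
  ultimately show ?thesis by simp linarith
qed

lemma len_S_mult:
  assumes "x \<in> carrier G" "s \<in> S" shows "\<ell> (s \<otimes> x) = \<ell> (inv x \<otimes> s)"
  using len_inv[of "inv x \<otimes> s"] assms by (simp add: inv_mult_group)

lemma len_S_mult_cases:
  assumes "x \<in> carrier G" "s \<in> S"
  shows "\<ell> (s \<otimes> x) = \<ell> x + 1 \<or> \<ell> x = \<ell> (s \<otimes> x) + 1"
  using len_mult_S_cases[of "inv x" s] assms by (simp add: len_S_mult)

section \<open>The reflection representation\<close>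

text \<open>\<open>bf s\<close> is the pairing with \<open>n s\<close> in the symmetric form with
  Gram matrix \<open>b\<close>, and \<open>\<sigma> s\<close> is the orthogonal reflection in the
  unit vector \<open>n s\<close>.\<close>

definition bf :: "'w \<Rightarrow> 'v \<Rightarrow> real" where "bf s x = (\<Sum>t\<in>S. b s t * cf t x)"
definition bil :: "'v \<Rightarrow> 'v \<Rightarrow> real" where "bil x y = (\<Sum>s\<in>S. cf s x * bf s y)"
definition \<sigma> :: "'w \<Rightarrow> 'v \<Rightarrow> 'v" where "\<sigma> s x = x - (2 * bf s x) *\<^sub>R n s"

lemma cf_simps [simp]:
  assumes "s \<in> S"
  shows "cf s (x + y) = cf s x + cf s y" "cf s (x - y) = cf s x - cf s y"
    "cf s (r *\<^sub>R x) = r * cf s x" "cf s (- x) = - cf s x" "cf s 0 = 0"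
  using linear_cf[OF assms]
  by (simp_all add: linear_add linear_diff linear_cmul linear_neg linear_0)

lemma bf_simps [simp]:
  "bf s (x + y) = bf s x + bf s y" "bf s (x - y) = bf s x - bf s y"
  "bf s (r *\<^sub>R x) = r * bf s x" "bf s (- x) = - bf s x" "bf s 0 = 0"
  unfolding bf_def
  by (simp_all add: sum.distrib sum_subtractf sum_distrib_left sum_negf algebra_simps)

lemma bil_simps [simp]:
  "bil z (x + y) = bil z x + bil z y" "bil z (x - y) = bil z x - bil z y"
  "bil z (r *\<^sub>R x) = r * bil z x" "bil z (- x) = - bil z x"
  "bil (x + y) z = bil x z + bil y z" "bil (x - y) z = bil x z - bil y z"
  "bil (r *\<^sub>R x) z = r * bil x z" "bil (- x) z = - bil x z"
  unfolding bil_def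
  by (simp_all add: sum.distrib sum_subtractf sum_distrib_left sum_negf algebra_simps)

lemma bf_n: "t \<in> S \<Longrightarrow> bf s (n t) = b s t"
  unfolding bf_def using finite_S by (simp add: cf_n if_distrib cong: if_cong)

lemma bil_n_left: "s \<in> S \<Longrightarrow> bil (n s) x = bf s x"
  unfolding bil_def using finite_S by (simp add: cf_n if_distrib[of "\<lambda>z. z * _"] cong: if_cong)

lemma bil_sym: "bil x y = bil y x"
proof -
  have "bil x y = (\<Sum>s\<in>S. \<Sum>t\<in>S. b s t * cf s x * cf t y)"
    unfolding bil_def bf_def by (simp add: sum_distrib_left mult_ac)
  also have "\<dots> = (\<Sum>t\<in>S. \<Sum>s\<in>S. b s t * cf s x * cf t y)" by (rule sum.swap)
  also have "\<dots> = bil y x"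
    unfolding bil_def bf_def by (simp add: sum_distrib_left mult_ac b_sym)
  finally show ?thesis .
qed

lemma eq_by_cf: "(\<And>s. s \<in> S \<Longrightarrow> cf s x = cf s y) \<Longrightarrow> x = y"
  using expand[of x] expand[of y] by (metis (no_types, lifting) sum.cong)

lemma \<sigma>_linear [simp]:
  "\<sigma> s (x + y) = \<sigma> s x + \<sigma> s y" "\<sigma> s (x - y) = \<sigma> s x - \<sigma> s y" "\<sigma> s (r *\<^sub>R x) = r *\<^sub>R \<sigma> s x"
  "\<sigma> s (- x) = - \<sigma> s x" "\<sigma> s 0 = 0"
  unfolding \<sigma>_def by (simp_all add: algebra_simps)

lemma \<sigma>_n: "s \<in> S \<Longrightarrow> \<sigma> s (n s) = - n s"
  unfolding \<sigma>_def by (simp add: bf_n b_self scaleR_2)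

lemma \<sigma>_\<sigma> [simp]: "s \<in> S \<Longrightarrow> \<sigma> s (\<sigma> s x) = x"
  unfolding \<sigma>_def by (simp add: bf_n b_self)

lemma bil_\<sigma>: "s \<in> S \<Longrightarrow> bil (\<sigma> s x) (\<sigma> s y) = bil x y"
proof -
  assume s: "s \<in> S"
  have "bil x (n s) = bf s x" using bil_sym[of x "n s"] bil_n_left[OF s] by simp
  then show ?thesis
    unfolding \<sigma>_def using s by (simp add: bil_n_left bf_n b_self algebra_simps)
qed

lemma cf_\<sigma>: "s \<in> S \<Longrightarrow> t \<in> S \<Longrightarrow> s \<noteq> t \<Longrightarrow> cf t (\<sigma> s x) = cf t x"
  unfolding \<sigma>_def by (simp add: cf_n)

lemma cf_\<sigma>_self: "s \<in> S \<Longrightarrow> cf s (\<sigma> s x) = cf s x - 2 * bf s x"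
  unfolding \<sigma>_def by (simp add: cf_n)

definition fold\<sigma> :: "'w list \<Rightarrow> 'v \<Rightarrow> 'v" where "fold\<sigma> u = foldr \<sigma> u"

lemma fold\<sigma>_simps [simp]:
  "fold\<sigma> [] x = x" "fold\<sigma> (s # u) x = \<sigma> s (fold\<sigma> u x)" "fold\<sigma> (u @ v) x = fold\<sigma> u (fold\<sigma> v x)"
  by (simp_all add: fold\<sigma>_def)

lemma fold\<sigma>_linear [simp]:
  "fold\<sigma> u (x + y) = fold\<sigma> u x + fold\<sigma> u y" "fold\<sigma> u (x - y) = fold\<sigma> u x - fold\<sigma> u y"
  "fold\<sigma> u (r *\<^sub>R x) = r *\<^sub>R fold\<sigma> u x" "fold\<sigma> u (- x) = - fold\<sigma> u x" "fold\<sigma> u 0 = 0"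
  by (induction u) auto

section \<open>Dihedral root systems and the Coxeter relations\<close>

definition U :: "'w \<Rightarrow> 'w \<Rightarrow> nat \<Rightarrow> real" where "U p q = chebyshev (- 2 * b p q)"

lemma U_simps [simp]:
  "U p q 0 = 0" "U p q (Suc 0) = 1" "U p q (Suc (Suc k)) = - 2 * b p q * U p q (Suc k) - U p q k"
  by (simp_all add: U_def)

lemma U_sym: "U p q = U q p"
  by (simp add: U_def b_sym)

lemma ord_ge_2: "p \<in> S \<Longrightarrow> q \<in> S \<Longrightarrow> p \<noteq> q \<Longrightarrow> ord (p \<otimes> q) \<noteq> 0 \<Longrightarrow> ord (p \<otimes> q) \<ge> 2"
proof -
  assume a: "p \<in> S" "q \<in> S" "p \<noteq> q" "ord (p \<otimes> q) \<noteq> 0"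
  have "ord (p \<otimes> q) \<noteq> 1"
  proof
    assume "ord (p \<otimes> q) = 1"
    then have "p \<otimes> q = \<one>" using a ord_eq_1[of "p \<otimes> q"] by simp
    then have "inv q = p" using a by (intro inv_equality) auto
    then show False using a by simp
  qed
  then show ?thesis using a by simp
qed

lemma angle:
  assumes "p \<in> S" "q \<in> S" "p \<noteq> q" "ord (p \<otimes> q) \<noteq> 0"
  defines "\<theta> \<equiv> pi / real (ord (p \<otimes> q))"
  shows "- 2 * b p q = 2 * cos \<theta>" "sin \<theta> > 0" "U p q k = sin (real k * \<theta>) / sin \<theta>"
    "real (ord (p \<otimes> q)) * \<theta> = pi"
proof -
  let ?m = "ord (p \<otimes> q)"
  have m: "?m \<ge> 2" using ord_ge_2 assms by blast
  show b: "- 2 * b p q = 2 * cos \<theta>" using b_finite assms by simp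
  have "\<theta> > 0" "\<theta> < pi" using m by (auto simp: \<theta>_def field_simps)
  then show s: "sin \<theta> > 0" by (rule sin_gt_zero)
  show "U p q k = sin (real k * \<theta>) / sin \<theta>" using chebyshev_cos[of \<theta> k] s unfolding U_def b by simp
  show "real ?m * \<theta> = pi" using m by (simp add: \<theta>_def)
qed

lemma U_pos:
  assumes "p \<in> S" "q \<in> S" "p \<noteq> q" "0 < k" "ord (p \<otimes> q) = 0 \<or> k < ord (p \<otimes> q)"
  shows "U p q k > 0"
proof (cases "ord (p \<otimes> q) = 0")
  case True
  then have "b p q \<le> - 1" using b_infinite assms by blast
  then have "- 2 * b p q \<ge> 2" by simp
  then show ?thesis using chebyshev_ge[of "- 2 * b p q" k] assms unfolding U_def by linarith
next
  case False
  let ?\<theta> = "pi / real (ord (p \<otimes> q))"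
  have "real k * ?\<theta> < real (ord (p \<otimes> q)) * ?\<theta>"
    using assms False by (intro mult_strict_right_mono) auto
  then have "real k * ?\<theta> < pi" using False by simp
  moreover have "real k * ?\<theta> > 0" using assms False by simp
  ultimately have "sin (real k * ?\<theta>) > 0" by (intro sin_gt_zero)
  then show ?thesis using angle(3)[of p q k] angle(2)[of p q] assms False by simp
qed

lemma U_ord:
  assumes "p \<in> S" "q \<in> S" "p \<noteq> q" "ord (p \<otimes> q) \<noteq> 0"
  shows "U p q (ord (p \<otimes> q)) = 0" "U p q (ord (p \<otimes> q) - 1) = 1"
    "U p q (2 * ord (p \<otimes> q)) = 0" "U p q (2 * ord (p \<otimes> q) + 1) = 1"
    "U p q (2 * ord (p \<otimes> q) - 1) = - 1"
proof -
  let ?m = "ord (p \<otimes> q)"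
  define \<theta> where "\<theta> = pi / real ?m"
  note a = angle[OF assms, folded \<theta>_def]
  have m: "?m \<ge> 2" using ord_ge_2 assms by blast
  show "U p q ?m = 0" using a(3)[of ?m] a(4) by simp
  have "real (?m - 1) * \<theta> = pi - \<theta>" using a(4) m by (simp add: of_nat_diff algebra_simps)
  then show "U p q (?m - 1) = 1" using a(2) a(3)[of "?m - 1"] by simp
  have "real (2 * ?m) * \<theta> = 2 * pi" using a(4) by simp
  then show "U p q (2 * ?m) = 0" using a(3)[of "2 * ?m"] by (simp add: mult.assoc del: U_simps)
  have "real (2 * ?m + 1) * \<theta> = \<theta> + 2 * pi" using a(4) by (simp add: algebra_simps)
  then show "U p q (2 * ?m + 1) = 1" using a(2) a(3)[of "2 * ?m + 1"]
    by (simp only: sin_periodic) simp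
  have "real (2 * ?m - 1) * \<theta> = 2 * pi - \<theta>" using a(4) m by (simp add: of_nat_diff algebra_simps)
  then show "U p q (2 * ?m - 1) = - 1" using a(2) a(3)[of "2 * ?m - 1"]
    by (simp only: sin_2pi_minus) simp
qed

text \<open>The reflection in \<open>p\<close> adds \<open>- 2 * b p q\<close> times
  \<open>n p\<close> to \<open>n q\<close>, so prefixing a letter is one step of the Chebyshev
  recursion. The coordinates of dihedral roots are therefore values of \<open>U\<close>, from which
  their signs are read off.\<close>

lemma alt_root:
  assumes "p \<in> S" "q \<in> S"
  shows "fold\<sigma> (alt p q k) (n (next_letter p q k)) = U p q (Suc k) *\<^sub>R n p + U p q k *\<^sub>R n q"
  using assms
proof (induction k arbitrary: p q)
  case (Suc k)
  have *: "\<sigma> p (n q) = n q + (- 2 * b p q) *\<^sub>R n p"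
    using Suc.prems by (simp add: \<sigma>_def bf_n)
  have b: "b q p = b p q" "U q p = U p q" by (rule b_sym, rule U_sym)
  have "fold\<sigma> (alt p q (Suc k)) (n (next_letter p q (Suc k)))
    = \<sigma> p (U q p (Suc k) *\<^sub>R n q + U q p k *\<^sub>R n p)"
    using Suc.IH[of q p] Suc.prems by simp
  also have "\<dots> = U p q (Suc (Suc k)) *\<^sub>R n p + U p q (Suc k) *\<^sub>R n q"
    using Suc.prems by (simp add: * \<sigma>_n b algebra_simps)
  finally show ?case .
qed simp

lemma fold\<sigma>_fixed:
  assumes "\<And>s. s \<in> set u \<Longrightarrow> bf s x = 0" shows "fold\<sigma> u x = x"
  using assms by (induction u) (auto simp: \<sigma>_def)

text \<open>The relator is trivial on the plane of \<open>n p\<close> and \<open>n q\<close> because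
  \<open>U\<close> has period \<open>2 * m\<close>, and on all vectors orthogonal to this plane. For
  finite \<open>m\<close> the form is nondegenerate on the plane, so both parts together span
  everything.\<close>

lemma fold\<sigma>_relator:
  assumes "p \<in> S" "q \<in> S" "p \<noteq> q" "ord (p \<otimes> q) \<noteq> 0"
  shows "fold\<sigma> (alt p q (2 * ord (p \<otimes> q))) x = x"
proof -
  let ?m = "ord (p \<otimes> q)" let ?u = "alt p q (2 * ?m)"
  have m: "?m \<ge> 2" using ord_ge_2 assms by blast
  note U = U_ord[OF assms]
  have p: "fold\<sigma> ?u (n p) = n p"
    using alt_root[OF assms(1,2), of "2 * ?m"] U by (simp add: next_letter_def)
  have u: "?u = alt p q (2 * ?m - 1) @ [q]"
    using alt_Suc_right[of p q "2 * ?m - 1"] m by (simp add: next_letter_def)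
  have "fold\<sigma> (alt p q (2 * ?m - 1)) (n q) = U p q (2 * ?m) *\<^sub>R n p + U p q (2 * ?m - 1) *\<^sub>R n q"
    using alt_root[OF assms(1,2), of "2 * ?m - 1"] m by (simp add: next_letter_def)
  then have q: "fold\<sigma> ?u (n q) = n q"
    unfolding u using assms U by (simp add: \<sigma>_n)
  define \<theta> where "\<theta> = pi / real ?m"
  note a = angle[OF assms, folded \<theta>_def]
  \<comment> \<open>The Gram determinant of \<open>n p\<close> and \<open>n q\<close>, equal to the
    square of \<open>sin \<theta>\<close>. By Cramer's rule \<open>h\<close> and \<open>k\<close>
    are the coordinates of the orthogonal projection of \<open>x\<close> to the plane.\<close>
  define d where "d = 1 - (b p q)\<^sup>2"
  have "b p q = - cos \<theta>" using a(1) by simp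
  then have "d = (sin \<theta>)\<^sup>2" by (simp add: d_def sin_squared_eq)
  then have d: "d \<noteq> 0" using a(2) by simp
  define h where "h = (bf p x - b p q * bf q x) / d"
  define k where "k = (bf q x - b p q * bf p x) / d"
  define z where "z = x - h *\<^sub>R n p - k *\<^sub>R n q"
  have hd: "h * d = bf p x - b p q * bf q x" and kd: "k * d = bf q x - b p q * bf p x"
    using d by (simp_all add: h_def k_def)
  have bb: "b p p = 1" "b q q = 1" "b q p = b p q" using assms b_self b_sym by auto
  have "d * bf p z = d * bf p x - h * d - k * d * b p q"
    using assms by (simp add: z_def bf_n bb algebra_simps)
  also have "\<dots> = 0" unfolding hd kd by (simp add: d_def power2_eq_square algebra_simps)
  finally have zp: "bf p z = 0" using d by simp
  have "d * bf q z = d * bf q x - h * d * b p q - k * d"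
    using assms by (simp add: z_def bf_n bb algebra_simps)
  also have "\<dots> = 0" unfolding hd kd by (simp add: d_def power2_eq_square algebra_simps)
  finally have zq: "bf q z = 0" using d by simp
  have z: "fold\<sigma> ?u z = z" using zp zq set_alt[of p q] by (intro fold\<sigma>_fixed) blast
  have "fold\<sigma> ?u (z + h *\<^sub>R n p + k *\<^sub>R n q) = z + h *\<^sub>R n p + k *\<^sub>R n q"
    by (simp only: fold\<sigma>_linear p q z)
  then show ?thesis by (simp add: z_def)
qed

lemma fold\<sigma>_cong: "coxeter_cong G S u v \<Longrightarrow> fold\<sigma> u = fold\<sigma> v"
proof (induction rule: coxeter_cong.induct)
  case (relator s t x y)
  have "fold\<sigma> (concat (replicate (ord (s \<otimes> t)) [s, t])) z = z" for z
  proof (cases "s = t")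
    case True
    then have "ord (s \<otimes> t) = 1" using relator by simp
    then show ?thesis using relator True by simp
  next
    case False
    then show ?thesis using relator by (simp only: alt_double) (rule fold\<sigma>_relator)
  qed
  then show ?case by auto
qed auto

section \<open>The representation of the group\<close>

definition rho :: "'w \<Rightarrow> 'v \<Rightarrow> 'v" ("\<rho>") where
  "\<rho> w = fold\<sigma> (SOME u. set u \<subseteq> S \<and> wp u = w)"

text \<open>The presentation enters here: words with the same product are congruent, and congruent
  words act equally.\<close>

lemma rho_wp:
  assumes "set u \<subseteq> S" shows "\<rho> (wp u) = fold\<sigma> u"
proof -
  let ?v = "SOME v. set v \<subseteq> S \<and> wp v = wp u"
  have v: "set ?v \<subseteq> S \<and> wp ?v = wp u" by (rule someI[of _ u]) (use assms in simp)
  then have "coxeter_cong G S ?v u" using assms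
    by (intro presentation) (auto simp: in_lists_conv_set subset_iff)
  then show ?thesis unfolding rho_def by (rule fold\<sigma>_cong)
qed

lemma rho_linear [simp]:
  "\<rho> w (x + y) = \<rho> w x + \<rho> w y" "\<rho> w (x - y) = \<rho> w x - \<rho> w y"
  "\<rho> w (r *\<^sub>R x) = r *\<^sub>R \<rho> w x" "\<rho> w (- x) = - \<rho> w x" "\<rho> w 0 = 0"
  unfolding rho_def by (rule fold\<sigma>_linear)+

lemma rho_one [simp]: "\<rho> \<one> x = x"
  using rho_wp[of "[]"] by simp

lemma rho_S [simp]: "s \<in> S \<Longrightarrow> \<rho> s x = \<sigma> s x"
  using rho_wp[of "[s]"] by simp

lemma rho_mult:
  assumes "w \<in> carrier G" "z \<in> carrier G" shows "\<rho> (w \<otimes> z) x = \<rho> w (\<rho> z x)"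
proof -
  obtain u where u: "set u \<subseteq> S" "w = wp u" using assms(1) by (rule carrier_words)
  obtain v where v: "set v \<subseteq> S" "z = wp v" using assms(2) by (rule carrier_words)
  have "w \<otimes> z = wp (u @ v)" using u v by (simp add: wp_append_S)
  then show ?thesis using u v rho_wp[of "u @ v"] rho_wp[of u] rho_wp[of v] by simp
qed

lemma rho_inv [simp]:
  assumes "w \<in> carrier G" shows "\<rho> w (\<rho> (inv w) x) = x" "\<rho> (inv w) (\<rho> w x) = x"
  using rho_mult[of w "inv w" x] rho_mult[of "inv w" w x] assms by simp_all

lemma bil_rho:
  assumes "w \<in> carrier G" shows "bil (\<rho> w x) (\<rho> w y) = bil x y"
proof -
  obtain u where u: "set u \<subseteq> S" "w = wp u" using assms by (rule carrier_words)
  have "bil (fold\<sigma> u x) (fold\<sigma> u y) = bil x y"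
    using u(1) by (induction u) (auto simp: bil_\<sigma>)
  then show ?thesis using u rho_wp by simp
qed

lemma rho_reflection:
  assumes "w \<in> carrier G" "s \<in> S"
  shows "\<rho> (w \<otimes> s \<otimes> inv w) x = x - (2 * bil (\<rho> w (n s)) x) *\<^sub>R \<rho> w (n s)"
proof -
  have "bf s (\<rho> (inv w) x) = bil (\<rho> w (n s)) x"
    using bil_rho[OF assms(1), of "n s" "\<rho> (inv w) x"] assms by (simp add: bil_n_left)
  then show ?thesis using assms by (simp add: rho_mult \<sigma>_def)
qed

section \<open>Positive roots\<close>

definition pos :: "'v \<Rightarrow> bool" where "pos x \<longleftrightarrow> (\<forall>s\<in>S. 0 \<le> cf s x)"

definition root :: "'v \<Rightarrow> bool" where "root x \<longleftrightarrow> (\<exists>w\<in>carrier G. \<exists>s\<in>S. x = \<rho> w (n s))"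

lemma pos_add: "pos x \<Longrightarrow> pos y \<Longrightarrow> pos (x + y)" and pos_scale: "0 \<le> r \<Longrightarrow> pos x \<Longrightarrow> pos (r *\<^sub>R x)"
  and pos_n: "s \<in> S \<Longrightarrow> pos (n s)" and pos_0: "pos 0"
  by (auto simp: pos_def cf_n)

lemma pos_neg_0: "pos x \<Longrightarrow> pos (- x) \<Longrightarrow> x = 0"
  by (intro eq_by_cf) (force simp: pos_def)

section \<open>Dihedral cosets and the positivity criterion\<close>

lemma rho_alt_root:
  assumes "p \<in> S" "q \<in> S"
  shows "\<rho> (wp (alt p q k)) (n (next_letter p q k)) = U p q (Suc k) *\<^sub>R n p + U p q k *\<^sub>R n q"
proof -
  have "\<rho> (wp (alt p q k)) = fold\<sigma> (alt p q k)"
    using set_alt[of p q k] assms by (intro rho_wp) auto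
  then show ?thesis using alt_root[OF assms, of k] by simp
qed

lemma wp_alt_closed [simp]: "p \<in> S \<Longrightarrow> q \<in> S \<Longrightarrow> wp (alt p q k) \<in> carrier G"
  using set_alt[of p q k] by (intro wp_closed_S) auto

lemma alt_S: "p \<in> S \<Longrightarrow> q \<in> S \<Longrightarrow> set (alt p q k) \<subseteq> S"
  using set_alt[of p q k] by auto

lemma next_letter_S [simp]: "p \<in> S \<Longrightarrow> q \<in> S \<Longrightarrow> next_letter p q k \<in> S"
  by (simp add: next_letter_def)

lemma wp_alt_Suc: "p \<in> S \<Longrightarrow> q \<in> S \<Longrightarrow> wp (alt p q (Suc k)) = wp (alt p q k) \<otimes> next_letter p q k"
  by (simp only: alt_Suc_right) (simp add: wp_append_S alt_S)

lemma ord_sym: "p \<in> S \<Longrightarrow> q \<in> S \<Longrightarrow> ord (p \<otimes> q) = ord (q \<otimes> p)"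
  using ord_inv[of "p \<otimes> q"] by (simp add: inv_mult_group)

lemma braid:
  assumes "p \<in> S" "q \<in> S" "p \<noteq> q" "ord (p \<otimes> q) = m"
  shows "wp (alt p q m) = wp (alt q p m)"
proof -
  have "wp (alt p q (2 * k)) = (p \<otimes> q) [^] k" for k
  proof (induction k)
    case (Suc k)
    have "alt p q (2 * Suc k) = alt p q (2 * k) @ [p, q]"
    proof -
      have "alt p q (2 * k + 2) = alt p q (2 * k) @ alt (next_letter p q (2 * k)) (next_letter q p (2 * k)) 2"
        by (rule alt_append)
      moreover have "next_letter p q (2 * k) = p" "next_letter q p (2 * k) = q" by (simp_all add: next_letter_def)
      moreover have "alt p q 2 = [p, q]" by (simp add: numeral_2_eq_2)
      ultimately show ?thesis by (simp only: mult_Suc_right add.commute)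
    qed
    then show ?case using Suc assms by (simp add: wp_append_S alt_S)
  qed simp
  then have "wp (alt p q (m + m)) = \<one>"
    using pow_ord_eq_1[of "p \<otimes> q"] assms by (simp add: mult_2[symmetric])
  moreover have "alt p q (m + m) = alt p q m @ rev (alt q p m)"
    by (simp only: alt_append rev_alt)
  ultimately have "wp (alt p q m) \<otimes> inv (wp (alt q p m)) = \<one>"
    using assms by (simp add: wp_append_S wp_rev alt_S)
  then show ?thesis using assms by (metis inv_equality inv_inv wp_alt_closed inv_closed)
qed

text \<open>Beyond position \<open>m\<close> the braid relation rewrites the first \<open>m\<close>
  letters so that they end in the letter that follows, and these two cancel.\<close>

lemma len_alt_ge:
  assumes "p \<in> S" "q \<in> S" "p \<noteq> q" "ord (p \<otimes> q) \<noteq> 0" "ord (p \<otimes> q) < k"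
  shows "\<ell> (wp (alt p q k)) + 2 \<le> k"
proof -
  let ?m = "ord (p \<otimes> q)"
  have m: "?m \<ge> 2" using ord_ge_2 assms by blast
  then obtain j where j: "?m = Suc j" by (cases ?m) auto
  have "wp (alt p q (Suc ?m)) = wp (alt p q ?m) \<otimes> next_letter p q ?m"
    using assms wp_alt_Suc by simp
  also have "wp (alt p q ?m) = wp (alt q p ?m)" using braid assms by blast
  also have "\<dots> = wp (alt q p j) \<otimes> next_letter q p j" using j assms wp_alt_Suc by simp
  also have "next_letter p q ?m = next_letter q p j" using j by simp
  finally have e: "wp (alt p q (Suc ?m)) = wp (alt q p j)" using assms by simp
  obtain i where i: "k = Suc ?m + i" using assms(5) less_iff_Suc_add by auto
  let ?r = "alt (next_letter p q (Suc ?m)) (next_letter q p (Suc ?m)) i"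
  have "alt p q k = alt p q (Suc ?m) @ ?r" unfolding i by (rule alt_append)
  then have "wp (alt p q k) = wp (alt p q (Suc ?m)) \<otimes> wp ?r"
    using wp_append_S[OF alt_S alt_S] assms by (metis next_letter_S)
  also have "\<dots> = wp (alt q p j @ ?r)"
    unfolding e using wp_append_S[OF alt_S alt_S] assms by (metis next_letter_S)
  finally have "\<ell> (wp (alt p q k)) \<le> j + i"
    using len_le[of "alt q p j @ ?r"] alt_S assms by auto
  then show ?thesis using i j by simp
qed

text \<open>Split off the longest alternating right factor in \<open>s\<close> and \<open>t\<close>
  that ends in \<open>t\<close> and has additive length. Maximality and additivity make
  \<open>z\<close> minimal in its coset, and \<open>\<ell> w < \<ell> (w \<otimes> s)\<close> keeps
  \<open>k\<close> below the length of the braid relation.\<close>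

lemma dihedral_decomp:
  assumes w: "w \<in> carrier G" and st: "s \<in> S" "t \<in> S" "s \<noteq> t"
    and lt: "\<ell> (w \<otimes> t) < \<ell> w" and ls: "\<ell> w < \<ell> (w \<otimes> s)"
  obtains z p q k where "{p, q} = {s, t}" "z \<in> carrier G" "w = z \<otimes> wp (alt p q k)" "\<ell> w = \<ell> z + k"
    "0 < k" "next_letter p q k = s" "next_letter q p k = t" "\<ell> z < \<ell> (z \<otimes> p)" "\<ell> z < \<ell> (z \<otimes> q)"
    "ord (p \<otimes> q) = 0 \<or> k < ord (p \<otimes> q)"
proof -
  define Q where "Q k \<longleftrightarrow> (\<exists>z p q. {p, q} = {s, t} \<and> z \<in> carrier G \<and> w = z \<otimes> wp (alt p q k) \<and>
    \<ell> w = \<ell> z + k \<and> next_letter p q k = s \<and> next_letter q p k = t)" for k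
  have "Q 1"
    unfolding Q_def using w st lt len_mult_S_cases[OF w st(2)]
    by (intro exI[of _ "w \<otimes> t"] exI[of _ t] exI[of _ s]) auto
  moreover have "\<forall>k. Q k \<longrightarrow> k \<le> \<ell> w" by (auto simp: Q_def)
  ultimately obtain k where k: "Q k" "\<And>j. Q j \<Longrightarrow> j \<le> k" "1 \<le> k"
    using Nat.ex_has_greatest_nat[of Q 1 "\<ell> w"] by blast
  then obtain z p q where z: "{p, q} = {s, t}" "z \<in> carrier G" "w = z \<otimes> wp (alt p q k)"
    "\<ell> w = \<ell> z + k" "next_letter p q k = s" "next_letter q p k = t" unfolding Q_def by blast
  have pq: "p \<in> S" "q \<in> S" "p \<noteq> q" using z(1) st by (auto simp: doubleton_eq_iff)
  obtain j where j: "k = Suc j" using k(3) by (cases k) auto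
  have "\<ell> w \<le> \<ell> (z \<otimes> p) + j"
  proof -
    have "w = (z \<otimes> p) \<otimes> wp (alt q p j)" using z pq j by (simp add: m_assoc)
    then have "\<ell> w \<le> \<ell> (z \<otimes> p) + \<ell> (wp (alt q p j))"
      using len_mult_le[of "z \<otimes> p" "wp (alt q p j)"] z(2) pq by simp
    also have "\<ell> (wp (alt q p j)) \<le> j" using len_le[of "alt q p j"] alt_S pq by simp
    finally show ?thesis by simp
  qed
  then have lp: "\<ell> z < \<ell> (z \<otimes> p)" using z j by simp
  have lq: "\<ell> z < \<ell> (z \<otimes> q)"
  proof (rule ccontr)
    assume "\<not> ?thesis"
    then have l: "\<ell> z = \<ell> (z \<otimes> q) + 1" using len_mult_S_cases[of z q] z pq by auto
    have "w = (z \<otimes> q) \<otimes> wp (alt q p (Suc k))" "{q, p} = {s, t}"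
      using z(1-3) pq by (simp_all add: m_assoc insert_commute)
    then have "Q (Suc k)"
      unfolding Q_def using z(2,4-6) pq l next_letter_simps(2) m_closed S_in_carrier by (metis add_Suc_right add_Suc_shift Suc_eq_plus1)
    then show False using k(2) by fastforce
  qed
  have "ord (p \<otimes> q) = 0 \<or> k < ord (p \<otimes> q)"
  proof (rule ccontr)
    assume a: "\<not> ?thesis"
    have "w \<otimes> s = z \<otimes> wp (alt p q (Suc k))"
      using z(2,3,5) pq st by (simp only: wp_alt_Suc) (simp add: m_assoc)
    then have "\<ell> (w \<otimes> s) \<le> \<ell> z + \<ell> (wp (alt p q (Suc k)))" using z pq len_mult_le by (metis wp_alt_closed)
    moreover have "\<ell> (wp (alt p q (Suc k))) + 2 \<le> Suc k"
      using a pq by (intro len_alt_ge) auto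
    ultimately show False using ls z(4) by simp
  qed
  then show thesis using that z lp lq k(3) by simp
qed

text \<open>Split off the dihedral part in \<open>s\<close> and a right descent \<open>t\<close>.
  Then \<open>\<rho> w (n s)\<close> is a combination of \<open>\<rho> z (n p)\<close> and
  \<open>\<rho> z (n q)\<close>, positive by induction as \<open>z\<close> is shorter. The
  coefficients are values of \<open>U\<close> at indices up to \<open>m\<close>, hence
  nonnegative.\<close>

lemma pos_root:
  assumes "w \<in> carrier G" "s \<in> S" "\<ell> w < \<ell> (w \<otimes> s)" shows "pos (\<rho> w (n s))"
  using assms
proof (induction "\<ell> w" arbitrary: w s rule: less_induct)
  case less
  show ?case
  proof (cases "w = \<one>")
    case True
    then show ?thesis using less.prems pos_n by simp
  next
    case False
    obtain u where u: "set u \<subseteq> S" "wp u = w" "length u = \<ell> w"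
      by (rule reduced_exists[OF less.prems(1)])
    then have "u \<noteq> []" using False by auto
    then obtain u' t where ut: "u = u' @ [t]" by (metis append_butlast_last_id)
    have t: "t \<in> S" "set u' \<subseteq> S" using u ut by auto
    have "w \<otimes> t = wp u'" using u t unfolding ut by (auto simp: wp_append_S wp_closed_S)
    then have lt: "\<ell> (w \<otimes> t) < \<ell> w" using len_le[of u'] t u ut by simp
    then have "s \<noteq> t" using less.prems by auto
    from less.prems(1,2) t(1) this lt less.prems(3)
    obtain z p q k where z: "{p, q} = {s, t}" "z \<in> carrier G" "w = z \<otimes> wp (alt p q k)" "\<ell> w = \<ell> z + k"
    "0 < k" "next_letter p q k = s" "next_letter q p k = t" "\<ell> z < \<ell> (z \<otimes> p)" "\<ell> z < \<ell> (z \<otimes> q)"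
    "ord (p \<otimes> q) = 0 \<or> k < ord (p \<otimes> q)" by (rule dihedral_decomp)
    have pq: "p \<in> S" "q \<in> S" "p \<noteq> q"
      using z(1) t less.prems \<open>s \<noteq> t\<close> by (auto simp: doubleton_eq_iff)
    have "pos (\<rho> z (n p))" "pos (\<rho> z (n q))" using less.hyps z pq by auto
    moreover have "\<rho> w (n s) = U p q (Suc k) *\<^sub>R \<rho> z (n p) + U p q k *\<^sub>R \<rho> z (n q)"
      using rho_alt_root[OF pq(1,2), of k] z pq by (simp add: rho_mult del: U_simps)
    moreover have "U p q k \<ge> 0" using U_pos[OF pq, of k] z by simp
    moreover have "U p q (Suc k) \<ge> 0"
    proof (cases "ord (p \<otimes> q) = Suc k")
      case True
      then show ?thesis using U_ord(1)[OF pq] by simp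
    next
      case False
      then show ?thesis using U_pos[OF pq, of "Suc k"] z(10) by linarith
    qed
    ultimately show ?thesis using pos_add pos_scale by simp
  qed
qed

lemma neg_root:
  assumes "w \<in> carrier G" "s \<in> S" "\<ell> (w \<otimes> s) < \<ell> w" shows "pos (- \<rho> w (n s))"
  using pos_root[of "w \<otimes> s" s] assms by (simp add: rho_mult \<sigma>_n)

lemma root_n: "s \<in> S \<Longrightarrow> root (n s)"
  unfolding root_def by (intro bexI[of _ \<one>] bexI[of _ s]) auto

lemma root_rho: "w \<in> carrier G \<Longrightarrow> root x \<Longrightarrow> root (\<rho> w x)"
  unfolding root_def using rho_mult m_closed by metis

lemma bil_root: "root x \<Longrightarrow> bil x x = 1"
  unfolding root_def by (auto simp: bil_rho bil_n_left bf_n b_self)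

lemma root_nonzero: "root x \<Longrightarrow> x \<noteq> 0"
  using bil_root by (force simp: bil_def)

lemma root_cases: "root x \<Longrightarrow> pos x \<or> pos (- x)"
  unfolding root_def using pos_root neg_root len_mult_S_cases
  by (metis less_add_one)

lemma root_not_both: "root x \<Longrightarrow> pos x \<Longrightarrow> \<not> pos (- x)"
  using pos_neg_0 root_nonzero by blast

lemma len_less_iff:
  assumes "w \<in> carrier G" "s \<in> S"
  shows "\<ell> (w \<otimes> s) < \<ell> w \<longleftrightarrow> \<not> pos (\<rho> w (n s))" "\<ell> w < \<ell> (w \<otimes> s) \<longleftrightarrow> pos (\<rho> w (n s))"
  using len_mult_S_cases[OF assms] pos_root[OF assms] neg_root[OF assms]
    root_not_both[OF root_rho[OF assms(1) root_n[OF assms(2)]]] by (metis less_add_one less_irrefl less_asym)+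

text \<open>\<open>lower s w\<close> says that \<open>w \<ge> s\<close> in the weak order.\<close>

definition lower :: "'w \<Rightarrow> 'w \<Rightarrow> bool" where "lower s w \<longleftrightarrow> \<ell> (s \<otimes> w) < \<ell> w"

lemma lower_iff:
  assumes "w \<in> carrier G" "s \<in> S" shows "lower s w \<longleftrightarrow> \<not> pos (\<rho> (inv w) (n s))"
  using len_less_iff(1)[of "inv w" s] assms by (simp add: lower_def len_S_mult)

lemma rho_faithful:
  assumes "w \<in> carrier G" "\<And>s. s \<in> S \<Longrightarrow> \<rho> w (n s) = n s" shows "w = \<one>"
proof (rule ccontr)
  assume a: "w \<noteq> \<one>"
  obtain u where u: "set u \<subseteq> S" "wp u = w" "length u = \<ell> w"
    by (rule reduced_exists[OF assms(1)])
  then have "u \<noteq> []" using a by auto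
  then obtain u' t where ut: "u = u' @ [t]" by (metis append_butlast_last_id)
  have t: "t \<in> S" "set u' \<subseteq> S" using u ut by auto
  have "w \<otimes> t = wp u'" using u t unfolding ut by (auto simp: wp_append_S wp_closed_S)
  then have "\<ell> (w \<otimes> t) < \<ell> w" using len_le[of u'] t u ut by simp
  then show False using len_less_iff(1)[OF assms(1) t(1)] assms(2)[OF t(1)] pos_n t by simp
qed

lemma rho_inj:
  assumes "w \<in> carrier G" "z \<in> carrier G" "\<And>x. \<rho> w x = \<rho> z x" shows "w = z"
proof -
  have "inv z \<otimes> w = \<one>" using assms by (intro rho_faithful) (auto simp: rho_mult)
  then show ?thesis using assms by (metis inv_closed inv_equality inv_inv)
qed

text \<open>Both roots have norm 1, so \<open>r\<close> is 1 or -1, and the formula for the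
  reflection is quadratic in the root.\<close>

lemma reflection_eq:
  assumes "w \<in> carrier G" "s \<in> S" "z \<in> carrier G" "t \<in> S"
    and "\<rho> w (n s) = r *\<^sub>R \<rho> z (n t)"
  shows "w \<otimes> s \<otimes> inv w = z \<otimes> t \<otimes> inv z"
proof (rule rho_inj)
  have rt: "root (\<rho> w (n s))" "root (\<rho> z (n t))" using assms(1-4) by (auto intro: root_rho root_n)
  have "r * r = 1" using bil_root[OF rt(1)] bil_root[OF rt(2)] unfolding assms(5) by simp
  then show "\<rho> (w \<otimes> s \<otimes> inv w) x = \<rho> (z \<otimes> t \<otimes> inv z) x" for x
    using assms by (simp add: rho_reflection mult_ac)
qed (use assms in auto)

lemma root_proportional:
  assumes "root x" "root y" "pos x" "pos y" "x = r *\<^sub>R y" shows "x = y"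
proof -
  have "r * r = 1" using bil_root[OF assms(1)] bil_root[OF assms(2)] unfolding assms(5) by simp
  then have "r = 1 \<or> r = - 1" by (metis power2_eq_square power2_eq_1_iff)
  then show ?thesis using assms root_not_both[of x] by auto
qed

lemma simple_proportional:
  assumes "s \<in> S" "root x" "pos x" "\<And>t. t \<in> S \<Longrightarrow> t \<noteq> s \<Longrightarrow> cf t x = 0" shows "x = n s"
proof -
  have "x = cf s x *\<^sub>R n s" using assms by (intro eq_by_cf) (auto simp: cf_n)
  then show ?thesis using root_proportional[of x "n s"] assms root_n pos_n by blast
qed

text \<open>The root has a positive coordinate at some \<open>t\<close> other than \<open>s\<close>.
  The reflection alters only the coordinate at \<open>s\<close>, and a root with one positive
  coordinate is positive.\<close>

lemma pos_\<sigma>: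
  assumes "root x" "pos x" "s \<in> S" "x \<noteq> n s" shows "pos (\<sigma> s x)"
proof -
  obtain t where t: "t \<in> S" "t \<noteq> s" "cf t x \<noteq> 0" using simple_proportional assms by blast
  then have "cf t (\<sigma> s x) > 0" using cf_\<sigma>[of s t x] assms by (force simp: pos_def)
  then have "\<not> pos (- \<sigma> s x)" using t unfolding pos_def by (auto intro!: bexI[of _ t])
  moreover have "root (\<sigma> s x)" using root_rho[of s x] assms by simp
  ultimately show ?thesis using root_cases by blast
qed

lemma conj_eq_mult:
  assumes "w \<in> carrier G" "s \<in> S" "t \<in> S" "\<rho> w (n s) = n t" shows "t \<otimes> w = w \<otimes> s"
proof -
  have "w \<otimes> s \<otimes> inv w = t"
    using reflection_eq[of w s \<one> t 1] assms by simp
  then have "t \<otimes> w = w \<otimes> s \<otimes> inv w \<otimes> w" by simp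
  then show ?thesis using assms by (simp add: m_assoc)
qed

lemma mult_eq_conj:
  assumes "w \<in> carrier G" "s \<in> S" "t \<in> S" "t \<otimes> w = w \<otimes> s" "\<ell> w < \<ell> (w \<otimes> s)" shows "\<rho> w (n s) = n t"
proof -
  have "\<sigma> t (\<rho> w (n s)) = - \<rho> w (n s)"
    using rho_mult[of t w "n s"] rho_mult[of w s "n s"] assms by (simp add: \<sigma>_n)
  then have "pos (- \<sigma> t (\<rho> w (n s)))" using pos_root assms by simp
  moreover have "root (\<rho> w (n s))" "pos (\<rho> w (n s))" using assms pos_root root_rho root_n by auto
  ultimately show ?thesis
    using pos_\<sigma>[of "\<rho> w (n s)" t] root_not_both[of "\<sigma> t (\<rho> w (n s))"] root_rho[of t "\<rho> w (n s)"] assms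
    by auto
qed

text \<open>The only wall between \<open>w\<close> and \<open>w \<otimes> q\<close> is that of
  \<open>\<rho> w (n q)\<close>; if \<open>n s\<close> changes sign there, it is this root.\<close>

lemma lower_change:
  assumes "w \<in> carrier G" "s \<in> S" "q \<in> S" "\<not> lower s w" "lower s (w \<otimes> q)"
  shows "s \<otimes> w = w \<otimes> q" "\<rho> w (n q) = n s"
proof -
  let ?x = "\<rho> (inv w) (n s)"
  have x: "pos ?x" "root ?x" using assms lower_iff root_rho root_n by auto
  have "\<rho> (inv (w \<otimes> q)) (n s) = \<sigma> q ?x"
    using assms by (simp add: inv_mult_group rho_mult)
  then have "\<not> pos (\<sigma> q ?x)" using assms lower_iff[of "w \<otimes> q" s] by simp
  then have "?x = n q" using pos_\<sigma> x assms by blast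
  then show *: "\<rho> w (n q) = n s" using assms rho_inv(1)[of w "n s"] by simp
  then show "s \<otimes> w = w \<otimes> q" using conj_eq_mult assms by blast
qed

lemma inv_cancel [simp]:
  "x \<in> carrier G \<Longrightarrow> y \<in> carrier G \<Longrightarrow> inv x \<otimes> (x \<otimes> y) = y"
  "x \<in> carrier G \<Longrightarrow> y \<in> carrier G \<Longrightarrow> x \<otimes> (inv x \<otimes> y) = y"
  by (simp_all add: m_assoc[symmetric])

section \<open>Exchange\<close>

text \<open>The strong exchange condition. The root is carried through the word letter by letter; it
  can turn negative only where it has become the simple root of the next letter, and that letter is
  deleted.\<close>

lemma exchange_word:
  assumes "set u \<subseteq> S" "x \<in> carrier G" "s \<in> S" "pos (\<rho> x (n s))" "\<not> pos (\<rho> (inv (wp u)) (\<rho> x (n s)))"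
  shows "\<exists>i<length u. x \<otimes> s \<otimes> inv x \<otimes> wp u = wp (take i u @ drop (Suc i) u)"
  using assms
proof (induction u arbitrary: x)
  case (Cons a v)
  have a: "a \<in> S" "set v \<subseteq> S" "wp v \<in> carrier G" using Cons.prems wp_closed_S by auto
  show ?case
  proof (cases "\<rho> x (n s) = n a")
    case True
    then have "x \<otimes> s \<otimes> inv x = a" using reflection_eq[of x s \<one> a 1] Cons.prems a by simp
    then show ?thesis using a by (intro exI[of _ 0]) simp
  next
    case False
    let ?x = "a \<otimes> x"
    have "\<rho> ?x (n s) = \<sigma> a (\<rho> x (n s))" using a Cons.prems by (simp add: rho_mult)
    moreover have "root (\<rho> x (n s))" using Cons.prems root_rho root_n by blast
    moreover have "\<rho> (inv (wp (a # v))) (\<rho> x (n s)) = \<rho> (inv (wp v)) (\<rho> ?x (n s))"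
      using a Cons.prems by (simp add: inv_mult_group rho_mult)
    ultimately have "pos (\<rho> ?x (n s))" "\<not> pos (\<rho> (inv (wp v)) (\<rho> ?x (n s)))"
      using pos_\<sigma> Cons.prems a False by auto
    then obtain i where i: "i < length v"
      "?x \<otimes> s \<otimes> inv ?x \<otimes> wp v = wp (take i v @ drop (Suc i) v)"
      using Cons.IH[of ?x] Cons.prems a by auto
    have "x \<otimes> s \<otimes> inv x \<otimes> wp (a # v) = a \<otimes> (?x \<otimes> s \<otimes> inv ?x \<otimes> wp v)"
      using a Cons.prems by (simp add: inv_mult_group m_assoc)
    then show ?thesis using i by (intro exI[of _ "Suc i"]) simp
  qed
qed simp

text \<open>A root that is negative at \<open>w\<close> gives a shorter element by exchange. A root
  that is positive at \<open>w\<close> is negative at the reflected element, and the same argument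
  leads back to the shorter \<open>w\<close>.\<close>

lemma len_reflection:
  assumes "x \<in> carrier G" "s \<in> S" "w \<in> carrier G" "pos (\<rho> x (n s))"
  shows "\<ell> (x \<otimes> s \<otimes> inv x \<otimes> w) < \<ell> w \<longleftrightarrow> \<not> pos (\<rho> (inv w) (\<rho> x (n s)))"
proof -
  let ?t = "x \<otimes> s \<otimes> inv x"
  have down: "\<ell> (?t \<otimes> z) < \<ell> z" if z: "z \<in> carrier G" "\<not> pos (\<rho> (inv z) (\<rho> x (n s)))" for z
  proof -
    obtain u where u: "set u \<subseteq> S" "wp u = z" "length u = \<ell> z" by (rule reduced_exists[OF \<open>z \<in> carrier G\<close>])
    then obtain i where "i < length u" "?t \<otimes> wp u = wp (take i u @ drop (Suc i) u)"
      using exchange_word[of u x s] assms z by metis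
    moreover have "set (take i u @ drop (Suc i) u) \<subseteq> S"
      using u set_take_subset[of i u] set_drop_subset[of "Suc i" u] by auto
    ultimately show ?thesis using len_le[of "take i u @ drop (Suc i) u"] u by simp
  qed
  show ?thesis
  proof
    assume l: "\<ell> (?t \<otimes> w) < \<ell> w"
    show "\<not> pos (\<rho> (inv w) (\<rho> x (n s)))"
    proof
      assume p: "pos (\<rho> (inv w) (\<rho> x (n s)))"
      have "inv (?t \<otimes> w) = inv w \<otimes> ?t" using assms by (simp add: inv_mult_group m_assoc)
      then have "\<rho> (inv (?t \<otimes> w)) (\<rho> x (n s)) = - \<rho> (inv w) (\<rho> x (n s))"
        using assms by (simp add: rho_mult \<sigma>_n)
      moreover have "root (\<rho> (inv w) (\<rho> x (n s)))" using assms root_rho root_n by simp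
      ultimately have "\<not> pos (\<rho> (inv (?t \<otimes> w)) (\<rho> x (n s)))" using p root_not_both by metis
      then have "\<ell> (?t \<otimes> (?t \<otimes> w)) < \<ell> (?t \<otimes> w)" using down[of "?t \<otimes> w"] assms by simp
      moreover have "?t \<otimes> (?t \<otimes> w) = w" using assms by (simp add: m_assoc inv_solve_left)
      ultimately show False using l by simp
    qed
  qed (use down assms in blast)
qed

text \<open>A letter put in front either lengthens a reduced word or, by exchange, deletes one of
  its letters. No new letters arise, so elements of \<open>W J\<close> have reduced words in
  \<open>J\<close>.\<close>

lemma reduced_subset:
  assumes "set u \<subseteq> S"
  obtains v where "set v \<subseteq> set u" "wp v = wp u" "length v = \<ell> (wp u)"
  using assms
proof (induction u arbitrary: thesis)
  case (Cons a u)
  then obtain v where v: "set v \<subseteq> set u" "wp v = wp u" "length v = \<ell> (wp u)" by auto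
  have a: "a \<in> S" "set v \<subseteq> S" "wp u \<in> carrier G" using Cons.prems v wp_closed_S by auto
  show ?case
  proof (cases "lower a (wp u)")
    case False
    then have "\<ell> (a \<otimes> wp u) = length (a # v)"
      using len_S_mult_cases[of "wp u" a] a v by (auto simp: lower_def)
    then show ?thesis using Cons.prems(1)[of "a # v"] v by auto
  next
    case True
    then have "\<not> pos (\<rho> (inv (wp v)) (n a))" using lower_iff a v by simp
    then obtain i where i: "i < length v" "a \<otimes> wp v = wp (take i v @ drop (Suc i) v)"
      using exchange_word[of v \<one> a] a pos_n by auto
    have "set (take i v @ drop (Suc i) v) \<subseteq> set (a # u)"
      using v set_take_subset[of i v] set_drop_subset[of "Suc i" v] by auto
    moreover have "length (take i v @ drop (Suc i) v) = \<ell> (a \<otimes> wp u)"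
    proof -
      have "\<ell> (wp u) = \<ell> (a \<otimes> wp u) + 1"
        using True len_S_mult_cases[OF a(3,1)] unfolding lower_def by linarith
      then show ?thesis using i(1) v(3) by simp
    qed
    moreover have "wp (a # u) = wp (take i v @ drop (Suc i) v)" using i v by simp
    ultimately show ?thesis using Cons.prems(1) by (metis wp_Cons)
  qed
qed simp

section \<open>Parabolic subgroups\<close>

abbreviation W :: "'w set \<Rightarrow> 'w set" where "W J \<equiv> generate G J"

lemma W_subset: "J \<subseteq> S \<Longrightarrow> W J \<subseteq> carrier G"
  using generate_incl[of J] S_carrier by auto

lemma W_closed: "J \<subseteq> S \<Longrightarrow> x \<in> W J \<Longrightarrow> x \<in> carrier G"
  using W_subset by blast

lemma W_inv: "J \<subseteq> S \<Longrightarrow> x \<in> W J \<Longrightarrow> inv x \<in> W J"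
  using generate_m_inv_closed[of J x] S_carrier by auto

lemmas W_one = generate.one and W_incl = generate.incl and W_mult = generate.eng

lemma W_mono: "I \<subseteq> J \<Longrightarrow> x \<in> W I \<Longrightarrow> x \<in> W J"
  using mono_generate by blast

lemma W_S: "W S = carrier G" by (rule gen_S)

lemma W_wp: "set u \<subseteq> J \<Longrightarrow> wp u \<in> W J"
  by (induction u) (auto intro: generate.intros)

lemma W_reduced:
  assumes "J \<subseteq> S" "x \<in> W J" obtains u where "set u \<subseteq> J" "wp u = x" "length u = \<ell> x"
proof -
  have "x \<in> wp ` lists J" using assms generate_words[of J] by simp
  then obtain v where "set v \<subseteq> J" "x = wp v" by (auto simp: in_lists_conv_set)
  then show thesis using reduced_subset[of v] assms that by (metis subset_trans)
qed

lemma W_lower: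
  assumes "J \<subseteq> S" "x \<in> W J" "x \<noteq> \<one>" obtains j where "j \<in> J" "lower j x"
proof -
  obtain u where u: "set u \<subseteq> J" "wp u = x" "length u = \<ell> x" by (rule W_reduced[OF assms(1,2)])
  then obtain j v where v: "u = j # v" using assms(3) by (cases u) auto
  then have j: "j \<in> S" "set v \<subseteq> S" "j \<in> J" using u assms(1) by auto
  then have "j \<otimes> x = wp v" using u v wp_closed_S[of v] by auto
  then have "lower j x" using u v j len_le[of v] by (simp add: lower_def)
  then show thesis using that j by blast
qed

lemma len_parabolic: "J \<subseteq> S \<Longrightarrow> x \<in> W J \<Longrightarrow> cox_length G J x = \<ell> x"
proof -
  assume J: "J \<subseteq> S" "x \<in> W J"
  obtain u where u: "set u \<subseteq> J" "wp u = x" "length u = \<ell> x" by (rule W_reduced[OF J])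
  have "\<ell> x \<le> length v" if "v \<in> lists J" "wp v = x" for v
    using len_le[of v] that J(1) by auto
  moreover have "u \<in> lists J" using u(1) by auto
  ultimately show ?thesis
    unfolding cox_length_def[of G J] using u by (intro Least_equality) auto
qed

section \<open>Coset representatives and the projection to a parabolic subgroup\<close>

definition supp :: "'w set \<Rightarrow> 'v \<Rightarrow> bool" where "supp J x \<longleftrightarrow> (\<forall>s\<in>S - J. cf s x = 0)"

lemma supp_simps [simp]:
  "supp J x \<Longrightarrow> supp J y \<Longrightarrow> supp J (x + y)" "supp J x \<Longrightarrow> supp J (r *\<^sub>R x)"
  "supp J (- x) = supp J x" "supp J x \<Longrightarrow> supp J y \<Longrightarrow> supp J (x - y)" "supp S x"
  by (auto simp: supp_def)

lemma supp_n: "j \<in> J \<Longrightarrow> J \<subseteq> S \<Longrightarrow> supp J (n j)"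
  by (auto simp: supp_def cf_n)

lemma supp_mono: "supp J x \<Longrightarrow> J \<subseteq> K \<Longrightarrow> supp K x"
  by (auto simp: supp_def)

text \<open>\<open>W J\<close> acts trivially modulo the span of its simple roots. In particular the
  coordinates outside \<open>J\<close> are left unchanged, which later serves to recognise positive
  roots.\<close>

lemma rho_W_diff:
  assumes "J \<subseteq> S" "x \<in> W J" shows "supp J (\<rho> x y - y)"
proof -
  obtain u where u: "set u \<subseteq> J" "wp u = x" "length u = \<ell> x" by (rule W_reduced[OF assms])
  have "supp J (fold\<sigma> u y - y)" using u(1)
  proof (induction u)
    case Nil
    then show ?case by (simp add: supp_def)
  next
    case (Cons a u)
    have "fold\<sigma> (a # u) y - y = (fold\<sigma> u y - y) - (2 * bf a (fold\<sigma> u y)) *\<^sub>R n a"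
      by (simp add: \<sigma>_def)
    also have "supp J \<dots>" using Cons assms(1) supp_n[of a J] by simp
    finally show ?case .
  qed
  then show ?thesis using u assms(1) rho_wp[of u] by auto
qed

lemma supp_rho:
  assumes "J \<subseteq> S" "x \<in> W J" "supp J y" shows "supp J (\<rho> x y)"
  using supp_simps(1)[OF rho_W_diff[OF assms(1,2), of y] assms(3)] by simp

lemma pos_comb:
  assumes "J \<subseteq> S" "supp J y" "pos y" "\<And>j. j \<in> J \<Longrightarrow> pos (\<rho> x (n j))" shows "pos (\<rho> x y)"
proof -
  have sum: "\<rho> x (\<Sum>s\<in>A. f s *\<^sub>R n s) = (\<Sum>s\<in>A. f s *\<^sub>R \<rho> x (n s))" if "finite A" for A and f :: "'w \<Rightarrow> real"
    using that by induction auto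
  have psum: "pos (\<Sum>s\<in>A. f s)" if "finite A" "\<And>s. s \<in> A \<Longrightarrow> pos (f s)" for A and f :: "'w \<Rightarrow> 'v"
    using that by induction (auto intro: pos_add pos_0)
  have "\<rho> x y = (\<Sum>s\<in>S. cf s y *\<^sub>R \<rho> x (n s))"
    using sum[OF finite_S, of "\<lambda>s. cf s y"] expand[of y] by simp
  moreover have "pos (cf s y *\<^sub>R \<rho> x (n s))" if "s \<in> S" for s
  proof (cases "s \<in> J")
    case True
    then show ?thesis using assms that by (intro pos_scale) (auto simp: pos_def)
  next
    case False
    then show ?thesis using assms(2) that pos_0 by (simp add: supp_def)
  qed
  ultimately show ?thesis using psum[OF finite_S] by simp
qed

text \<open>These are the elements without left descents in \<open>J\<close>, the shortest ones in
  the cosets of \<open>W J\<close>. The form by roots extends at once to all positive vectors in the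
  span of \<open>J\<close>.\<close>

definition Jmin :: "'w set \<Rightarrow> 'w \<Rightarrow> bool" where
  "Jmin J x \<longleftrightarrow> x \<in> carrier G \<and> (\<forall>j\<in>J. pos (\<rho> (inv x) (n j)))"

text \<open>The factor \<open>inv x\<close> preserves the sign of every root in the span of
  \<open>J\<close>, so for such roots the sign at \<open>u \<otimes> x\<close> is the sign at
  \<open>u\<close>.\<close>

lemma Jmin_pos_iff:
  assumes "J \<subseteq> S" "Jmin J x" "u \<in> W J" "root y" "supp J y"
  shows "pos (\<rho> (inv (u \<otimes> x)) y) \<longleftrightarrow> pos (\<rho> (inv u) y)"
proof -
  let ?z = "\<rho> (inv u) y"
  have u: "u \<in> carrier G" "x \<in> carrier G" using assms W_closed[OF assms(1)] by (auto simp: Jmin_def)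
  have e: "\<rho> (inv (u \<otimes> x)) y = \<rho> (inv x) ?z" using u by (simp add: inv_mult_group rho_mult)
  have z: "root ?z" "supp J ?z"
    using assms u root_rho supp_rho[OF assms(1) W_inv[OF assms(1,3)]] by simp_all
  have p: "pos (\<rho> (inv x) z')" if "supp J z'" "pos z'" for z'
    using assms(2) pos_comb[OF assms(1) that] by (simp add: Jmin_def)
  show ?thesis
  proof
    assume "pos (\<rho> (inv (u \<otimes> x)) y)"
    then have "\<not> pos (\<rho> (inv x) (- ?z))" using e root_not_both root_rho[of "inv x" ?z] z u by simp
    then show "pos ?z" using p[of "- ?z"] z root_cases[of ?z] by auto
  qed (use p z e in auto)
qed

lemma Jmin_exists:
  assumes "J \<subseteq> K" "K \<subseteq> S" "w \<in> W K"
  obtains u x where "u \<in> W J" "x \<in> W K" "Jmin J x" "w = u \<otimes> x"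
proof -
  have J: "J \<subseteq> S" using assms by auto
  have w: "w \<in> carrier G" using W_closed[OF assms(2,3)] .
  define u where "u = arg_min (\<lambda>u. \<ell> (inv u \<otimes> w)) (\<lambda>u. u \<in> W J)"
  have u: "u \<in> W J" and um: "\<And>v. v \<in> W J \<Longrightarrow> \<ell> (inv u \<otimes> w) \<le> \<ell> (inv v \<otimes> w)"
    using arg_min_nat_lemma[of "\<lambda>u. u \<in> W J" \<one> "\<lambda>u. \<ell> (inv u \<otimes> w)"] W_one unfolding u_def by auto
  have uc: "u \<in> carrier G" using W_closed[OF J u] .
  let ?x = "inv u \<otimes> w"
  have "pos (\<rho> (inv ?x) (n j))" if j: "j \<in> J" for j
  proof -
    have jS: "j \<in> S" using j J by auto
    have "\<ell> ?x \<le> \<ell> (inv (u \<otimes> j) \<otimes> w)" using um W_mult[OF u W_incl[OF j]] by blast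
    then have "\<not> lower j ?x" using uc w jS by (simp add: lower_def inv_mult_group m_assoc)
    then show ?thesis using lower_iff[of ?x j] uc w jS by simp
  qed
  then have "Jmin J ?x" using uc w by (simp add: Jmin_def)
  moreover have "?x \<in> W K" by (rule W_mult[OF W_mono[OF assms(1) W_inv[OF J u]] assms(3)])
  moreover have "w = u \<otimes> ?x" using uc w by (simp add: m_assoc[symmetric])
  ultimately show thesis using that u by blast
qed

lemma Jmin_unique:
  assumes "J \<subseteq> S" "u \<in> W J" "u' \<in> W J" "Jmin J x" "Jmin J x'" "u \<otimes> x = u' \<otimes> x'"
  shows "u = u'"
proof (rule ccontr)
  assume ne: "u \<noteq> u'"
  have c: "u \<in> carrier G" "u' \<in> carrier G" "x \<in> carrier G" "x' \<in> carrier G"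
    using assms(2-5) W_closed[OF assms(1)] by (simp_all add: Jmin_def)
  let ?g = "inv u' \<otimes> u"
  have g: "?g \<in> W J" by (rule W_mult[OF W_inv[OF assms(1,3)] assms(2)])
  have "?g \<noteq> \<one>" using ne c by (metis inv_equality inv_inv inv_closed)
  then obtain j where j: "j \<in> J" "lower j ?g" by (rule W_lower[OF assms(1) g])
  have jS: "j \<in> S" using j assms by auto
  have "inv u' \<otimes> (u \<otimes> x) = x'" unfolding assms(6) using c by (simp add: m_assoc[symmetric])
  then have "x' = ?g \<otimes> x" using c by (simp add: m_assoc)
  then have "pos (\<rho> (inv x') (n j)) \<longleftrightarrow> pos (\<rho> (inv ?g) (n j))"
    using Jmin_pos_iff[OF assms(1,4) g, of "n j"] root_n supp_n j jS assms by simp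
  moreover have "pos (\<rho> (inv x') (n j))" using assms j by (auto simp: Jmin_def)
  ultimately show False using lower_iff[of ?g j] j c jS by simp
qed

text \<open>The default \<open>w\<close> makes \<open>\<ell> (par J w) \<le> \<ell> w\<close> true
  for all arguments, as the termination proofs of the recursions require.\<close>

definition par :: "'w set \<Rightarrow> 'w \<Rightarrow> 'w" where
  "par J w = (if w \<in> carrier G \<and> J \<subseteq> S then SOME u. u \<in> W J \<and> Jmin J (inv u \<otimes> w) else w)"

lemma par_eq:
  assumes "J \<subseteq> S" "u \<in> W J" "Jmin J x" shows "par J (u \<otimes> x) = u"
proof -
  have c: "u \<in> carrier G" "x \<in> carrier G" using assms W_closed[OF assms(1)] by (auto simp: Jmin_def)
  let ?v = "par J (u \<otimes> x)"
  have "inv u \<otimes> (u \<otimes> x) = x" using c by (simp add: m_assoc[symmetric])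
  then have "?v \<in> W J \<and> Jmin J (inv ?v \<otimes> (u \<otimes> x))"
    using c assms someI[of "\<lambda>v. v \<in> W J \<and> Jmin J (inv v \<otimes> (u \<otimes> x))" u] by (simp add: par_def)
  moreover from this have "?v \<otimes> (inv ?v \<otimes> (u \<otimes> x)) = u \<otimes> x"
    using W_closed[OF assms(1)] c by (simp add: m_assoc[symmetric])
  ultimately show ?thesis using Jmin_unique[OF assms(1) _ assms(2) _ assms(3)] by blast
qed

lemma par_decomp:
  assumes "J \<subseteq> K" "K \<subseteq> S" "w \<in> W K"
  obtains x where "par J w \<in> W J" "x \<in> W K" "Jmin J x" "w = par J w \<otimes> x"
proof -
  obtain u x where "u \<in> W J" "x \<in> W K" "Jmin J x" "w = u \<otimes> x" by (rule Jmin_exists[OF assms])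
  moreover from this have "par J w = u" using par_eq[of J u x] assms by auto
  ultimately show thesis using that[of x] by simp
qed

lemma par_decomp_S:
  assumes "J \<subseteq> S" "w \<in> carrier G"
  obtains x where "par J w \<in> W J" "Jmin J x" "w = par J w \<otimes> x"
  using par_decomp[OF assms(1) subset_refl] assms(2) W_S by metis

lemma par_in: "J \<subseteq> S \<Longrightarrow> w \<in> carrier G \<Longrightarrow> par J w \<in> W J"
  using par_decomp_S by blast

lemma par_closed [simp]: "J \<subseteq> S \<Longrightarrow> w \<in> carrier G \<Longrightarrow> par J w \<in> carrier G"
  using par_in[of J w] W_closed[of J] by blast

lemma Jmin_one: "J \<subseteq> S \<Longrightarrow> Jmin J \<one>"
  by (auto simp: Jmin_def intro: pos_n)

lemma par_id: "J \<subseteq> S \<Longrightarrow> w \<in> W J \<Longrightarrow> par J w = w"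
  using par_eq[of J w \<one>] Jmin_one W_closed by simp

lemma par_pos_iff:
  assumes "J \<subseteq> S" "w \<in> carrier G" "root y" "supp J y"
  shows "pos (\<rho> (inv (par J w)) y) \<longleftrightarrow> pos (\<rho> (inv w) y)"
proof -
  obtain x where "par J w \<in> W J" "Jmin J x" "w = par J w \<otimes> x" by (rule par_decomp_S[OF assms(1,2)])
  then show ?thesis using Jmin_pos_iff[OF assms(1) _ _ assms(3,4)] by metis
qed

lemma lower_par: "J \<subseteq> S \<Longrightarrow> w \<in> carrier G \<Longrightarrow> a \<in> J \<Longrightarrow> lower a (par J w) \<longleftrightarrow> lower a w"
  using par_pos_iff[of J w "n a"] lower_iff[of w a] lower_iff[of "par J w" a] root_n[of a] supp_n[of a J] by auto

lemma par_mult: "J \<subseteq> S \<Longrightarrow> w \<in> carrier G \<Longrightarrow> a \<in> W J \<Longrightarrow> par J (a \<otimes> w) = a \<otimes> par J w"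
proof -
  assume a: "J \<subseteq> S" "w \<in> carrier G" "a \<in> W J"
  obtain x where x: "par J w \<in> W J" "Jmin J x" "w = par J w \<otimes> x" by (rule par_decomp_S[OF a(1,2)])
  then have "a \<otimes> w = (a \<otimes> par J w) \<otimes> x"
    using a W_closed[OF a(1)] by (simp add: m_assoc Jmin_def)
  then show ?thesis using par_eq[OF a(1) W_mult[OF a(3) x(1)] x(2)] by simp
qed

lemma par_par:
  assumes "I \<subseteq> J" "J \<subseteq> S" "w \<in> carrier G" shows "par I (par J w) = par I w"
proof -
  obtain x where x: "par J w \<in> W J" "Jmin J x" "w = par J w \<otimes> x" by (rule par_decomp_S[OF assms(2,3)])
  obtain y where y: "par I (par J w) \<in> W I" "y \<in> W J" "Jmin I y" "par J w = par I (par J w) \<otimes> y"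
    by (rule par_decomp[OF assms(1,2) x(1)])
  have I: "I \<subseteq> S" using assms by auto
  have "pos (\<rho> (inv (y \<otimes> x)) (n i))" if "i \<in> I" for i
  proof -
    have i: "root (n i)" "supp J (n i)" using that assms supp_n root_n by auto
    then show ?thesis using Jmin_pos_iff[OF assms(2) x(2) y(2)] y(3) that by (auto simp: Jmin_def)
  qed
  then have "Jmin I (y \<otimes> x)" using x(2) y(3) by (auto simp: Jmin_def)
  moreover have "w = par I (par J w) \<otimes> (y \<otimes> x)"
    using x y W_closed[OF I y(1)] by (metis Jmin_def m_assoc)
  ultimately show ?thesis using par_eq[OF I y(1)] by metis
qed

lemma len_Jmin:
  assumes "J \<subseteq> S" "u \<in> W J" "Jmin J x" shows "\<ell> (u \<otimes> x) = \<ell> u + \<ell> x"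
proof -
  obtain v where v: "set v \<subseteq> J" "wp v = u" "length v = \<ell> u" by (rule W_reduced[OF assms(1,2)])
  have "length v = \<ell> (wp v) \<Longrightarrow> set v \<subseteq> J \<Longrightarrow> \<ell> (wp v \<otimes> x) = \<ell> (wp v) + \<ell> x"
  proof (induction v)
    case Nil
    then show ?case using assms by (simp add: Jmin_def)
  next
    case (Cons a v)
    have a: "a \<in> S" "a \<in> J" "wp v \<in> carrier G" "x \<in> carrier G" "wp v \<in> W J" "set v \<subseteq> S"
      using Cons.prems assms wp_closed_S[of v] W_wp[of v J] by (auto simp: Jmin_def)
    have l: "length v = \<ell> (wp v)"
      using Cons.prems a len_le[of v] len_S_mult_cases[of "wp v" a] by auto
    then have nl: "\<not> lower a (wp v)" using Cons.prems by (auto simp: lower_def)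
    then have "pos (\<rho> (inv (wp v)) (n a))" using lower_iff a by simp
    then have "pos (\<rho> (inv (wp v \<otimes> x)) (n a))"
      using Jmin_pos_iff[OF assms(1,3) a(5)] root_n supp_n a assms by simp
    then have "\<not> lower a (wp v \<otimes> x)" using lower_iff[of "wp v \<otimes> x" a] a by simp
    then have "\<ell> (a \<otimes> (wp v \<otimes> x)) = \<ell> (wp v \<otimes> x) + 1"
      using len_S_mult_cases[of "wp v \<otimes> x" a] a by (auto simp: lower_def)
    then show ?case using Cons l a by (simp add: m_assoc)
  qed
  then show ?thesis using v by metis
qed

lemma len_par: "\<ell> (par J w) \<le> \<ell> w"
proof (cases "w \<in> carrier G \<and> J \<subseteq> S")
  case True
  then obtain x where "par J w \<in> W J" "Jmin J x" "w = par J w \<otimes> x" using par_decomp_S by blast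
  then show ?thesis using len_Jmin[of J "par J w" x] True by simp
next
  case False
  then show ?thesis by (auto simp: par_def)
qed

text \<open>Let \<open>w = u \<otimes> x\<close> with \<open>x\<close> minimal. Either
  \<open>x \<otimes> q\<close> is still minimal and the edge collapses, or
  \<open>x \<otimes> q = q' \<otimes> x\<close> with \<open>q'\<close> in \<open>J\<close> and the
  edge goes to one with the same root. Whether the root lies in the span of \<open>J\<close> decides
  between the two.\<close>

lemma par_edge:
  assumes "J \<subseteq> S" "w \<in> carrier G" "q \<in> S" "\<ell> w < \<ell> (w \<otimes> q)"
  shows "supp J (\<rho> w (n q)) \<Longrightarrow> \<exists>q'\<in>J. par J (w \<otimes> q) = par J w \<otimes> q' \<and> \<rho> (par J w) (n q') = \<rho> w (n q)"
    and "\<not> supp J (\<rho> w (n q)) \<Longrightarrow> par J (w \<otimes> q) = par J w"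
proof -
  obtain x where x: "par J w \<in> W J" "Jmin J x" "w = par J w \<otimes> x" by (rule par_decomp_S[OF assms(1,2)])
  let ?u = "par J w"
  have c: "?u \<in> carrier G" "x \<in> carrier G" using x W_closed[OF assms(1)] by (auto simp: Jmin_def)
  have wq: "w \<otimes> q = ?u \<otimes> (x \<otimes> q)" using x(3) c assms by (metis S_in_carrier m_assoc)
  have rw: "\<rho> w (n q) = \<rho> ?u (\<rho> x (n q))" using x(3) c rho_mult by metis
  have dichotomy: "Jmin J (x \<otimes> q) \<or> (\<exists>q'\<in>J. q' \<otimes> x = x \<otimes> q \<and> \<rho> x (n q) = n q')"
  proof (cases "Jmin J (x \<otimes> q)")
    case False
    then obtain j where j: "j \<in> J" "\<not> pos (\<rho> (inv (x \<otimes> q)) (n j))" using c assms by (auto simp: Jmin_def)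
    then have "\<not> lower j x" "lower j (x \<otimes> q)"
      using x(2) c assms lower_iff by (auto simp: Jmin_def)
    then show ?thesis using lower_change[of x j q] j c assms by auto
  qed simp
  have lx: "\<ell> x < \<ell> (x \<otimes> q)"
  proof -
    have "\<ell> (w \<otimes> q) \<le> \<ell> ?u + \<ell> (x \<otimes> q)" unfolding wq using len_mult_le c assms by simp
    moreover have "\<ell> w = \<ell> ?u + \<ell> x" using len_Jmin[OF assms(1) x(1,2)] x(3) by simp
    ultimately show ?thesis using assms(4) by simp
  qed
  have nosupp: "\<not> supp J (\<rho> w (n q))" if m: "Jmin J (x \<otimes> q)"
  proof
    assume "supp J (\<rho> w (n q))"
    then have "supp J (\<rho> (inv ?u) (\<rho> w (n q)))" using supp_rho[OF assms(1) W_inv[OF assms(1) x(1)]] by blast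
    then have s: "supp J (\<rho> x (n q))" using rw c by simp
    have p: "pos (\<rho> x (n q))" using lx len_less_iff c assms by blast
    have "pos (\<rho> (inv (x \<otimes> q)) (\<rho> x (n q)))"
      using m by (intro pos_comb[OF assms(1) s p]) (auto simp: Jmin_def)
    then have "pos (- n q)" using c assms by (simp add: inv_mult_group rho_mult \<sigma>_n)
    then show False using root_not_both[OF root_n pos_n] assms by blast
  qed
  show "\<exists>q'\<in>J. par J (w \<otimes> q) = ?u \<otimes> q' \<and> \<rho> ?u (n q') = \<rho> w (n q)" if "supp J (\<rho> w (n q))"
  proof -
    obtain q' where q: "q' \<in> J" "q' \<otimes> x = x \<otimes> q" "\<rho> x (n q) = n q'"
      using dichotomy nosupp \<open>supp J (\<rho> w (n q))\<close> by metis
    then have "w \<otimes> q = (?u \<otimes> q') \<otimes> x" using wq c assms by (metis S_in_carrier m_assoc subsetD)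
    then have "par J (w \<otimes> q) = ?u \<otimes> q'"
      using par_eq[OF assms(1) W_mult[OF x(1) W_incl[OF q(1)]] x(2)] by simp
    then show ?thesis using q rw by auto
  qed
  show "par J (w \<otimes> q) = ?u" if "\<not> supp J (\<rho> w (n q))"
  proof -
    have "Jmin J (x \<otimes> q)"
    proof (rule ccontr)
      assume "\<not> Jmin J (x \<otimes> q)"
      then obtain q' where q: "q' \<in> J" "\<rho> x (n q) = n q'" using dichotomy by blast
      then have "supp J (\<rho> w (n q))"
        using rw supp_rho[OF assms(1) x(1)] supp_n[OF q(1) assms(1)] by simp
      then show False using that by simp
    qed
    then show ?thesis unfolding wq using par_eq[OF assms(1) x(1)] by blast
  qed
qed

lemma par_adjacent:
  assumes "J \<subseteq> S" "w \<in> carrier G" "q \<in> S"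
  shows "par J (w \<otimes> q) = par J w \<or> (\<exists>q'\<in>J. par J (w \<otimes> q) = par J w \<otimes> q')"
proof (cases "\<ell> w < \<ell> (w \<otimes> q)")
  case True
  then show ?thesis using par_edge[OF assms] by blast
next
  case False
  then have l: "\<ell> (w \<otimes> q) < \<ell> (w \<otimes> q \<otimes> q)" using len_mult_S_cases[OF assms(2,3)] assms by auto
  have c: "w \<otimes> q \<in> carrier G" using assms by simp
  have "par J w = par J (w \<otimes> q) \<or> (\<exists>q'\<in>J. par J w = par J (w \<otimes> q) \<otimes> q')"
    using par_edge[OF assms(1) c assms(3) l] assms by auto
  moreover have "par J (w \<otimes> q) = par J w \<otimes> q'" if "q' \<in> J" "par J w = par J (w \<otimes> q) \<otimes> q'" for q'
    using that c assms by (simp add: subset_iff)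
  ultimately show ?thesis by metis
qed

section \<open>The projection along a Coxeter word\<close>

text \<open>The first letter of the word is the chosen initial letter, and the rotated word is a
  word for \<open>scs\<close>. Rotation shortens \<open>w\<close>, restriction shortens the word, so
  the sum of the lengths decreases.\<close>

function proj :: "'w list \<Rightarrow> 'w \<Rightarrow> 'w" where
  "proj [] w = \<one>"
| "proj (s # cs) w = (if lower s w then s \<otimes> proj (cs @ [s]) (s \<otimes> w) else proj cs (par (set cs) w))"
  by pat_completeness auto
termination
  by (relation "measure (\<lambda>(cs, w). length cs + \<ell> w)") (auto simp: lower_def intro: le_imp_less_Suc len_par)

declare proj.simps(2) [simp del]

lemma proj_lower: "lower s w \<Longrightarrow> proj (s # cs) w = s \<otimes> proj (cs @ [s]) (s \<otimes> w)"
  and proj_not_lower: "\<not> lower s w \<Longrightarrow> proj (s # cs) w = proj cs (par (set cs) w)"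
  by (simp_all add: proj.simps(2))

definition cox_word :: "'w list \<Rightarrow> bool" where "cox_word cs \<longleftrightarrow> distinct cs \<and> set cs \<subseteq> S"

lemma cox_word_Cons: "cox_word (s # cs) \<longleftrightarrow> s \<in> S \<and> s \<notin> set cs \<and> cox_word cs"
  and cox_word_rotate: "cox_word (s # cs) \<Longrightarrow> cox_word (cs @ [s])"
  and cox_word_filter: "cox_word cs \<Longrightarrow> cox_word (filter P cs)"
  and cox_word_subset: "cox_word cs \<Longrightarrow> set cs \<subseteq> S"
  by (auto simp: cox_word_def)

lemma cox_word_W: "cox_word cs \<Longrightarrow> w \<in> W (set cs) \<Longrightarrow> w \<in> carrier G"
  using W_closed[OF cox_word_subset] by blast

lemma cox_word_ctx:
  assumes "cox_word (s # cs)" "w \<in> W (set (s # cs))"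
  shows "w \<in> carrier G" "s \<in> S" "s \<notin> set cs" "cox_word cs" "set cs \<subseteq> S"
  using cox_word_W[OF assms] assms(1) by (auto simp: cox_word_def)

lemma W_Cons_mult: "w \<in> W (set (s # cs)) \<Longrightarrow> s \<otimes> w \<in> W (set (cs @ [s]))"
  using W_mult[OF W_incl[of s "set (s # cs)"]] by simp

lemma supp_\<sigma>: "s \<in> J \<Longrightarrow> J \<subseteq> S \<Longrightarrow> supp J y \<Longrightarrow> supp J (\<sigma> s y)"
  unfolding \<sigma>_def by (intro supp_simps supp_n)

lemma proj_in:
  "cox_word cs \<Longrightarrow> w \<in> W (set cs) \<Longrightarrow> proj cs w \<in> W (set cs)"
proof (induction cs w rule: proj.induct)
  case (1 w)
  then show ?case by (simp add: W_one)
next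
  case (2 s cs w)
  have c: "w \<in> carrier G" using W_closed[OF cox_word_subset] 2 by blast
  show ?case
  proof (cases "lower s w")
    case True
    have "proj (cs @ [s]) (s \<otimes> w) \<in> W (set (cs @ [s]))"
      using 2(1)[OF True cox_word_rotate W_Cons_mult] 2(3,4) by blast
    then show ?thesis using True W_mult[OF W_incl[of s "set (s # cs)"]] by (simp add: proj_lower)
  next
    case False
    have "proj cs (par (set cs) w) \<in> W (set cs)"
      using 2(2)[OF False] 2(3) par_in[OF _ c] by (auto simp: cox_word_Cons cox_word_def)
    then have "proj cs (par (set cs) w) \<in> W (set (s # cs))" using W_mono[of "set cs" "set (s # cs)"] by auto
    then show ?thesis using False by (simp add: proj_not_lower)
  qed
qed

lemma proj_carrier [simp]: "cox_word cs \<Longrightarrow> w \<in> W (set cs) \<Longrightarrow> proj cs w \<in> carrier G"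
  using proj_in W_closed[OF cox_word_subset] by blast

lemma cf_rho_W:
  assumes "J \<subseteq> S" "u \<in> W J" "s \<in> S - J" shows "cf s (\<rho> u y) = cf s y"
  using rho_W_diff[OF assms(1,2), of y] assms(3) by (auto simp: supp_def)

lemma pos_by_coord: "root x \<Longrightarrow> s \<in> S \<Longrightarrow> cf s x > 0 \<Longrightarrow> pos x"
  using root_cases[of x] by (force simp: pos_def)

lemma supp_Cons: "supp (set (s # cs)) x \<Longrightarrow> s \<in> S \<Longrightarrow> \<not> supp (set cs) x \<Longrightarrow> cf s x \<noteq> 0"
  by (force simp: supp_def)

text \<open>This is \<open>proj cs w \<le> w\<close> in terms of roots. When \<open>s\<close> is
  dropped, a positive root outside the smaller span has a positive coordinate at \<open>s\<close>,
  which the smaller group does not alter.\<close>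

lemma proj_below:
  "cox_word cs \<Longrightarrow> w \<in> W (set cs) \<Longrightarrow> root y \<Longrightarrow> pos y \<Longrightarrow> supp (set cs) y \<Longrightarrow> pos (\<rho> (inv w) y)
    \<Longrightarrow> pos (\<rho> (inv (proj cs w)) y)"
proof (induction cs w arbitrary: y rule: proj.induct)
  case (1 w)
  then show ?case by simp
next
  case (2 s cs w)
  note c = cox_word_ctx[OF 2(3,4)]
  show ?case
  proof (cases "lower s w")
    case True
    have sw: "s \<otimes> w \<in> W (set (cs @ [s]))" using 2(4) W_Cons_mult by blast
    have g: "cox_word (cs @ [s])" using 2(3) cox_word_rotate by blast
    let ?v = "proj (cs @ [s]) (s \<otimes> w)"
    have v: "?v \<in> carrier G" using proj_carrier g sw by blast
    have ne: "y \<noteq> n s" using 2(8) True lower_iff c by auto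
    have "pos (\<rho> (inv ?v) (\<sigma> s y))"
    proof (rule 2(1)[OF True g sw])
      show "root (\<sigma> s y)" using root_rho[of s y] c 2(5) by simp
      show "pos (\<sigma> s y)" using pos_\<sigma> ne c 2 by blast
      show "supp (set (cs @ [s])) (\<sigma> s y)"
        using supp_\<sigma>[of s "set (s # cs)" y] c 2(7) by simp
      show "pos (\<rho> (inv (s \<otimes> w)) (\<sigma> s y))" using 2(8) c by (simp add: inv_mult_group rho_mult)
    qed
    then show ?thesis using True v c by (simp add: proj_lower inv_mult_group rho_mult)
  next
    case False
    have pin: "par (set cs) w \<in> W (set cs)" using par_in c by blast
    let ?v = "proj cs (par (set cs) w)"
    have v: "?v \<in> W (set cs)" using proj_in c pin by blast
    show ?thesis
    proof (cases "supp (set cs) y")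
      case True
      then have "pos (\<rho> (inv (par (set cs) w)) y)" using par_pos_iff[OF c(5,1) 2(5)] 2(8) by blast
      then show ?thesis using 2(2)[OF False c(4) pin 2(5,6) True] False by (simp add: proj_not_lower)
    next
      case nsupp: False
      then have "cf s y > 0" using supp_Cons[OF 2(7)] 2(6) c by (force simp: pos_def)
      then have "cf s (\<rho> (inv ?v) y) > 0" using cf_rho_W[OF c(5) W_inv[OF c(5) v]] c by simp
      moreover have "root (\<rho> (inv ?v) y)" using root_rho 2(5) W_closed[OF c(5) v] by simp
      ultimately show ?thesis using pos_by_coord c False by (simp add: proj_not_lower)
    qed
  qed
qed

lemma not_lower_W: "J \<subseteq> S \<Longrightarrow> s \<in> S - J \<Longrightarrow> u \<in> W J \<Longrightarrow> \<not> lower s u"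
  using lower_iff[of u s] W_closed[of J u] cf_rho_W[OF _ W_inv, of J u s "n s"]
    pos_by_coord[OF root_rho[OF _ root_n], of "inv u" s s] by (auto simp: cf_n)

lemma lower_mult_self: "w \<in> carrier G \<Longrightarrow> s \<in> S \<Longrightarrow> lower s (s \<otimes> w) \<longleftrightarrow> \<not> lower s w"
  using len_S_mult_cases[of w s] by (auto simp: lower_def)

lemma proj_not_lower_step:
  assumes "cox_word (s # cs)" "w \<in> W (set (s # cs))" "lower s w"
  shows "\<not> lower s (proj (cs @ [s]) (s \<otimes> w))"
proof -
  note c = cox_word_ctx[OF assms(1,2)]
  have g: "cox_word (cs @ [s])" "s \<otimes> w \<in> W (set (cs @ [s]))" using assms cox_word_rotate W_Cons_mult by auto
  have "\<not> lower s (s \<otimes> w)" using lower_mult_self c assms by blast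
  then have "pos (\<rho> (inv (proj (cs @ [s]) (s \<otimes> w))) (n s))"
    using g c lower_iff[of "s \<otimes> w" s] root_n pos_n supp_n[of s "set (cs @ [s])"] cox_word_subset
    by (intro proj_below) auto
  then show ?thesis using lower_iff g c by simp
qed

text \<open>Consequently two elements of one fibre take the same branch of the recursion.\<close>

lemma lower_proj:
  assumes "cox_word (s # cs)" "w \<in> W (set (s # cs))"
  shows "lower s (proj (s # cs) w) \<longleftrightarrow> lower s w"
proof (cases "lower s w")
  case True
  have "s \<in> S" "proj (cs @ [s]) (s \<otimes> w) \<in> carrier G"
    using assms cox_word_rotate W_Cons_mult proj_carrier cox_word_Cons by blast+
  then show ?thesis
    using proj_not_lower_step[OF assms True] True lower_mult_self by (simp add: proj_lower)
next
  case False
  note c = cox_word_ctx[OF assms]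
  have "proj cs (par (set cs) w) \<in> W (set cs)" using proj_in par_in c by blast
  then show ?thesis using not_lower_W c False by (auto simp: proj_not_lower)
qed

definition same_fibre :: "'w list \<Rightarrow> 'w \<Rightarrow> 'w \<Rightarrow> bool" where "same_fibre cs w z \<longleftrightarrow> proj cs w = proj cs z"

lemma same_refl [simp]: "same_fibre cs w w"
  by (simp add: same_fibre_def)

lemma same_lower_iff:
  "cox_word (s # cs) \<Longrightarrow> w \<in> W (set (s # cs)) \<Longrightarrow> z \<in> W (set (s # cs)) \<Longrightarrow> same_fibre (s # cs) w z
    \<Longrightarrow> lower s w \<longleftrightarrow> lower s z"
  using lower_proj unfolding same_fibre_def by metis

lemma same_lower:
  assumes "cox_word (s # cs)" "w \<in> W (set (s # cs))" "z \<in> W (set (s # cs))" "lower s w" "lower s z"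
  shows "same_fibre (s # cs) w z \<longleftrightarrow> same_fibre (cs @ [s]) (s \<otimes> w) (s \<otimes> z)"
  using assms cox_word_rotate W_Cons_mult proj_carrier[of "cs @ [s]"] cox_word_Cons
  unfolding same_fibre_def proj_lower[OF assms(4)] proj_lower[OF assms(5)]
  by (metis S_in_carrier S_cancel_left)

lemma same_not_lower:
  "\<not> lower s w \<Longrightarrow> \<not> lower s z \<Longrightarrow> same_fibre (s # cs) w z \<longleftrightarrow> same_fibre cs (par (set cs) w) (par (set cs) z)"
  by (simp add: same_fibre_def proj_not_lower)

section \<open>The skew form of a Coxeter word\<close>

text \<open>The antisymmetric companion of the form: on the simple roots of two letters
  \<open>s\<close>, \<open>t\<close> of a Coxeter word the value is \<open>- b s t\<close> if
  \<open>s\<close> comes before \<open>t\<close> and \<open>b s t\<close> if it comes after. As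
  \<open>b s t \<le> 0\<close>, the sign records the order of the letters.\<close>

primrec skew :: "'w list \<Rightarrow> 'v \<Rightarrow> 'v \<Rightarrow> real" where
  "skew [] x y = 0"
| "skew (s # cs) x y = skew cs x y - (\<Sum>t\<in>set cs. b s t * (cf s x * cf t y - cf t x * cf s y))"

lemma skew_snoc:
  "cox_word (s # cs) \<Longrightarrow>
    skew (cs @ [s]) x y = skew cs x y + (\<Sum>t\<in>set cs. b s t * (cf s x * cf t y - cf t x * cf s y))"
proof (induction cs)
  case (Cons a cs)
  have "cox_word (s # cs)" "a \<notin> set cs" "s \<notin> set cs" using Cons.prems by (auto simp: cox_word_def)
  then show ?case using Cons.IH by (simp add: b_sym[of a s] algebra_simps)
qed simp

lemma skew_cong:
  "(\<And>t. t \<in> set cs \<Longrightarrow> cf t x = cf t x') \<Longrightarrow> (\<And>t. t \<in> set cs \<Longrightarrow> cf t y = cf t y') \<Longrightarrow> skew cs x y = skew cs x' y'"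
proof (induction cs)
  case (Cons a cs)
  have "skew cs x y = skew cs x' y'" using Cons by simp
  moreover have "(\<Sum>t\<in>set cs. b a t * (cf a x * cf t y - cf t x * cf a y)) =
    (\<Sum>t\<in>set cs. b a t * (cf a x' * cf t y' - cf t x' * cf a y'))"
    using Cons.prems by (intro sum.cong) auto
  ultimately show ?case by simp
qed simp

lemma bf_supp:
  assumes "cox_word (s # cs)" "supp (set (s # cs)) x"
  shows "bf s x = cf s x + (\<Sum>t\<in>set cs. b s t * cf t x)"
proof -
  have c: "s \<in> S" "s \<notin> set cs" "set cs \<subseteq> S" using assms by (auto simp: cox_word_def)
  have "bf s x = (\<Sum>t\<in>set (s # cs). b s t * cf t x)"
    unfolding bf_def using assms c finite_S by (intro sum.mono_neutral_right) (auto simp: supp_def)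
  then show ?thesis using c by (simp add: b_self)
qed

text \<open>The reflection changes only the coordinate at \<open>s\<close>, by twice the pairing
  with \<open>n s\<close>; moving \<open>s\<close> to the end reverses the sign of the terms of
  \<open>s\<close>. The two changes cancel, so the orientation survives the recursion.\<close>

lemma skew_rotate:
  assumes "cox_word (s # cs)" "supp (set (s # cs)) x" "supp (set (s # cs)) y"
  shows "skew (cs @ [s]) (\<sigma> s x) (\<sigma> s y) = skew (s # cs) x y"
proof -
  have c: "s \<in> S" "s \<notin> set cs" "set cs \<subseteq> S" using assms by (auto simp: cox_word_def)
  have cft: "cf t (\<sigma> s z) = cf t z" if "t \<in> set cs" for t z
    using that c cf_\<sigma>[of s t z] by auto
  have *: "(\<Sum>t\<in>set cs. b s t * (g * cf t y' - cf t x' * h)) =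
      g * (\<Sum>t\<in>set cs. b s t * cf t y') - h * (\<Sum>t\<in>set cs. b s t * cf t x')" for g h x' y'
    by (simp add: sum_distrib_left sum_subtractf algebra_simps)
  have s: "(\<Sum>t\<in>set cs. b s t * cf t (\<sigma> s z)) = (\<Sum>t\<in>set cs. b s t * cf t z)" for z
    using cft by simp
  have "skew cs (\<sigma> s x) (\<sigma> s y) = skew cs x y" using cft by (intro skew_cong)
  then show ?thesis
    unfolding skew_snoc[OF assms(1)] skew.simps * s
    using bf_supp[OF assms(1,2)] bf_supp[OF assms(1,3)] c by (simp add: cf_\<sigma>_self algebra_simps)
qed

lemma skew_restrict: "s \<in> S \<Longrightarrow> s \<notin> set cs \<Longrightarrow> supp (set cs) x \<Longrightarrow> supp (set cs) y \<Longrightarrow> skew (s # cs) x y = skew cs x y"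
  by (simp add: supp_def)

lemma b_nonpos: "s \<in> S \<Longrightarrow> t \<in> S \<Longrightarrow> s \<noteq> t \<Longrightarrow> b s t \<le> 0"
proof (cases "ord (s \<otimes> t) = 0")
  case False
  assume a: "s \<in> S" "t \<in> S" "s \<noteq> t"
  have "ord (s \<otimes> t) \<ge> 2" using ord_ge_2 a False by blast
  then have "pi / real (ord (s \<otimes> t)) \<le> pi / 2" by (intro divide_left_mono) auto
  moreover have "pi / real (ord (s \<otimes> t)) \<ge> 0" by simp
  ultimately have "cos (pi / real (ord (s \<otimes> t))) \<ge> 0"
    using pi_ge_zero by (intro cos_ge_zero) linarith+
  then show ?thesis using b_finite a False by simp
qed (use b_infinite in force)

lemma sum_b_nonpos: "cox_word (s # cs) \<Longrightarrow> pos x \<Longrightarrow> (\<Sum>t\<in>set cs. b s t * cf t x) \<le> 0"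
  by (intro sum_nonpos mult_nonpos_nonneg) (auto simp: cox_word_def pos_def intro!: b_nonpos)

lemma skew_n:
  assumes "cox_word (s # cs)"
  shows "skew cs x (n s) = 0" "skew (cs @ [s]) x (n s) = - (\<Sum>t\<in>set cs. b s t * cf t x)"
    "skew (s # cs) x (n s) = (\<Sum>t\<in>set cs. b s t * cf t x)"
proof -
  have c: "s \<in> S" "s \<notin> set cs" "set cs \<subseteq> S" using assms by (auto simp: cox_word_def)
  have z: "cf t (n s) = 0" if "t \<in> set cs" for t using that c cf_n[of t s] by auto
  have "skew cs x (n s) = skew cs x 0" using z c by (intro skew_cong) auto
  also have "\<dots> = 0" using c(3) by (induction cs) (auto intro!: sum.neutral)
  finally show o: "skew cs x (n s) = 0" .
  have "(\<Sum>t\<in>set cs. b s t * (cf s x * cf t (n s) - cf t x * cf s (n s))) = - (\<Sum>t\<in>set cs. b s t * cf t x)"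
    using z c by (simp add: cf_n sum_negf)
  then show "skew (cs @ [s]) x (n s) = - (\<Sum>t\<in>set cs. b s t * cf t x)"
    "skew (s # cs) x (n s) = (\<Sum>t\<in>set cs. b s t * cf t x)"
    using o skew_snoc[OF assms] by simp_all
qed

lemma skew_final: "cox_word (s # cs) \<Longrightarrow> pos x \<Longrightarrow> skew (cs @ [s]) x (n s) \<ge> 0"
  using skew_n sum_b_nonpos by simp

text \<open>For \<open>s\<close> in first place the value is at most 0. If it is 0, the pairing with
  \<open>n s\<close> equals the coordinate at \<open>s\<close>, which the reflection then negates;
  both signs being nonnegative, it vanishes. So an initial simple root comes second in an oriented
  pair only if the pair is orthogonal.\<close>

lemma skew_initial:
  assumes "cox_word (s # cs)" "root x" "pos x" "supp (set (s # cs)) x" "x \<noteq> n s" "skew (s # cs) x (n s) \<ge> 0"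
  shows "bil (n s) x = 0"
proof -
  have s: "s \<in> S" using assms by (simp add: cox_word_Cons)
  have "(\<Sum>t\<in>set cs. b s t * cf t x) = 0"
    using sum_b_nonpos[OF assms(1,3)] assms(6) unfolding skew_n(3)[OF assms(1)] by simp
  then have bf: "bf s x = cf s x" using bf_supp[OF assms(1,4)] by simp
  have "pos (\<sigma> s x)" using pos_\<sigma> assms s by blast
  then have "cf s x - 2 * cf s x \<ge> 0" using cf_\<sigma>_self[OF s, of x] bf s by (force simp: pos_def)
  moreover have "cf s x \<ge> 0" using assms(3) s by (simp add: pos_def)
  ultimately show ?thesis using bf s by (simp add: bil_n_left)
qed

section \<open>Rank two intervals\<close>

text \<open>
  \<open>base x q r\<close>: \<open>x\<close> is the least element of its coset by the subgroup generated by
  \<open>q\<close> and \<open>r\<close>; \<open>chain x q r\<close> runs up the side of the coset through \<open>x \<otimes> q\<close>.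
\<close>

definition base :: "'w \<Rightarrow> 'w \<Rightarrow> 'w \<Rightarrow> bool" where
  "base x q r \<longleftrightarrow> x \<in> carrier G \<and> q \<in> S \<and> r \<in> S \<and> q \<noteq> r \<and> \<ell> x < \<ell> (x \<otimes> q) \<and> \<ell> x < \<ell> (x \<otimes> r)"

definition chain :: "'w \<Rightarrow> 'w \<Rightarrow> 'w \<Rightarrow> nat \<Rightarrow> 'w" where
  "chain x q r k = x \<otimes> wp (alt q r k)"

lemma base_sym: "base x q r \<Longrightarrow> base x r q"
  by (auto simp: base_def)

lemma chain_closed [simp]: "base x q r \<Longrightarrow> chain x q r k \<in> carrier G"
  by (simp add: base_def chain_def)

lemma chain_0: "base x q r \<Longrightarrow> chain x q r 0 = x" and chain_1: "base x q r \<Longrightarrow> chain x q r (Suc 0) = x \<otimes> q"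
  by (simp_all add: base_def chain_def)

lemma chain_Suc: "base x q r \<Longrightarrow> chain x q r (Suc k) = chain x q r k \<otimes> next_letter q r k"
  unfolding chain_def base_def by (simp only: wp_alt_Suc) (simp add: m_assoc)

lemma chain_Suc_left: "base x q r \<Longrightarrow> chain x q r (Suc k) = x \<otimes> q \<otimes> wp (alt r q k)"
  unfolding chain_def base_def by (simp add: m_assoc)

lemma chain_top: "base x q r \<Longrightarrow> chain x q r (ord (q \<otimes> r)) = chain x r q (ord (q \<otimes> r))"
  unfolding chain_def base_def using braid[of q r] by simp

lemma chain_root:
  assumes "base x q r"
  shows "\<rho> (chain x q r k) (n (next_letter q r k)) = U q r (Suc k) *\<^sub>R \<rho> x (n q) + U q r k *\<^sub>R \<rho> x (n r)"
  using assms rho_alt_root[of q r k] unfolding chain_def base_def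
  by (simp add: rho_mult del: U_simps)

lemma base_roots:
  assumes "base x q r"
  shows "root (\<rho> x (n q))" "root (\<rho> x (n r))" "pos (\<rho> x (n q))" "pos (\<rho> x (n r))"
  using assms pos_root root_rho root_n by (auto simp: base_def)

lemma U_nonneg: "base x q r \<Longrightarrow> k \<le> ord (q \<otimes> r) \<Longrightarrow> U q r k \<ge> 0"
proof (cases "k = 0 \<or> k = ord (q \<otimes> r)")
  case True
  moreover assume "base x q r"
  ultimately have "U q r k = 0" using U_ord(1)[of q r] unfolding base_def by (metis U_simps(1))
  then show ?thesis by simp
next
  case False
  moreover assume "base x q r" "k \<le> ord (q \<otimes> r)"
  ultimately show ?thesis using U_pos[of q r k] unfolding base_def by simp
qed

lemma chain_up:
  assumes "base x q r" "k < ord (q \<otimes> r)"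
  shows "\<ell> (chain x q r k) < \<ell> (chain x q r k \<otimes> next_letter q r k)"
proof -
  have "pos (\<rho> (chain x q r k) (n (next_letter q r k)))"
    unfolding chain_root[OF assms(1)] using assms U_nonneg base_roots
    by (intro pos_add pos_scale) auto
  then show ?thesis using len_less_iff assms by (simp add: base_def)
qed

lemma lower_edge:
  assumes "w \<in> carrier G" "s \<in> S" "q \<in> S" "lower s w" "\<ell> w < \<ell> (w \<otimes> q)" shows "lower s (w \<otimes> q)"
proof -
  have "\<ell> (s \<otimes> w \<otimes> q) \<le> \<ell> (s \<otimes> w) + 1" using len_mult_le[of "s \<otimes> w" q] assms by (simp add: len_S)
  then show ?thesis using assms by (simp add: lower_def m_assoc)
qed

lemma lower_chain_mono:
  "base x q r \<Longrightarrow> s \<in> S \<Longrightarrow> j + i \<le> ord (q \<otimes> r) \<Longrightarrow> lower s (chain x q r j) \<Longrightarrow> lower s (chain x q r (j + i))"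
proof (induction i)
  case (Suc i)
  then show ?case
    using lower_edge[of "chain x q r (j + i)" s "next_letter q r (j + i)"] chain_up[of x q r "j + i"]
    by (simp add: chain_Suc base_def)
qed simp

lemma lower_chain:
  "base x q r \<Longrightarrow> s \<in> S \<Longrightarrow> k \<le> ord (q \<otimes> r) \<Longrightarrow> lower s x \<Longrightarrow> lower s (chain x q r k)"
  using lower_chain_mono[of x q r s 0 k] by (simp add: chain_0)

text \<open>The root of the edge where \<open>s\<close> enters is \<open>n s\<close>, a nonnegative
  combination of the two extreme roots. A simple root spans an extreme ray of the positive cone, so
  it is one of the two.\<close>

lemma lower_chain_cross:
  assumes "base x q r" "s \<in> S" "k \<le> ord (q \<otimes> r)" "\<not> lower s x" "lower s (chain x q r k)"
  shows "\<rho> x (n q) = n s \<or> \<rho> x (n r) = n s"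
proof -
  have "\<exists>j<k. \<not> lower s (chain x q r j) \<and> lower s (chain x q r (Suc j))"
    using assms(5)
  proof (induction k)
    case 0
    then show ?case using assms by (simp add: chain_0)
  next
    case (Suc k)
    then show ?case by (metis less_Suc_eq)
  qed
  then obtain j where j: "j < k" "\<not> lower s (chain x q r j)" "lower s (chain x q r j \<otimes> next_letter q r j)"
    using assms chain_Suc by metis
  have qr: "q \<in> S" "r \<in> S" using assms by (auto simp: base_def)
  have "\<rho> (chain x q r j) (n (next_letter q r j)) = n s"
    using lower_change(2)[OF _ assms(2) _ j(2,3)] assms qr by simp
  then have e: "n s = U q r (Suc j) *\<^sub>R \<rho> x (n q) + U q r j *\<^sub>R \<rho> x (n r)"
    using chain_root assms by simp
  have U: "U q r (Suc j) \<ge> 0" "U q r j \<ge> 0" using U_nonneg[OF assms(1)] j assms by auto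
  have z: "U q r (Suc j) * cf t (\<rho> x (n q)) = 0 \<and> U q r j * cf t (\<rho> x (n r)) = 0" if "t \<in> S" "t \<noteq> s" for t
  proof -
    have "0 = U q r (Suc j) * cf t (\<rho> x (n q)) + U q r j * cf t (\<rho> x (n r))"
      using arg_cong[OF e, of "cf t"] that assms(2) by (simp add: cf_n del: U_simps)
    moreover have "U q r (Suc j) * cf t (\<rho> x (n q)) \<ge> 0" "U q r j * cf t (\<rho> x (n r)) \<ge> 0"
      using U base_roots[OF assms(1)] that by (auto simp: pos_def simp del: U_simps)
    ultimately show ?thesis by linarith
  qed
  show ?thesis
  proof (cases "U q r (Suc j) = 0")
    case False
    then have "\<rho> x (n q) = n s" using z base_roots[OF assms(1)] assms(2)
      by (intro simple_proportional) auto
    then show ?thesis by simp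
  next
    case True
    then have "U q r j \<noteq> 0" using e root_nonzero[OF root_n[OF assms(2)]] by auto
    then have "\<rho> x (n r) = n s" using z base_roots[OF assms(1)] assms(2)
      by (intro simple_proportional) auto
    then show ?thesis by simp
  qed
qed

lemma ord_conj:
  assumes "x \<in> carrier G" "q \<in> S" "r \<in> S" "q' \<in> S" "r' \<in> S" "q' \<otimes> x = x \<otimes> q" "r' \<otimes> x = x \<otimes> r"
  shows "ord (q' \<otimes> r') = ord (q \<otimes> r)"
proof -
  have e: "(q' \<otimes> r') [^] k \<otimes> x = x \<otimes> (q \<otimes> r) [^] k" for k :: nat
  proof (induction k)
    case (Suc k)
    have "(q' \<otimes> r') [^] Suc k \<otimes> x = (q' \<otimes> r') [^] k \<otimes> (q' \<otimes> (r' \<otimes> x))"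
      using assms by (simp add: m_assoc)
    also have "q' \<otimes> (r' \<otimes> x) = x \<otimes> (q \<otimes> r)"
      using assms by (metis S_in_carrier m_assoc)
    also have "(q' \<otimes> r') [^] k \<otimes> (x \<otimes> (q \<otimes> r)) = x \<otimes> (q \<otimes> r) [^] Suc k"
      using Suc assms by (metis S_in_carrier m_assoc m_closed nat_pow_Suc nat_pow_closed)
    finally show ?case .
  qed (use assms in simp)
  have "(q' \<otimes> r') [^] k = \<one> \<longleftrightarrow> (q \<otimes> r) [^] k = \<one>" for k :: nat
  proof
    assume "(q' \<otimes> r') [^] k = \<one>"
    then have "x \<otimes> (q \<otimes> r) [^] k = x" using e[of k] assms by simp
    then show "(q \<otimes> r) [^] k = \<one>"
      using assms by (metis S_in_carrier inv_cancel(1) l_inv m_closed nat_pow_closed)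
  next
    assume "(q \<otimes> r) [^] k = \<one>"
    then have "(q' \<otimes> r') [^] k \<otimes> x = x" using e[of k] assms by simp
    then have "(q' \<otimes> r') [^] k \<otimes> x \<otimes> inv x = x \<otimes> inv x" by simp
    then show "(q' \<otimes> r') [^] k = \<one>" using assms by (simp add: m_assoc)
  qed
  then have "\<forall>k::nat. (q' \<otimes> r') [^] k = \<one> \<longleftrightarrow> ord (q \<otimes> r) dvd k"
    using pow_eq_id[of "q \<otimes> r"] assms by simp
  then show ?thesis using ord_unique[of "q' \<otimes> r'"] assms by simp
qed

text \<open>In \<open>x = par J x \<otimes> y\<close> the minimal factor \<open>y\<close> conjugates
  \<open>q\<close> and \<open>r\<close> into simple reflections of \<open>W J\<close>, so the
  projection carries both sides of the interval, edge by edge, onto those of an interval in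
  \<open>W J\<close>.\<close>

lemma par_chain_both:
  assumes "base x q r" "J \<subseteq> S" "supp J (\<rho> x (n q))" "supp J (\<rho> x (n r))"
  obtains q' r' where "q' \<in> J" "r' \<in> J" "base (par J x) q' r'" "ord (q' \<otimes> r') = ord (q \<otimes> r)"
    "\<rho> (par J x) (n q') = \<rho> x (n q)" "\<rho> (par J x) (n r') = \<rho> x (n r)"
    "\<And>k. par J (chain x q r k) = chain (par J x) q' r' k"
    "\<And>k. par J (chain x r q k) = chain (par J x) r' q' k"
proof -
  have x: "x \<in> carrier G" and qr: "q \<in> S" "r \<in> S" "q \<noteq> r"
    and up: "\<ell> x < \<ell> (x \<otimes> q)" "\<ell> x < \<ell> (x \<otimes> r)" using assms by (auto simp: base_def)
  obtain y where y: "par J x \<in> W J" "Jmin J y" "x = par J x \<otimes> y" by (rule par_decomp_S[OF assms(2) x])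
  let ?u = "par J x"
  have c: "?u \<in> carrier G" "y \<in> carrier G" using y W_closed[OF assms(2)] by (auto simp: Jmin_def)
  obtain q' where q': "q' \<in> J" "\<rho> ?u (n q') = \<rho> x (n q)"
    using par_edge(1)[OF assms(2) x qr(1) up(1) assms(3)] by blast
  obtain r' where r': "r' \<in> J" "\<rho> ?u (n r') = \<rho> x (n r)"
    using par_edge(1)[OF assms(2) x qr(2) up(2) assms(4)] by blast
  have S': "q' \<in> S" "r' \<in> S" using q' r' assms(2) by auto
  have yroot: "\<rho> y z = \<rho> (inv ?u) (\<rho> x z)" for z
    using rho_mult[OF c] y(3) c by (metis rho_inv(2))
  have conj: "q' \<otimes> y = y \<otimes> q" "r' \<otimes> y = y \<otimes> r"
    using yroot q'(2) r'(2) c qr S' by (auto intro!: conj_eq_mult simp flip: q'(2) r'(2))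
  have ne: "q' \<noteq> r'"
  proof
    assume "q' = r'"
    then have "y \<otimes> q = y \<otimes> r" using conj by simp
    then have "inv y \<otimes> (y \<otimes> q) = inv y \<otimes> (y \<otimes> r)" by simp
    then show False using c qr by simp
  qed
  have "pos (\<rho> ?u (n q'))" "pos (\<rho> ?u (n r'))" using q' r' base_roots[OF assms(1)] by simp_all
  then have base: "base ?u q' r'" using c S' ne len_less_iff(2)[of ?u] by (simp add: base_def)
  have alts: "wp (alt q' r' k) \<otimes> y = y \<otimes> wp (alt q r k)"
    if "q' \<otimes> y = y \<otimes> q" "r' \<otimes> y = y \<otimes> r" "q' \<in> S" "r' \<in> S" "q \<in> S" "r \<in> S" for q r q' r' k
    using that
  proof (induction k arbitrary: q r q' r')
    case (Suc k)
    have "wp (alt q' r' (Suc k)) \<otimes> y = q' \<otimes> (y \<otimes> wp (alt r q k))"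
      using Suc.IH[of r' r q' q] Suc.prems c by (simp add: m_assoc)
    also have "\<dots> = y \<otimes> q \<otimes> wp (alt r q k)" using Suc.prems c by (metis S_in_carrier m_assoc wp_alt_closed)
    finally show ?case using Suc.prems c by (simp add: m_assoc)
  qed (use c in simp)
  have wpJ: "wp (alt q r k) \<in> W J" if "q \<in> J" "r \<in> J" for q r k
    using that set_alt[of q r k] by (intro W_wp) auto
  have main: "par J (x \<otimes> wp (alt q r k)) = ?u \<otimes> wp (alt q' r' k)"
    if "q' \<otimes> y = y \<otimes> q" "r' \<otimes> y = y \<otimes> r" "q' \<in> J" "r' \<in> J" "q \<in> S" "r \<in> S" for q r q' r' k
  proof -
    have S: "q' \<in> S" "r' \<in> S" using that assms(2) by auto
    have "x \<otimes> wp (alt q r k) = ?u \<otimes> (y \<otimes> wp (alt q r k))"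
      using y(3) c that by (metis m_assoc wp_alt_closed)
    also have "\<dots> = (?u \<otimes> wp (alt q' r' k)) \<otimes> y"
      using alts[OF that(1,2) S that(5,6)] c S by (simp add: m_assoc)
    finally show ?thesis using par_eq[OF assms(2) W_mult[OF y(1) wpJ[OF that(3,4)]] y(2)] by simp
  qed
  show thesis
    using main[OF conj q'(1) r'(1) qr(1,2)] main[OF conj(2,1) r'(1) q'(1) qr(2,1)]
    by (intro that[OF q'(1) r'(1) base _ q'(2) r'(2)] ord_conj[of y] c conj qr S') (auto simp: chain_def)
qed

text \<open>On the side starting with \<open>r\<close>, every root but the last involves
  \<open>\<rho> x (n r)\<close> and leaves the span of \<open>J\<close>, so these edges collapse.
  The last root is \<open>\<rho> x (n q)\<close>, because \<open>U\<close> is 0 at \<open>m\<close>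
  and 1 at \<open>m - 1\<close>; the top edge and the opposite bottom edge thus have the same
  image.\<close>

lemma par_chain_mixed:
  assumes "base x q r" "J \<subseteq> S" "supp J (\<rho> x (n q))" "\<not> supp J (\<rho> x (n r))" "ord (q \<otimes> r) \<noteq> 0"
  shows "k < ord (q \<otimes> r) \<Longrightarrow> par J (chain x r q k) = par J x"
    and "par J (chain x r q (ord (q \<otimes> r))) = par J (x \<otimes> q)"
proof -
  let ?m = "ord (q \<otimes> r)"
  have x: "x \<in> carrier G" and qr: "q \<in> S" "r \<in> S" "q \<noteq> r"
    and up: "\<ell> x < \<ell> (x \<otimes> q)" "\<ell> x < \<ell> (x \<otimes> r)" using assms by (auto simp: base_def)
  note b = base_sym[OF assms(1)]
  have m: "ord (r \<otimes> q) = ?m" using ord_sym qr by blast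
  have m2: "?m \<ge> 2" using ord_ge_2 qr assms(5) by blast
  obtain t where t: "t \<in> S - J" "cf t (\<rho> x (n r)) \<noteq> 0" using assms(4) by (auto simp: supp_def)
  then have tq: "cf t (\<rho> x (n q)) = 0" using assms(3) by (auto simp: supp_def)
  have below: "par J (chain x r q k) = par J x" if "k < ?m" for k
    using that
  proof (induction k)
    case 0
    then show ?case using b by (simp add: chain_0)
  next
    case (Suc k)
    have "U r q (Suc k) > 0" using Suc.prems qr m by (intro U_pos) auto
    then have "cf t (\<rho> (chain x r q k) (n (next_letter r q k))) \<noteq> 0"
      unfolding chain_root[OF b] using t tq by (simp del: U_simps)
    then have "\<not> supp J (\<rho> (chain x r q k) (n (next_letter r q k)))" using t by (auto simp: supp_def)
    then show ?case
      using par_edge(2)[OF assms(2) chain_closed[OF b] next_letter_S[OF qr(2,1)] chain_up[OF b]] Suc m chain_Suc[OF b]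
      by simp
  qed
  show "par J (chain x r q k) = par J x" if "k < ?m" using below that .
  obtain j where j: "?m = Suc j" using assms(5) by (cases ?m) auto
  have "\<rho> (chain x r q j) (n (next_letter r q j)) = \<rho> x (n q)"
    unfolding chain_root[OF b] using U_ord(1,2)[OF qr assms(5)] j U_sym[of r q] by (simp del: U_simps)
  moreover obtain q'' where q'': "q'' \<in> J" "par J (chain x r q j \<otimes> next_letter r q j) = par J (chain x r q j) \<otimes> q''"
    "\<rho> (par J (chain x r q j)) (n q'') = \<rho> (chain x r q j) (n (next_letter r q j))"
    using par_edge(1)[OF assms(2) chain_closed[OF b] next_letter_S[OF qr(2,1)] chain_up[OF b, of j]] j m
      assms(3) calculation by auto
  moreover obtain q' where q': "q' \<in> J" "par J (x \<otimes> q) = par J x \<otimes> q'" "\<rho> (par J x) (n q') = \<rho> x (n q)"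
    using par_edge(1)[OF assms(2) x qr(1) up(1) assms(3)] by blast
  moreover have "par J (chain x r q j) = par J x" using below j by simp
  ultimately have "\<rho> (par J x) (n q'') = \<rho> (par J x) (n q')" by simp
  then have "n q'' = n q'" using rho_inv(2)[OF par_closed[OF assms(2) x]] by metis
  then have "q'' = q'" using cf_n[of q'' q''] cf_n[of q'' q'] q''(1) q'(1) assms(2)
    by (metis subsetD zero_neq_one)
  then show "par J (chain x r q ?m) = par J (x \<otimes> q)"
    using q''(2) q'(2) below[of j] j chain_Suc[OF b] by simp
qed

section \<open>Fibres of the projection in rank two intervals\<close>

text \<open>
  Say that a cover \<open>w < wq\<close> is contracted if both elements have the same projection.  In order
  of appearance: contraction passes down between opposite edges of a finite rank two interval, from
  the inner edges of its first side (in the order given by the skew form) to one of its two bottom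
  edges, and to standard parabolic subgroups; and no edge \<open>w < sw\<close> with \<open>s\<close> simple is
  contracted.  The four statements need each other, so they are proved by simultaneous induction on a
  bound \<open>N\<close> for the length of the Coxeter word plus the length of the highest element involved.
\<close>

definition opposite_edges :: "nat \<Rightarrow> bool" where
  "opposite_edges N \<longleftrightarrow> (\<forall>cs x q r. cox_word cs \<longrightarrow> x \<in> W (set cs) \<longrightarrow> q \<in> set cs \<longrightarrow> r \<in> set cs \<longrightarrow>
    base x q r \<longrightarrow> ord (q \<otimes> r) \<noteq> 0 \<longrightarrow> length cs + \<ell> x + ord (q \<otimes> r) \<le> N \<longrightarrow>
    same_fibre cs (chain x r q (ord (q \<otimes> r) - 1)) (chain x r q (ord (q \<otimes> r))) \<longrightarrow> same_fibre cs x (x \<otimes> q))"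

definition side_edges :: "nat \<Rightarrow> bool" where
  "side_edges N \<longleftrightarrow> (\<forall>cs x q r k. cox_word cs \<longrightarrow> x \<in> W (set cs) \<longrightarrow> q \<in> set cs \<longrightarrow> r \<in> set cs \<longrightarrow>
    base x q r \<longrightarrow> 0 < k \<longrightarrow> k + 1 < ord (q \<otimes> r) \<longrightarrow> length cs + \<ell> x + k + 1 \<le> N \<longrightarrow>
    0 \<le> skew cs (\<rho> x (n q)) (\<rho> x (n r)) \<longrightarrow>
    same_fibre cs (chain x q r k) (chain x q r (k + 1)) \<longrightarrow> same_fibre cs x (x \<otimes> q) \<or> same_fibre cs x (x \<otimes> r))"

definition parabolic_edges :: "nat \<Rightarrow> bool" where
  "parabolic_edges N \<longleftrightarrow> (\<forall>cs x q s. cox_word cs \<longrightarrow> x \<in> W (set cs) \<longrightarrow> q \<in> set cs \<longrightarrow> s \<in> set cs \<longrightarrow>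
    \<ell> x < \<ell> (x \<otimes> q) \<longrightarrow> length cs + \<ell> x + 1 \<le> N \<longrightarrow> same_fibre cs x (x \<otimes> q) \<longrightarrow>
    same_fibre (filter (\<lambda>t. t \<noteq> s) cs) (par (set cs - {s}) x) (par (set cs - {s}) (x \<otimes> q)))"

definition simple_edges :: "nat \<Rightarrow> bool" where
  "simple_edges N \<longleftrightarrow> (\<forall>cs x r s. cox_word cs \<longrightarrow> x \<in> W (set cs) \<longrightarrow> r \<in> set cs \<longrightarrow> s \<in> set cs \<longrightarrow>
    \<ell> x < \<ell> (x \<otimes> r) \<longrightarrow> s \<otimes> x = x \<otimes> r \<longrightarrow> length cs + \<ell> x + 1 \<le> N \<longrightarrow> \<not> same_fibre cs x (x \<otimes> r))"

lemma filter_Cons_self: "s \<notin> set cs \<Longrightarrow> filter (\<lambda>t. t \<noteq> s) (s # cs) = cs"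
  "s \<notin> set cs \<Longrightarrow> filter (\<lambda>t. t \<noteq> s) (cs @ [s]) = cs"
  by (auto intro: filter_True)

lemma W_mult_S: "cox_word cs \<Longrightarrow> x \<in> W (set cs) \<Longrightarrow> q \<in> set cs \<Longrightarrow> x \<otimes> q \<in> W (set cs)"
  using W_mult[OF _ W_incl[of q "set cs"], of x] by simp

lemma W_chain:
  assumes "x \<in> W (set cs)" "q \<in> set cs" "r \<in> set cs" shows "chain x q r k \<in> W (set cs)"
  unfolding chain_def using assms set_alt[of q r k] by (intro W_mult W_wp) auto

lemma base_strip:
  assumes "base x q r" "s \<in> S" "lower s x" shows "base (s \<otimes> x) q r" "chain (s \<otimes> x) q r k = s \<otimes> chain x q r k"
proof -
  have x: "x \<in> carrier G" "q \<in> S" "r \<in> S" using assms by (auto simp: base_def)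
  have l: "\<ell> x = \<ell> (s \<otimes> x) + 1" using assms(3) len_S_mult_cases[OF x(1) assms(2)] by (auto simp: lower_def)
  have *: "\<ell> (s \<otimes> x) < \<ell> (s \<otimes> x \<otimes> p)" if "p \<in> S" "\<ell> x < \<ell> (x \<otimes> p)" for p
  proof -
    have "\<ell> (x \<otimes> p) \<le> \<ell> (s \<otimes> (x \<otimes> p)) + 1"
      using len_S_mult_cases[of "x \<otimes> p" s] x that assms by auto
    then show ?thesis using that l x assms by (simp add: m_assoc)
  qed
  show "base (s \<otimes> x) q r" using assms * x by (auto simp: base_def)
  show "chain (s \<otimes> x) q r k = s \<otimes> chain x q r k" using x assms by (simp add: chain_def m_assoc)
qed

lemma base_supp:
  assumes "cox_word cs" "x \<in> W (set cs)" "q \<in> set cs" shows "supp (set cs) (\<rho> x (n q))"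
  using assms supp_rho supp_n cox_word_subset by blast

text \<open>Left multiplication by \<open>s\<close> is the reflection of the interval in its extreme
  root \<open>n s\<close>: it takes one side to the other, shifted up by one step.\<close>

lemma cross_simple:
  assumes "base x q r" "s \<in> S" "\<rho> x (n r) = n s"
  shows "s \<otimes> x = x \<otimes> r" "chain x r q (Suc k) = s \<otimes> chain x q r k" "\<not> lower s x"
    "k < ord (q \<otimes> r) \<Longrightarrow> lower s (chain x r q (Suc k))" "k < ord (q \<otimes> r) \<Longrightarrow> \<not> lower s (chain x q r k)"
proof -
  have x: "x \<in> carrier G" "q \<in> S" "r \<in> S" "q \<noteq> r" "\<ell> x < \<ell> (x \<otimes> r)" using assms by (auto simp: base_def)
  show sx: "s \<otimes> x = x \<otimes> r" using conj_eq_mult assms x by blast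
  have e: "chain x r q (Suc k) = s \<otimes> chain x q r k" for k
    using chain_Suc_left[OF base_sym[OF assms(1)], of k] x assms sx
    by (simp add: chain_def m_assoc[symmetric])
  show "chain x r q (Suc k) = s \<otimes> chain x q r k" by (rule e)
  show nl: "\<not> lower s x" using sx x by (simp add: lower_def)
  have o: "ord (r \<otimes> q) = ord (q \<otimes> r)" using ord_sym x by blast
  have "lower s (chain x r q (Suc 0))" using e[of 0] assms x nl lower_mult_self by (simp add: chain_0)
  then show l: "lower s (chain x r q (Suc k))" if "k < ord (q \<otimes> r)"
    using lower_chain_mono[OF base_sym[OF assms(1)] assms(2), of 1 k] that o by simp
  then show "\<not> lower s (chain x q r k)" if "k < ord (q \<otimes> r)"
    using that e[of k] lower_mult_self[of "chain x q r k" s] assms by simp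
qed

text \<open>
  The step shared by the two kinds of edges of an interval in which a simple root \<open>n s\<close> with
  \<open>s\<close> initial is extreme: the other extreme root is then compared through \<open>W\<^bsub>set ds\<^esub>\<close>.
\<close>

lemma final_step:
  assumes Y: "parabolic_edges M" and P: "simple_edges M" and B: "side_edges M"
    and g: "cox_word (s # ds)" and x: "x \<in> W (set (s # ds))" and qr: "q \<in> set (s # ds)" "r \<in> set (s # ds)"
    and base: "base x q r" and xr: "\<rho> x (n r) = n s"
    and k: "k + 1 < ord (q \<otimes> r)" "length ds + \<ell> x + k + 2 \<le> M"
    and sm: "same_fibre (ds @ [s]) (chain x q r k) (chain x q r (k + 1))"
  shows "same_fibre (s # ds) x (x \<otimes> q)"
proof -
  note c = cox_word_ctx[OF g x]
  have S: "q \<in> S" "r \<in> S" "q \<noteq> r" and up: "\<ell> x < \<ell> (x \<otimes> q)" "\<ell> x < \<ell> (x \<otimes> r)"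
    using base by (auto simp: base_def)
  note cr = cross_simple[OF base c(2) xr]
  have g': "cox_word (ds @ [s])" using g cox_word_rotate by blast
  have "same_fibre (ds @ [s]) x (x \<otimes> q)"
  proof (cases "k = 0")
    case True
    then show ?thesis using sm base by (simp add: chain_0 chain_1)
  next
    case False
    \<comment> \<open>As \<open>s\<close> is the last letter of \<open>ds @ [s]\<close>, every
      positive root is correctly oriented towards \<open>n s\<close>.\<close>
    have "0 \<le> skew (ds @ [s]) (\<rho> x (n q)) (\<rho> x (n r))"
      unfolding xr using skew_final[OF g] base_roots[OF base] by blast
    then have "same_fibre (ds @ [s]) x (x \<otimes> q) \<or> same_fibre (ds @ [s]) x (x \<otimes> r)"
      using B[unfolded side_edges_def, rule_format, of "ds @ [s]" x q r k] g' x qr base k sm False by simp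
    \<comment> \<open>Here \<open>x \<otimes> r = s \<otimes> x\<close>, an edge of the kind that is
      never contracted.\<close>
    moreover have "\<not> same_fibre (ds @ [s]) x (x \<otimes> r)"
      using P[unfolded simple_edges_def, rule_format, of "ds @ [s]" x r s] g' x qr up cr(1) k by simp
    ultimately show ?thesis by blast
  qed
  then have "same_fibre (filter (\<lambda>t. t \<noteq> s) (ds @ [s])) (par (set (ds @ [s]) - {s}) x) (par (set (ds @ [s]) - {s}) (x \<otimes> q))"
    using Y[unfolded parabolic_edges_def, rule_format, of "ds @ [s]" x q s] g' x qr up k by simp
  moreover have "set (ds @ [s]) - {s} = set ds" using c by auto
  ultimately have "same_fibre ds (par (set ds) x) (par (set ds) (x \<otimes> q))"
    using filter_Cons_self(2)[OF c(3)] by metis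
  moreover have "\<not> lower s (x \<otimes> q)" using cr(5)[of 1] k base by (simp add: chain_1)
  ultimately show ?thesis using cr(3) same_not_lower by blast
qed

text \<open>An interval above \<open>s\<close> is divided by \<open>s\<close>; one whose top is not
  above \<open>s\<close> is projected to the subgroup without \<open>s\<close>. Otherwise
  \<open>n s\<close> is an extreme root. If it is the root of the given top edge, that edge crosses
  the wall of \<open>s\<close> and cannot be contracted; if not, division by \<open>s\<close> moves
  the edge to the other side, just below the top edge there.\<close>

lemma opposite_edges_step:
  assumes IH: "\<And>M. M < N \<Longrightarrow> opposite_edges M \<and> side_edges M \<and> parabolic_edges M \<and> simple_edges M"
  shows "opposite_edges N"
  unfolding opposite_edges_def
proof (intro allI impI)
  fix cs x q r
  let ?m = "ord (q \<otimes> r)"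
  assume g: "cox_word cs" and x: "x \<in> W (set cs)" and qr: "q \<in> set cs" "r \<in> set cs" and base: "base x q r"
    and m0: "?m \<noteq> 0" and le: "length cs + \<ell> x + ?m \<le> N"
    and sm: "same_fibre cs (chain x r q (?m - 1)) (chain x r q ?m)"
  have S: "q \<in> S" "r \<in> S" "q \<noteq> r" and up: "\<ell> x < \<ell> (x \<otimes> q)" "\<ell> x < \<ell> (x \<otimes> r)"
    using base by (auto simp: base_def)
  have m2: "?m \<ge> 2" using ord_ge_2 S m0 by blast
  have ord_rq: "ord (r \<otimes> q) = ?m" using ord_sym S by blast
  obtain s ds where cs: "cs = s # ds" using qr by (cases cs) auto
  note c = cox_word_ctx[OF g[unfolded cs] x[unfolded cs]]
  have N: "N \<ge> 1" using le cs by simp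
  have ih: "opposite_edges (N - 1)" "side_edges (N - 1)" "parabolic_edges (N - 1)" "simple_edges (N - 1)"
    using IH[of "N - 1"] N by auto
  note bs = base_sym[OF base]
  let ?y = "chain x r q (?m - 1)" let ?t = "chain x r q ?m"
  have yW: "?y \<in> W (set cs)" "?t \<in> W (set cs)" "x \<otimes> q \<in> W (set cs)"
    using W_chain x qr W_mult_S g by auto
  show "same_fibre cs x (x \<otimes> q)"
  proof (cases "lower s x")
    case True
    have l: "lower s ?y" "lower s ?t" "lower s (x \<otimes> q)"
      using lower_chain[OF bs c(2) _ True] lower_edge[OF c(1,2) S(1) True up(1)] ord_rq by auto
    have "same_fibre (ds @ [s]) (s \<otimes> ?y) (s \<otimes> ?t)"
      using sm same_lower[OF g[unfolded cs] yW(1,2)[unfolded cs] l(1,2)] cs by simp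
    moreover note st = base_strip(2)[OF bs c(2) True]
    moreover have "length (ds @ [s]) + \<ell> (s \<otimes> x) + ?m \<le> N - 1"
      using le cs True by (auto simp: lower_def)
    ultimately have "same_fibre (ds @ [s]) (s \<otimes> x) (s \<otimes> x \<otimes> q)"
      using ih(1)[unfolded opposite_edges_def, rule_format, of "ds @ [s]" "s \<otimes> x" q r]
        cox_word_rotate g cs W_Cons_mult x qr base_strip(1)[OF base c(2) True] m0 by simp
    then show ?thesis
      using same_lower[OF g[unfolded cs] x[unfolded cs] yW(3)[unfolded cs] True l(3)] cs c S
      by (simp add: m_assoc)
  next
    case not_x: False
    show ?thesis
    proof (cases "lower s ?t")
      case True
      then consider "\<rho> x (n r) = n s" | "\<rho> x (n q) = n s"
        using lower_chain_cross[OF bs c(2) _ not_x True] ord_rq by auto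
      then show ?thesis
      proof cases
        case 1
        have e: "chain x r q (?m - 1) = s \<otimes> chain x q r (?m - 2)" "chain x r q ?m = s \<otimes> chain x q r (?m - 1)"
          using cross_simple(2)[OF base c(2) 1, of "?m - 2"] cross_simple(2)[OF base c(2) 1, of "?m - 1"] m2
          by (simp_all add: Suc_diff_Suc numeral_2_eq_2)
        have l: "lower s ?y" "lower s ?t"
          using cross_simple(4)[OF base c(2) 1, of "?m - 2"] cross_simple(4)[OF base c(2) 1, of "?m - 1"] m2
          by (simp_all add: Suc_diff_Suc numeral_2_eq_2)
        have "same_fibre (ds @ [s]) (s \<otimes> ?y) (s \<otimes> ?t)"
          using sm same_lower[OF g[unfolded cs] yW(1,2)[unfolded cs] l] cs by simp
        then have "same_fibre (ds @ [s]) (chain x q r (?m - 2)) (chain x q r (?m - 2 + 1))"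
          using e base c m2 by (simp add: Suc_diff_Suc numeral_2_eq_2)
        then show ?thesis
          unfolding cs using final_step[OF ih(3,4,2) g[unfolded cs] x[unfolded cs] _ _ base 1, of "?m - 2"]
            qr cs m2 le by simp
      next
        case 2
        have "?t = s \<otimes> ?y" using cross_simple(2)[OF bs c(2) 2, of "?m - 1"] chain_top[OF base] m0 by simp
        moreover have "\<not> lower s ?y" using cross_simple(5)[OF bs c(2) 2, of "?m - 1"] ord_rq m0 by simp
        ultimately have "lower s ?y \<noteq> lower s ?t" using True by simp
        then show ?thesis using same_lower_iff[OF g[unfolded cs] yW(1,2)[unfolded cs]] sm cs by simp
      qed
    next
      case nt: False
      have ny: "\<not> lower s ?y"
        using nt lower_chain_mono[OF bs c(2), of "?m - 1" 1] ord_rq m0 by auto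
      have nq: "\<not> lower s (x \<otimes> q)"
        using nt lower_chain_mono[OF base c(2), of 1 "?m - 1"] m0 base chain_top[OF base] by (auto simp: chain_1)
      let ?J = "set ds"
      have sy: "same_fibre ds (par ?J ?y) (par ?J ?t)" using sm same_not_lower[OF ny nt] cs by simp
      have "same_fibre ds (par ?J x) (par ?J (x \<otimes> q))"
      proof (cases "supp ?J (\<rho> x (n q))")
        case False
        then show ?thesis using par_edge(2)[OF c(5,1) S(1) up(1)] by simp
      next
        case sq: True
        show ?thesis
        proof (cases "supp ?J (\<rho> x (n r))")
          case False
          then show ?thesis using par_chain_mixed[OF base c(5) sq False m0] sy m0 by simp
        next
          case True
          obtain q' r' where q': "q' \<in> ?J" "r' \<in> ?J" "base (par ?J x) q' r'" "ord (q' \<otimes> r') = ?m"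
            "\<rho> (par ?J x) (n q') = \<rho> x (n q)" "\<rho> (par ?J x) (n r') = \<rho> x (n r)"
            "\<And>k. par ?J (chain x q r k) = chain (par ?J x) q' r' k"
            "\<And>k. par ?J (chain x r q k) = chain (par ?J x) r' q' k"
            by (rule par_chain_both[OF base c(5) sq True]) (rule that)
          have "length ds + \<ell> (par ?J x) + ord (q' \<otimes> r') \<le> N - 1"
            using le cs len_par[of ?J x] q'(4) by simp
          then have "same_fibre ds (par ?J x) (par ?J x \<otimes> q')"
            using ih(1)[unfolded opposite_edges_def, rule_format, of ds "par ?J x" q' r']
              q'(1-4,8) sy c m0 par_in[OF c(5,1)] by simp
          then show ?thesis using q'(7)[of 1] q'(3) base by (simp add: chain_1)
        qed
      qed
      then show ?thesis using same_not_lower[OF not_x nq] cs by simp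
    qed
  qed
qed

text \<open>The critical case is an extreme root \<open>n s\<close>. At the start of the given side,
  division by \<open>s\<close> moves the edge to the other side, one step down. At the start of the
  other side, the orientation makes the extreme roots orthogonal, which contradicts
  \<open>m > 2\<close>.\<close>

lemma side_edges_step:
  assumes IH: "\<And>M. M < N \<Longrightarrow> opposite_edges M \<and> side_edges M \<and> parabolic_edges M \<and> simple_edges M"
  shows "side_edges N"
  unfolding side_edges_def
proof (intro allI impI)
  fix cs x q r k
  let ?m = "ord (q \<otimes> r)"
  assume g: "cox_word cs" and x: "x \<in> W (set cs)" and qr: "q \<in> set cs" "r \<in> set cs" and base: "base x q r"
    and k: "0 < k" "k + 1 < ?m" and le: "length cs + \<ell> x + k + 1 \<le> N"
    and o: "0 \<le> skew cs (\<rho> x (n q)) (\<rho> x (n r))"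
    and sm: "same_fibre cs (chain x q r k) (chain x q r (k + 1))"
  have S: "q \<in> S" "r \<in> S" "q \<noteq> r" and up: "\<ell> x < \<ell> (x \<otimes> q)" "\<ell> x < \<ell> (x \<otimes> r)"
    using base by (auto simp: base_def)
  have ord_rq: "ord (r \<otimes> q) = ?m" using ord_sym S by blast
  obtain s ds where cs: "cs = s # ds" using qr by (cases cs) auto
  note c = cox_word_ctx[OF g[unfolded cs] x[unfolded cs]]
  have ih: "opposite_edges (N - 1)" "side_edges (N - 1)" "parabolic_edges (N - 1)" "simple_edges (N - 1)"
    using IH[of "N - 1"] le cs by auto
  note bs = base_sym[OF base]
  let ?y = "chain x q r k" let ?t = "chain x q r (k + 1)"
  have yW: "?y \<in> W (set cs)" "?t \<in> W (set cs)" "x \<otimes> q \<in> W (set cs)" "x \<otimes> r \<in> W (set cs)"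
    using W_chain x qr W_mult_S g by auto
  have sp: "supp (set cs) (\<rho> x (n q))" "supp (set cs) (\<rho> x (n r))"
    using base_supp[OF g x] qr by auto
  show "same_fibre cs x (x \<otimes> q) \<or> same_fibre cs x (x \<otimes> r)"
  proof (cases "lower s x")
    case True
    have l: "lower s ?y" "lower s ?t" "lower s (x \<otimes> q)" "lower s (x \<otimes> r)"
      using lower_chain[OF base c(2) _ True] lower_edge[OF c(1,2) S(1) True up(1)]
        lower_edge[OF c(1,2) S(2) True up(2)] k by auto
    have "same_fibre (ds @ [s]) (s \<otimes> ?y) (s \<otimes> ?t)"
      using sm same_lower[OF g[unfolded cs] yW(1,2)[unfolded cs] l(1,2)] cs by simp
    moreover note base_strip(2)[OF base c(2) True]
    moreover have "length (ds @ [s]) + \<ell> (s \<otimes> x) + k + 1 \<le> N - 1"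
      using le cs True by (auto simp: lower_def)
    moreover have "0 \<le> skew (ds @ [s]) (\<rho> (s \<otimes> x) (n q)) (\<rho> (s \<otimes> x) (n r))"
      using skew_rotate[OF g[unfolded cs] sp[unfolded cs]] o cs c by (simp add: rho_mult)
    ultimately have "same_fibre (ds @ [s]) (s \<otimes> x) (s \<otimes> x \<otimes> q) \<or> same_fibre (ds @ [s]) (s \<otimes> x) (s \<otimes> x \<otimes> r)"
      using ih(2)[unfolded side_edges_def, rule_format, of "ds @ [s]" "s \<otimes> x" q r k]
        cox_word_rotate g cs W_Cons_mult x qr base_strip(1)[OF base c(2) True] k by simp
    then show ?thesis
      using same_lower[OF g[unfolded cs] x[unfolded cs] yW(3)[unfolded cs] True l(3)]
        same_lower[OF g[unfolded cs] x[unfolded cs] yW(4)[unfolded cs] True l(4)] cs c S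
      by (simp add: m_assoc)
  next
    case not_x: False
    consider (q) "\<rho> x (n q) = n s" | (r) "\<rho> x (n q) \<noteq> n s" "\<rho> x (n r) = n s"
      | (n) "\<rho> x (n q) \<noteq> n s" "\<rho> x (n r) \<noteq> n s" by blast
    then show ?thesis
    proof cases
      case q
      have e: "?y = s \<otimes> chain x r q (k - 1)" "?t = s \<otimes> chain x r q k"
        using cross_simple(2)[OF bs c(2) q, of "k - 1"] cross_simple(2)[OF bs c(2) q, of k] k by simp_all
      have l: "lower s ?y" "lower s ?t"
        using cross_simple(4)[OF bs c(2) q, of "k - 1"] cross_simple(4)[OF bs c(2) q, of k] k ord_rq by simp_all
      have "same_fibre (ds @ [s]) (s \<otimes> ?y) (s \<otimes> ?t)"
        using sm same_lower[OF g[unfolded cs] yW(1,2)[unfolded cs] l] cs by simp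
      then have "same_fibre (ds @ [s]) (chain x r q (k - 1)) (chain x r q (k - 1 + 1))"
        using e bs c k by simp
      then have "same_fibre cs x (x \<otimes> r)"
        unfolding cs using final_step[OF ih(3,4,2) g[unfolded cs] x[unfolded cs] _ _ bs q, of "k - 1"]
          qr cs k le ord_rq by simp
      then show ?thesis by simp
    next
      case r
      have "bil (n s) (\<rho> x (n q)) = 0"
        using skew_initial[OF g[unfolded cs] base_roots(1,3)[OF base] sp(1)[unfolded cs] r(1)] o r(2) cs by simp
      then have "bil (\<rho> x (n r)) (\<rho> x (n q)) = 0" using r(2) by simp
      then have "b r q = 0" using bil_rho c(1) S by (simp add: bil_n_left bf_n)
      then have "U q r (Suc (Suc 0)) = 0" using b_sym[of r q] by simp
      then show ?thesis using U_pos[OF S, of "Suc (Suc 0)"] k by simp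
    next
      case n
      have nl: "\<not> lower s (chain x q r j)" if "j \<le> ?m" for j
        using lower_chain_cross[OF base c(2) that not_x] n by blast
      have nl': "\<not> lower s (chain x r q j)" if "j \<le> ?m" for j
        using lower_chain_cross[OF bs c(2) _ not_x, of j] n that ord_rq by auto
      have ny: "\<not> lower s ?y" "\<not> lower s ?t" and nq: "\<not> lower s (x \<otimes> q)" "\<not> lower s (x \<otimes> r)"
        using nl[of k] nl[of "k + 1"] nl[of 1] nl'[of 1] k base bs by (auto simp: chain_1)
      let ?J = "set ds"
      have sy: "same_fibre ds (par ?J ?y) (par ?J ?t)" using sm same_not_lower[OF ny] cs by simp
      have "same_fibre ds (par ?J x) (par ?J (x \<otimes> q)) \<or> same_fibre ds (par ?J x) (par ?J (x \<otimes> r))"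
      proof (cases "supp ?J (\<rho> x (n q)) \<and> supp ?J (\<rho> x (n r))")
        case False
        then show ?thesis using par_edge(2)[OF c(5,1) S(1) up(1)] par_edge(2)[OF c(5,1) S(2) up(2)] by auto
      next
        case True
        obtain q' r' where q': "q' \<in> ?J" "r' \<in> ?J" "base (par ?J x) q' r'" "ord (q' \<otimes> r') = ?m"
          "\<rho> (par ?J x) (n q') = \<rho> x (n q)" "\<rho> (par ?J x) (n r') = \<rho> x (n r)"
          "\<And>k. par ?J (chain x q r k) = chain (par ?J x) q' r' k"
          "\<And>k. par ?J (chain x r q k) = chain (par ?J x) r' q' k"
          by (rule par_chain_both[OF base c(5) conjunct1[OF True] conjunct2[OF True]]) (rule that)
        have "length ds + \<ell> (par ?J x) + k + 1 \<le> N - 1" using le cs len_par[of ?J x] by simp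
        moreover have "0 \<le> skew ds (\<rho> (par ?J x) (n q')) (\<rho> (par ?J x) (n r'))"
          using skew_restrict[OF c(2,3)] True o cs q'(5,6) by simp
        ultimately have "same_fibre ds (par ?J x) (par ?J x \<otimes> q') \<or> same_fibre ds (par ?J x) (par ?J x \<otimes> r')"
          using ih(2)[unfolded side_edges_def, rule_format, of ds "par ?J x" q' r' k]
            q'(1-4,7) sy c k par_in[OF c(5,1)] by simp
        then show ?thesis
          using q'(7)[of 1] q'(8)[of 1] q'(3) base bs base_sym[OF q'(3)] by (simp add: chain_1)
      qed
      then show ?thesis using same_not_lower[OF not_x] nq cs by simp
    qed
  qed
qed

text \<open>If \<open>x\<close> is not in \<open>W J\<close>, its minimal factor \<open>y\<close>
  has a right descent \<open>p\<close>, and the root of \<open>p\<close> at \<open>x\<close> leaves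
  the span of \<open>J\<close>. In the interval of \<open>q\<close> and \<open>p\<close>, the given
  root has coordinate 0 at \<open>s\<close> while not both extreme roots do, so it is extreme
  itself: the interval is finite and the edge is a top edge. The opposite bottom edge is contracted,
  lies lower, and has the same image in \<open>W J\<close>.\<close>

lemma wall_descent:
  assumes A: "opposite_edges N" and g: "cox_word cs" and s: "s \<in> set cs"
  defines "J \<equiv> set cs - {s}"
  shows "x \<in> W (set cs) \<Longrightarrow> q \<in> set cs \<Longrightarrow> \<ell> x < \<ell> (x \<otimes> q) \<Longrightarrow> supp J (\<rho> x (n q)) \<Longrightarrow>
    length cs + \<ell> x + 1 \<le> N \<Longrightarrow> same_fibre cs x (x \<otimes> q) \<Longrightarrow> same_fibre cs (par J x) (par J (x \<otimes> q))"
proof (induction "\<ell> x" arbitrary: x q rule: less_induct)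
  case less
  note x = less.prems(1) and q = less.prems(2) and up = less.prems(3) and sp = less.prems(4)
    and le = less.prems(5) and sm = less.prems(6)
  have K: "set cs \<subseteq> S" using cox_word_subset g by blast
  have J: "J \<subseteq> S" "J \<subseteq> set cs" using K by (auto simp: J_def)
  have c: "x \<in> carrier G" "q \<in> S" "s \<in> S" using cox_word_W[OF g x] K q s by auto
  obtain y where y: "par J x \<in> W J" "y \<in> W (set cs)" "Jmin J y" "x = par J x \<otimes> y"
    by (rule par_decomp[OF J(2) K x])
  have yc: "y \<in> carrier G" using y(3) by (simp add: Jmin_def)
  show ?case
  proof (cases "y = \<one>")
    case True
    then have px: "par J x = x" using y(4) J c by simp
    obtain q' where "q' \<in> J" "par J (x \<otimes> q) = par J x \<otimes> q'" "\<rho> (par J x) (n q') = \<rho> x (n q)"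
      using par_edge(1)[OF J(1) c(1,2) up sp] by blast
    then have "\<rho> x (n q') = \<rho> x (n q)" "q' \<in> S" using px J by auto
    then have "n q' = n q" using rho_inv(2)[OF c(1)] by metis
    then have "q' = q" using cf_n[of q' q'] cf_n[of q' q] \<open>q' \<in> S\<close> c(2) by (metis zero_neq_one)
    then show ?thesis using \<open>par J (x \<otimes> q) = par J x \<otimes> q'\<close> px sm by simp
  next
    case False
    obtain u where u: "set u \<subseteq> set cs" "wp u = y" "length u = \<ell> y" by (rule W_reduced[OF K y(2)])
    then have "u \<noteq> []" using False by auto
    then obtain u' p where up': "u = u' @ [p]" by (metis append_butlast_last_id)
    have p: "p \<in> set cs" "p \<in> S" "set u' \<subseteq> S" using u up' K by auto
    have "y \<otimes> p = wp u'" using u p up' by (auto simp: wp_append_S wp_closed_S)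
    then have lyp: "\<ell> (y \<otimes> p) < \<ell> y" using len_le[of u'] p u up' by simp
    have xp: "x \<otimes> p = par J x \<otimes> (y \<otimes> p)" using y(4) yc p J c by (metis S_in_carrier m_assoc par_closed)
    have lxp: "\<ell> (x \<otimes> p) < \<ell> x"
    proof -
      have "\<ell> (x \<otimes> p) \<le> \<ell> (par J x) + \<ell> (y \<otimes> p)" unfolding xp using len_mult_le yc p J c by simp
      moreover have "\<ell> x = \<ell> (par J x) + \<ell> y" using len_Jmin[OF J(1) y(1,3)] y(4) by simp
      ultimately show ?thesis using lyp by simp
    qed
    have ypmin: "Jmin J (y \<otimes> p)"
      unfolding Jmin_def
    proof (intro conjI ballI)
      fix j assume j: "j \<in> J"
      have "\<not> lower j y" using y(3) j J yc lower_iff by (auto simp: Jmin_def)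
      then have "\<not> lower j (y \<otimes> p)"
        using lower_edge[of "y \<otimes> p" j p] lyp j J yc p by auto
      then show "pos (\<rho> (inv (y \<otimes> p)) (n j))" using lower_iff[of "y \<otimes> p" j] j J yc p by auto
    qed (use yc p in simp)
    \<comment> \<open>Otherwise \<open>par J\<close> would change between
      \<open>x \<otimes> p\<close> and \<open>x\<close>, but it is constant there because
      \<open>y \<otimes> p\<close> is still minimal.\<close>
    have np: "\<not> supp J (\<rho> x (n p))"
    proof
      assume "supp J (\<rho> x (n p))"
      moreover have "\<rho> (x \<otimes> p) (n p) = - \<rho> x (n p)" using c p by (simp add: rho_mult \<sigma>_n)
      ultimately have "supp J (\<rho> (x \<otimes> p) (n p))" by simp
      then obtain q' where "q' \<in> J" "par J (x \<otimes> p \<otimes> p) = par J (x \<otimes> p) \<otimes> q'"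
        using par_edge(1)[OF J(1), of "x \<otimes> p" p] c p lxp by auto
      moreover have "par J (x \<otimes> p) = par J x" unfolding xp by (rule par_eq[OF J(1) y(1) ypmin])
      ultimately have "par J x = par J x \<otimes> q'" "q' \<in> S" using c p J by auto
      then have "q' = \<one>" using J c by (metis S_in_carrier inv_cancel(1) l_inv par_closed)
      then show False using S_ne_one \<open>q' \<in> S\<close> by blast
    qed
    have qp: "q \<noteq> p" using up lxp by auto
    obtain z p1 q1 k where z: "{p1, q1} = {q, p}" "z \<in> carrier G" "x = z \<otimes> wp (alt p1 q1 k)"
      "\<ell> x = \<ell> z + k" "0 < k" "next_letter p1 q1 k = q" "next_letter q1 p1 k = p" "\<ell> z < \<ell> (z \<otimes> p1)" "\<ell> z < \<ell> (z \<otimes> q1)"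
      "ord (p1 \<otimes> q1) = 0 \<or> k < ord (p1 \<otimes> q1)"
      by (rule dihedral_decomp[OF c(1,2) p(2) qp lxp up])
    have pq1: "p1 \<in> S" "q1 \<in> S" "p1 \<noteq> q1" "p1 \<in> set cs" "q1 \<in> set cs"
      using z(1) c p q qp by (auto simp: doubleton_eq_iff)
    have base: "base z p1 q1" using z pq1 by (simp add: base_def)
    have xz: "x = chain z p1 q1 k" using z by (simp add: chain_def)
    have zW: "z \<in> W (set cs)"
    proof -
      have a: "wp (alt p1 q1 k) \<in> W (set cs)" using set_alt[of p1 q1 k] pq1 by (intro W_wp) auto
      have "z = x \<otimes> inv (wp (alt p1 q1 k))" using z(2,3) pq1 by (simp add: m_assoc)
      then show ?thesis using W_mult[OF x W_inv[OF K a]] by simp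
    qed
    have rx: "\<rho> x (n q) = U p1 q1 (Suc k) *\<^sub>R \<rho> z (n p1) + U p1 q1 k *\<^sub>R \<rho> z (n q1)"
      using chain_root[OF base, of k] xz z(6) by simp
    obtain j where j: "k = Suc j" using z(5) by (cases k) auto
    have "\<rho> x (n p) = - \<rho> (chain z p1 q1 j) (n (next_letter p1 q1 j))"
      unfolding xz j chain_Suc[OF base] using z(7) j p(2) base by (simp add: rho_mult \<sigma>_n)
    then have rp: "\<rho> x (n p) = - (U p1 q1 k *\<^sub>R \<rho> z (n p1) + U p1 q1 j *\<^sub>R \<rho> z (n q1))"
      unfolding chain_root[OF base] j .
    have notboth: "\<not> (supp J (\<rho> z (n p1)) \<and> supp J (\<rho> z (n q1)))"
      using np unfolding rp by (auto simp del: U_simps)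
    have Uk: "U p1 q1 k > 0" using U_pos[OF pq1(1-3) z(5,10)] .
    have sK: "supp (set cs) (\<rho> z (n p1))" "supp (set cs) (\<rho> z (n q1))" using base_supp[OF g zW] pq1 by auto
    have suppJ: "supp J v \<longleftrightarrow> cf s v = 0" if "supp (set cs) v" for v
      using that c(3) unfolding supp_def J_def by blast
    \<comment> \<open>Two positive coefficients would force both extreme roots into the span of
      \<open>J\<close>.\<close>
    have Uk1: "\<not> U p1 q1 (Suc k) > 0"
    proof
      assume U1: "U p1 q1 (Suc k) > 0"
      have "U p1 q1 (Suc k) * cf s (\<rho> z (n p1)) + U p1 q1 k * cf s (\<rho> z (n q1)) = 0"
        using sp c(3) arg_cong[OF rx, of "cf s"] by (simp add: supp_def J_def del: U_simps)
      moreover have "cf s (\<rho> z (n p1)) \<ge> 0" "cf s (\<rho> z (n q1)) \<ge> 0"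
        using base_roots[OF base] c(3) by (auto simp: pos_def)
      ultimately have "cf s (\<rho> z (n p1)) = 0 \<and> cf s (\<rho> z (n q1)) = 0"
        using U1 Uk by (simp add: add_nonneg_eq_0_iff del: U_simps)
      then show False using notboth suppJ sK by blast
    qed
    then have m: "ord (p1 \<otimes> q1) = Suc k"
      using U_pos[OF pq1(1-3), of "Suc k"] z(10) by (metis Suc_lessI zero_less_Suc)
    have m0: "ord (p1 \<otimes> q1) \<noteq> 0" using m by simp
    have ord_rq: "ord (q1 \<otimes> p1) = Suc k" using m ord_sym pq1 by metis
    have "\<rho> x (n q) = \<rho> z (n q1)"
      unfolding rx using U_ord(1,2)[OF pq1(1-3) m0] m by (simp del: U_simps)
    then have sq1: "supp J (\<rho> z (n q1))" using sp by simp
    then have np1: "\<not> supp J (\<rho> z (n p1))" using notboth by blast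
    note b2 = base_sym[OF base]
    have xq: "x \<otimes> q = chain z p1 q1 (Suc k)" unfolding chain_Suc[OF base] xz[symmetric] z(6) by simp
    have "same_fibre cs (chain z p1 q1 (Suc k - 1)) (chain z p1 q1 (Suc k))" using sm xq xz by simp
    then have "same_fibre cs z (z \<otimes> q1)"
      using A[unfolded opposite_edges_def, rule_format, of cs z q1 p1] g zW pq1 b2 ord_rq le z(4) by simp
    then have "same_fibre cs (par J z) (par J (z \<otimes> q1))"
      using less.hyps[of z q1] z zW pq1 sq1 le by simp
    moreover have "par J x = par J z" "par J (x \<otimes> q) = par J (z \<otimes> q1)"
      using par_chain_mixed[OF b2 J(1) sq1 np1] ord_rq xz xq by simp_all
    ultimately show ?thesis by simp
  qed
qed

text \<open>The recursions for the two words run in parallel as long as the first letter is not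
  \<open>s\<close>. They part when it is \<open>s\<close> and lies below \<open>x\<close>, since the
  smaller word has no such letter. There \<open>wall_descent\<close> moves the contracted edge into
  \<open>W J\<close>, where \<open>s\<close> lies below neither end and the larger recursion drops
  it too.\<close>

lemma parabolic_edges_step:
  assumes A: "opposite_edges N" and IH: "\<And>M. M < N \<Longrightarrow> parabolic_edges M"
  shows "parabolic_edges N"
  unfolding parabolic_edges_def
proof (intro allI impI)
  fix cs :: "'w list" and x q s
  let ?J = "set cs - {s}" let ?f = "filter (\<lambda>t. t \<noteq> s)"
  assume g: "cox_word cs" and x: "x \<in> W (set cs)" and q: "q \<in> set cs" and s: "s \<in> set cs"
    and up: "\<ell> x < \<ell> (x \<otimes> q)" and le: "length cs + \<ell> x + 1 \<le> N" and sm: "same_fibre cs x (x \<otimes> q)"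
  obtain a ds where cs: "cs = a # ds" using q by (cases cs) auto
  note g' = g[unfolded cs] and x' = x[unfolded cs]
  note c = cox_word_ctx[OF g' x']
  have K: "set cs \<subseteq> S" using cox_word_subset g by blast
  have J: "?J \<subseteq> S" using K by auto
  have S: "q \<in> S" "s \<in> S" using K q s by auto
  have xq: "x \<otimes> q \<in> W (set cs)" using W_mult_S g x q by blast
  have xqc: "x \<otimes> q \<in> carrier G" using c S by simp
  note iff = same_lower_iff[OF g' x' xq[unfolded cs] sm[unfolded cs]]
  have ih: "parabolic_edges (N - 1)" using IH[of "N - 1"] le by simp
  show "same_fibre (?f cs) (par ?J x) (par ?J (x \<otimes> q))"
  proof (cases "supp ?J (\<rho> x (n q))")
    case False
    then show ?thesis using par_edge(2)[OF J c(1) S(1) up] by simp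
  next
    case sp: True
    show ?thesis
    proof (cases "a = s")
      case True
      have J': "?J = set ds" and f: "?f cs = ds" using cs True c(3) filter_Cons_self(1) by auto
      have in_J: "par ?J x \<in> W ?J" "par ?J (x \<otimes> q) \<in> W ?J" using par_in J c xqc by auto
      show ?thesis
      proof (cases "lower a x")
        case False
        then show ?thesis using same_not_lower[of a x "x \<otimes> q" ds] iff sm cs J' f by simp
      next
        case l: True
        have "same_fibre cs (par ?J x) (par ?J (x \<otimes> q))"
          using wall_descent[OF A g s x q up sp le sm] .
        moreover have "\<not> lower a (par ?J x)" "\<not> lower a (par ?J (x \<otimes> q))"
          using not_lower_W[OF J _ in_J(1)] not_lower_W[OF J _ in_J(2)] True S by auto
        ultimately have "same_fibre ds (par (set ds) (par ?J x)) (par (set ds) (par ?J (x \<otimes> q)))"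
          using same_not_lower cs by simp
        then show ?thesis using par_id[OF J] in_J J' f by simp
      qed
    next
      case as: False
      have f: "?f cs = a # ?f ds" "?f (ds @ [a]) = ?f ds @ [a]" using cs as by auto
      have fg: "cox_word (a # ?f ds)" using cox_word_filter[OF g] f(1) by metis
      have setf: "set (a # ?f ds) = ?J" using cs as by auto
      have aJ: "a \<in> ?J" using cs as by simp
      have pW: "par ?J x \<in> W (set (a # ?f ds))" "par ?J (x \<otimes> q) \<in> W (set (a # ?f ds))"
        using par_in J c xqc setf by auto
      have lp: "lower a (par ?J x) = lower a x" "lower a (par ?J (x \<otimes> q)) = lower a (x \<otimes> q)"
        using lower_par[OF J _ aJ] c xqc by auto
      show ?thesis
      proof (cases "lower a x")
        case l: True
        then have lq: "lower a (x \<otimes> q)" using iff by simp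
        have sax: "same_fibre (ds @ [a]) (a \<otimes> x) (a \<otimes> x \<otimes> q)"
          using same_lower[OF g' x' xq[unfolded cs] l lq] sm cs c S by (simp add: m_assoc)
        have "\<ell> x = \<ell> (a \<otimes> x) + 1" using l len_S_mult_cases[OF c(1,2)] by (auto simp: lower_def)
        moreover have "\<ell> (x \<otimes> q) = \<ell> (a \<otimes> x \<otimes> q) + 1"
          using lq len_S_mult_cases[OF xqc c(2)] c S by (auto simp: lower_def m_assoc)
        ultimately have "same_fibre (?f (ds @ [a])) (par (set (ds @ [a]) - {s}) (a \<otimes> x)) (par (set (ds @ [a]) - {s}) (a \<otimes> x \<otimes> q))"
          using ih[unfolded parabolic_edges_def, rule_format, of "ds @ [a]" "a \<otimes> x" q s]
            cox_word_rotate[OF g'] W_Cons_mult[OF x'] q s cs up le sax by simp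
        moreover have "set (ds @ [a]) - {s} = ?J" using cs by auto
        moreover have "par ?J (a \<otimes> x) = a \<otimes> par ?J x" "par ?J (a \<otimes> x \<otimes> q) = a \<otimes> par ?J (x \<otimes> q)"
          using par_mult[OF J _ W_incl[OF aJ]] c xqc S by (simp_all add: m_assoc)
        ultimately have "same_fibre (?f ds @ [a]) (a \<otimes> par ?J x) (a \<otimes> par ?J (x \<otimes> q))" using f(2) by metis
        then show ?thesis using same_lower[OF fg pW] lp l lq f(1) by simp
      next
        case l: False
        then have lq: "\<not> lower a (x \<otimes> q)" using iff by simp
        let ?A = "set ds" let ?I = "set (?f ds)"
        have IA: "?I \<subseteq> ?A" "?I \<subseteq> ?J" using cs as c by auto
        have sds: "same_fibre ds (par ?A x) (par ?A (x \<otimes> q))" using sm same_not_lower[OF l lq] cs by simp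
        have "same_fibre (?f ds) (par ?I x) (par ?I (x \<otimes> q))"
        proof (cases "supp ?A (\<rho> x (n q))")
          case False
          then have "par ?A (x \<otimes> q) = par ?A x" using par_edge(2)[OF c(5,1) S(1) up] by simp
          then have "par ?I (par ?A (x \<otimes> q)) = par ?I (par ?A x)" by simp
          then show ?thesis using par_par[OF IA(1) c(5)] c xqc by simp
        next
          case True
          then obtain q' where q': "q' \<in> ?A" "par ?A (x \<otimes> q) = par ?A x \<otimes> q'"
            "\<rho> (par ?A x) (n q') = \<rho> x (n q)"
            using par_edge(1)[OF c(5,1) S(1) up] by blast
          have "pos (\<rho> (par ?A x) (n q'))" using q'(3) pos_root[OF c(1) S(1) up] by simp
          then have up': "\<ell> (par ?A x) < \<ell> (par ?A x \<otimes> q')"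
            using len_less_iff(2)[of "par ?A x" q'] c q'(1) by auto
          have "same_fibre (?f ds) (par (?A - {s}) (par ?A x)) (par (?A - {s}) (par ?A x \<otimes> q'))"
            using ih[unfolded parabolic_edges_def, rule_format, of ds "par ?A x" q' s]
              c par_in[OF c(5,1)] q' s as cs up' le len_par[of ?A x] sds by simp
          moreover have "?A - {s} = ?I" by auto
          ultimately show ?thesis using q'(2) par_par[OF IA(1) c(5)] c xqc by metis
        qed
        then have "same_fibre (?f ds) (par ?I (par ?J x)) (par ?I (par ?J (x \<otimes> q)))"
          using par_par[OF IA(2) J] c xqc by simp
        then show ?thesis using same_not_lower[of a "par ?J x" "par ?J (x \<otimes> q)" "?f ds"] lp l lq f(1) by simp
      qed
    qed
  qed
qed

text \<open>The root of the edge is \<open>n s\<close>. It stays in the span when another letter is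
  removed, so the projected edge is of the same kind for a shorter word.\<close>

lemma simple_edges_step:
  assumes Y: "parabolic_edges N" and IH: "\<And>M. M < N \<Longrightarrow> simple_edges M"
  shows "simple_edges N"
  unfolding simple_edges_def
proof (intro allI impI notI)
  fix cs x r s
  assume g: "cox_word cs" and x: "x \<in> W (set cs)" and r: "r \<in> set cs" and s: "s \<in> set cs"
    and up: "\<ell> x < \<ell> (x \<otimes> r)" and sx: "s \<otimes> x = x \<otimes> r" and le: "length cs + \<ell> x + 1 \<le> N"
    and sm: "same_fibre cs x (x \<otimes> r)"
  have K: "set cs \<subseteq> S" using cox_word_subset g by blast
  have c: "x \<in> carrier G" "r \<in> S" "s \<in> S" using cox_word_W[OF g x] K r s by auto
  have xr: "\<rho> x (n r) = n s" using mult_eq_conj c sx up by simp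
  show False
  proof (cases "\<exists>s'\<in>set cs. s' \<noteq> s")
    case True
    then obtain s' where s': "s' \<in> set cs" "s' \<noteq> s" by blast
    let ?J = "set cs - {s'}" let ?f = "filter (\<lambda>t. t \<noteq> s') cs"
    have J: "?J \<subseteq> S" "s \<in> ?J" using K s s' by auto
    have sf: "same_fibre ?f (par ?J x) (par ?J (x \<otimes> r))"
      using Y[unfolded parabolic_edges_def, rule_format, of cs x r s'] g x r s' up le sm by simp
    obtain r' where r': "r' \<in> ?J" "par ?J (x \<otimes> r) = par ?J x \<otimes> r'" "\<rho> (par ?J x) (n r') = n s"
      using par_edge(1)[OF J(1) c(1,2) up] supp_n[OF J(2,1)] xr by auto
    have rS: "r' \<in> S" using r' J by auto
    have sp: "s \<otimes> par ?J x = par ?J x \<otimes> r'" using conj_eq_mult[of "par ?J x" r' s] r'(3) c J rS by simp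
    have up': "\<ell> (par ?J x) < \<ell> (par ?J x \<otimes> r')"
      using len_less_iff(2)[of "par ?J x" r'] r'(3) c J rS pos_n by simp
    have lf: "length ?f < length cs" using s' by (intro length_filter_less) auto
    have pf: "par ?J x \<in> W (set ?f)" "r' \<in> set ?f" "s \<in> set ?f"
      using par_in[OF J(1) c(1)] r'(1) J(2) by (simp_all add: set_diff_eq)
    have "length ?f + \<ell> (par ?J x) + 1 \<le> N - 1" using lf le len_par[of ?J x] by linarith
    moreover have "simple_edges (N - 1)" using IH[of "N - 1"] le by simp
    ultimately have "\<not> same_fibre ?f (par ?J x) (par ?J x \<otimes> r')"
      using cox_word_filter[OF g] pf up' sp unfolding simple_edges_def by blast
    then show False using sf r'(2) by simp
  next
    case False
    then have "set cs = {s}" using s by blast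
    moreover have "length cs = card (set cs)" using g by (simp add: cox_word_def distinct_card)
    ultimately have "set cs = {s}" "length cs = 1" by simp_all
    then have cs: "cs = [s]" by (cases cs) auto
    have "\<not> lower s x" using sx up by (simp add: lower_def)
    then have x1: "x = \<one>" using W_lower[OF K x] cs by auto
    then have "s = r" using sx c by simp
    moreover have "\<not> lower s \<one>" "lower s s" using c by (simp_all add: lower_def len_S)
    ultimately show False
      using sm x1 cs c S_ne_one[of s] by (simp add: same_fibre_def proj_lower proj_not_lower)
  qed
qed

text \<open>The first two statements need only smaller bounds. At the same \<open>N\<close>,
  parabolic edges rest on opposite edges, and simple edges on parabolic edges.\<close>

theorem edges: "opposite_edges N \<and> side_edges N \<and> parabolic_edges N \<and> simple_edges N"
proof (induction N rule: less_induct)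
  case (less N)
  have "opposite_edges N" using opposite_edges_step less by blast
  moreover have "side_edges N" using side_edges_step less by blast
  moreover have "parabolic_edges N" using parabolic_edges_step calculation less by blast
  moreover have "simple_edges N" using simple_edges_step calculation less by blast
  ultimately show ?case by blast
qed

section \<open>Fibres and cones\<close>

text \<open>The given simple roots are multiples of the \<open>n s\<close> with varying factors, so
  their images are roots of norm 1 only after positive scaling.\<close>

definition ray :: "'w set \<Rightarrow> 'v \<Rightarrow> bool" where
  "ray K x \<longleftrightarrow> (\<exists>r>0. \<exists>y. x = r *\<^sub>R y \<and> root y \<and> supp K y)"

lemma ray_mono: "ray K x \<Longrightarrow> K \<subseteq> L \<Longrightarrow> ray L x"
  unfolding ray_def using supp_mono by blast

lemma pos_scale_iff: "0 < r \<Longrightarrow> pos (r *\<^sub>R x) \<longleftrightarrow> pos x"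
  by (auto simp: pos_def zero_le_mult_iff)

lemma par_pos_ray:
  assumes "J \<subseteq> S" "w \<in> carrier G" "ray J x" shows "pos (\<rho> (inv (par J w)) x) \<longleftrightarrow> pos (\<rho> (inv w) x)"
  using assms par_pos_iff by (auto simp: ray_def pos_scale_iff)

text \<open>The set \<open>C\<close> of the projection of \<open>w\<close>, defined for every
  \<open>w\<close> so that it obeys the same recursion as \<open>proj\<close>. The simple roots are
  a parameter \<open>a\<close>, which admits any scaling.\<close>

function c_roots :: "('w \<Rightarrow> 'v) \<Rightarrow> 'w list \<Rightarrow> 'w \<Rightarrow> 'v set" where
  "c_roots a [] w = {}"
| "c_roots a (s # cs) w = (if lower s w then \<sigma> s ` c_roots a (cs @ [s]) (s \<otimes> w)
     else insert (a s) (c_roots a cs (par (set cs) w)))"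
  by pat_completeness auto
termination
  by (relation "measure (\<lambda>(a, cs, w). length cs + \<ell> w)") (auto simp: lower_def intro: le_imp_less_Suc len_par)

declare c_roots.simps(2) [simp del]

lemma c_roots_lower: "lower s w \<Longrightarrow> c_roots a (s # cs) w = \<sigma> s ` c_roots a (cs @ [s]) (s \<otimes> w)"
  and c_roots_not_lower: "\<not> lower s w \<Longrightarrow> c_roots a (s # cs) w = insert (a s) (c_roots a cs (par (set cs) w))"
  by (simp_all add: c_roots.simps(2))

lemma word_induct [consumes 2, case_names Nil lower not_lower]:
  assumes "cox_word cs" "w \<in> W (set cs)"
    and nil: "\<And>w. w \<in> W {} \<Longrightarrow> P [] w"
    and low: "\<And>s cs w. cox_word (s # cs) \<Longrightarrow> w \<in> W (set (s # cs)) \<Longrightarrow> lower s w \<Longrightarrow> cox_word (cs @ [s]) \<Longrightarrow>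
      s \<otimes> w \<in> W (set (cs @ [s])) \<Longrightarrow> P (cs @ [s]) (s \<otimes> w) \<Longrightarrow> P (s # cs) w"
    and nlow: "\<And>s cs w. cox_word (s # cs) \<Longrightarrow> w \<in> W (set (s # cs)) \<Longrightarrow> \<not> lower s w \<Longrightarrow>
      par (set cs) w \<in> W (set cs) \<Longrightarrow> P cs (par (set cs) w) \<Longrightarrow> P (s # cs) w"
  shows "P cs w"
  using assms(1,2)
proof (induction cs w rule: proj.induct)
  case (1 w)
  then show ?case using nil by simp
next
  case (2 s cs w)
  show ?case
  proof (cases "lower s w")
    case True
    then show ?thesis
      using 2(1)[OF True cox_word_rotate[OF 2(3)] W_Cons_mult[OF 2(4)]]
      by (intro low 2(3,4) cox_word_rotate W_Cons_mult)
  next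
    case False
    note c = cox_word_ctx[OF 2(3,4)]
    have p: "par (set cs) w \<in> W (set cs)" using par_in c by blast
    show ?thesis using 2(2)[OF False c(4) p] by (intro nlow 2(3,4) False p)
  qed
qed

lemma proj_proj: "cox_word cs \<Longrightarrow> w \<in> W (set cs) \<Longrightarrow> proj cs (proj cs w) = proj cs w \<and> c_roots a cs (proj cs w) = c_roots a cs w"
proof (induction cs w rule: word_induct)
  case (Nil w)
  then show ?case by simp
next
  case (lower s cs w)
  note c = cox_word_ctx[OF lower(1,2)]
  have "lower s (proj (s # cs) w)" using lower_proj lower by blast
  moreover have "s \<otimes> proj (s # cs) w = proj (cs @ [s]) (s \<otimes> w)"
    using lower c by (simp add: proj_lower)
  ultimately show ?case using lower by (simp add: proj_lower c_roots_lower)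
next
  case (not_lower s cs w)
  note c = cox_word_ctx[OF not_lower(1,2)]
  have "\<not> lower s (proj (s # cs) w)" using lower_proj not_lower by blast
  moreover have "par (set cs) (proj (s # cs) w) = proj cs (par (set cs) w)"
    using not_lower par_id[OF c(5) proj_in[OF c(4) not_lower(4)]] by (simp add: proj_not_lower)
  ultimately show ?case using not_lower by (simp add: proj_not_lower c_roots_not_lower)
qed

context
  fixes a :: "'w \<Rightarrow> 'v"
  assumes scale: "\<And>s. s \<in> S \<Longrightarrow> \<exists>r>0. a s = r *\<^sub>R n s"
begin

lemma ray_simple: "s \<in> K \<Longrightarrow> K \<subseteq> S \<Longrightarrow> ray K (a s)"
  using scale[of s] root_n[of s] supp_n[of s K] unfolding ray_def by blast

lemma pos_simple_iff: "s \<in> S \<Longrightarrow> pos (\<rho> w (a s)) \<longleftrightarrow> pos (\<rho> w (n s))"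
  using scale[of s] pos_scale_iff by auto

lemma c_roots_ray: "cox_word cs \<Longrightarrow> w \<in> W (set cs) \<Longrightarrow> x \<in> c_roots a cs w \<Longrightarrow> ray (set cs) x"
proof (induction cs w arbitrary: x rule: word_induct)
  case (lower s cs w)
  note c = cox_word_ctx[OF lower(1,2)]
  obtain x' where x': "x = \<sigma> s x'" "x' \<in> c_roots a (cs @ [s]) (s \<otimes> w)"
    using lower by (auto simp: c_roots_lower)
  then obtain r y where y: "r > 0" "x' = r *\<^sub>R y" "root y" "supp (set (s # cs)) y"
    using lower.IH[of x'] by (auto simp: ray_def)
  have "root (\<sigma> s y)" using root_rho[of s y] y c by simp
  moreover have "supp (set (s # cs)) (\<sigma> s y)" using supp_\<sigma>[OF _ _ y(4), of s] c by simp
  moreover have "x = r *\<^sub>R \<sigma> s y" using x' y by simp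
  ultimately show ?case using y(1) unfolding ray_def by blast
next
  case (not_lower s cs w)
  note c = cox_word_ctx[OF not_lower(1,2)]
  have "x = a s \<or> x \<in> c_roots a cs (par (set cs) w)" using not_lower by (auto simp: c_roots_not_lower)
  then show ?case
  proof
    assume "x = a s"
    then show ?thesis using ray_simple[of s "set (s # cs)"] c by simp
  next
    assume "x \<in> c_roots a cs (par (set cs) w)"
    then show ?thesis using not_lower.IH[of x] ray_mono[of "set cs" x "set (s # cs)"] by auto
  qed
qed auto

lemma c_roots_pos: "cox_word cs \<Longrightarrow> w \<in> W (set cs) \<Longrightarrow> x \<in> c_roots a cs w \<Longrightarrow> pos (\<rho> (inv w) x)"
proof (induction cs w arbitrary: x rule: word_induct)
  case (lower s cs w)
  note c = cox_word_ctx[OF lower(1,2)]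
  obtain x' where x': "x = \<sigma> s x'" "x' \<in> c_roots a (cs @ [s]) (s \<otimes> w)"
    using lower by (auto simp: c_roots_lower)
  then have "pos (\<rho> (inv (s \<otimes> w)) x')" using lower.IH by blast
  then show ?case using c x' by (simp add: inv_mult_group rho_mult)
next
  case (not_lower s cs w)
  note c = cox_word_ctx[OF not_lower(1,2)]
  have "x = a s \<or> x \<in> c_roots a cs (par (set cs) w)" using not_lower by (auto simp: c_roots_not_lower)
  then show ?case
  proof
    assume "x = a s"
    then show ?thesis using not_lower(3) lower_iff[OF c(1,2)] pos_simple_iff c by simp
  next
    assume x: "x \<in> c_roots a cs (par (set cs) w)"
    then show ?thesis
      using not_lower.IH[OF x] par_pos_ray[OF c(5,1) c_roots_ray[OF c(4) not_lower(4) x]] by simp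
  qed
qed auto

lemma adjacent:
  "cox_word cs \<Longrightarrow> w \<in> W (set cs) \<Longrightarrow> q \<in> set cs \<Longrightarrow> (\<And>x. x \<in> c_roots a cs w \<Longrightarrow> pos (\<rho> (inv (w \<otimes> q)) x)) \<Longrightarrow>
    same_fibre cs w (w \<otimes> q)"
proof (induction cs w arbitrary: q rule: word_induct)
  case (lower s cs w)
  note c = cox_word_ctx[OF lower(1,2)]
  note q = lower.prems(1) and C = lower.prems(2)
  have qS: "q \<in> S" using q c by auto
  have wq: "w \<otimes> q \<in> W (set (s # cs))" using W_mult_S lower(1,2) q by blast
  have C': "pos (\<rho> (inv (w \<otimes> q)) (\<sigma> s x))" if "x \<in> c_roots a (cs @ [s]) (s \<otimes> w)" for x
    using C[of "\<sigma> s x"] that lower(3) by (simp add: c_roots_lower)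
  show ?case
  proof (cases "lower s (w \<otimes> q)")
    case True
    have "same_fibre (cs @ [s]) (s \<otimes> w) (s \<otimes> w \<otimes> q)"
    proof (rule lower.IH)
      fix x assume "x \<in> c_roots a (cs @ [s]) (s \<otimes> w)"
      then show "pos (\<rho> (inv (s \<otimes> w \<otimes> q)) x)"
        using C'[of x] c qS by (simp add: inv_mult_group rho_mult)
    qed (use q in auto)
    then show ?thesis using same_lower[OF lower(1,2) wq lower(3) True] c qS by (simp add: m_assoc)
  next
    case False
    let ?y = "w \<otimes> q"
    have yc: "?y \<in> carrier G" "?y \<otimes> q = w" using c qS by auto
    have sy: "s \<otimes> ?y = w" using lower_change(1)[OF yc(1) c(2) qS False] lower(3) yc by simp
    then have y: "s \<otimes> w = ?y" using S_cancel_left[OF c(2) yc(1)] by simp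
    have "same_fibre (cs @ [s]) ?y (?y \<otimes> q)"
      unfolding y[symmetric]
    proof (rule lower.IH)
      fix x assume x: "x \<in> c_roots a (cs @ [s]) (s \<otimes> w)"
      \<comment> \<open>Here \<open>s \<otimes> w \<otimes> q\<close> is
        \<open>?y \<otimes> q = s \<otimes> ?y\<close>, so its condition on \<open>x\<close> is that
        of \<open>?y\<close> on \<open>\<sigma> s x\<close>.\<close>
      have "inv (s \<otimes> w \<otimes> q) = inv ?y \<otimes> s" using y yc sy c qS by (metis inv_S S_in_carrier inv_mult_group)
      then show "pos (\<rho> (inv (s \<otimes> w \<otimes> q)) x)" using C'[OF x] c yc by (simp add: rho_mult)
    qed (use q in auto)
    moreover have "\<ell> ?y < \<ell> (?y \<otimes> q)"
      using False len_S_mult_cases[OF yc(1) c(2)] sy yc(2) by (auto simp: lower_def)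
    moreover have "?y \<in> W (set (cs @ [s]))" using wq by simp
    ultimately have False
      using edges[of "length (cs @ [s]) + \<ell> ?y + 1"] lower(4) q sy yc(2)
      unfolding simple_edges_def by (metis order_refl set_rotate1 rotate1.simps(2) list.set_intros(1))
    then show ?thesis ..
  qed
next
  case (not_lower s cs w)
  note c = cox_word_ctx[OF not_lower(1,2)]
  note q = not_lower.prems(1) and C = not_lower.prems(2)
  have qS: "q \<in> S" using q c by auto
  \<comment> \<open>The root \<open>a s\<close> of the set keeps \<open>w \<otimes> q\<close> on the
    same side of the wall of \<open>s\<close> as \<open>w\<close>.\<close>
  have nl: "\<not> lower s (w \<otimes> q)"
    using C[of "a s"] lower_iff[of "w \<otimes> q" s] pos_simple_iff c qS not_lower(3) by (simp add: c_roots_not_lower)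
  have "same_fibre cs (par (set cs) w) (par (set cs) (w \<otimes> q))"
  proof (cases "par (set cs) (w \<otimes> q) = par (set cs) w")
    case False
    then obtain q' where q': "q' \<in> set cs" "par (set cs) (w \<otimes> q) = par (set cs) w \<otimes> q'"
      using par_adjacent[OF c(5,1) qS] by blast
    show ?thesis
      unfolding q'(2)
    proof (rule not_lower.IH[OF q'(1)])
      fix x assume x: "x \<in> c_roots a cs (par (set cs) w)"
      then have "pos (\<rho> (inv (w \<otimes> q)) x)" using C[of x] not_lower(3) by (simp add: c_roots_not_lower)
      then show "pos (\<rho> (inv (par (set cs) w \<otimes> q')) x)"
        using par_pos_ray[OF c(5) _ c_roots_ray[OF c(4) not_lower(4) x], of "w \<otimes> q"] q'(2) c qS by simp
    qed
  qed simp
  then show ?case using same_not_lower[OF not_lower(3) nl] by simp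
qed auto

lemma same_of_pos:
  assumes "cox_word cs" "v \<in> W (set cs)" "w \<in> W (set cs)" "\<And>x. x \<in> c_roots a cs v \<Longrightarrow> pos (\<rho> (inv w) x)"
  shows "same_fibre cs v w"
  using assms(2,4)
proof (induction "\<ell> (inv v \<otimes> w)" arbitrary: v rule: less_induct)
  case less
  note v = less.prems(1)
  have K: "set cs \<subseteq> S" using cox_word_subset assms by blast
  have c: "v \<in> carrier G" "w \<in> carrier G" using cox_word_W assms v by auto
  let ?g = "inv v \<otimes> w"
  have gW: "?g \<in> W (set cs)" using W_mult[OF W_inv[OF K v] assms(3)] .
  show ?case
  proof (cases "?g = \<one>")
    case True
    then have "w = v" using c by (metis inv_closed inv_equality inv_inv)
    then show ?thesis by simp
  next
    case False
    then obtain j where j: "j \<in> set cs" "lower j ?g" by (rule W_lower[OF K gW])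
    have jS: "j \<in> S" using j K by auto
    have "pos (\<rho> (inv (v \<otimes> j)) x)" if x: "x \<in> c_roots a cs v" for x
    proof -
      obtain r y where y: "r > 0" "x = r *\<^sub>R y" "root y" using c_roots_ray[OF assms(1) v x] by (auto simp: ray_def)
      let ?d = "\<rho> (inv v) y"
      have d: "root ?d" "pos ?d" using c_roots_pos[OF assms(1) v x] y root_rho c by (auto simp: pos_scale_iff)
      have "\<rho> (inv ?g) ?d = \<rho> (inv w) y" using c by (simp add: inv_mult_group rho_mult)
      then have "pos (\<rho> (inv ?g) ?d)" using less.prems(2)[OF x] y by (simp add: pos_scale_iff)
      \<comment> \<open>As \<open>j\<close> is a left descent of \<open>?g\<close>, the root
        \<open>n j\<close> is negative there, whereas \<open>?d\<close> is positive at both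
        ends.\<close>
      then have "?d \<noteq> n j" using j(2) lower_iff[of ?g j] c jS by auto
      then have "pos (\<sigma> j ?d)" using pos_\<sigma> d jS by blast
      then show ?thesis using y c jS by (simp add: inv_mult_group rho_mult pos_scale_iff)
    qed
    then have s1: "same_fibre cs v (v \<otimes> j)" using adjacent[OF assms(1) v j(1)] by blast
    have vj: "v \<otimes> j \<in> W (set cs)" using W_mult_S assms(1) v j(1) by blast
    \<comment> \<open>The cone is constant on fibres, so the walk continues from
      \<open>v \<otimes> j\<close> with the same roots.\<close>
    have "c_roots a cs (v \<otimes> j) = c_roots a cs v"
      using s1 proj_proj[OF assms(1) v] proj_proj[OF assms(1) vj] unfolding same_fibre_def by metis
    moreover have "inv (v \<otimes> j) \<otimes> w = j \<otimes> ?g" using c jS by (simp add: inv_mult_group m_assoc)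
    ultimately have "same_fibre cs (v \<otimes> j) w"
      using less.hyps[of "v \<otimes> j"] j(2) vj less.prems(2) by (simp add: lower_def)
    then show ?thesis using s1 by (simp add: same_fibre_def)
  qed
qed

theorem fibre_iff:
  assumes "cox_word cs" "v \<in> W (set cs)" "w \<in> W (set cs)" "proj cs v = v"
  shows "proj cs w = v \<longleftrightarrow> (\<forall>x\<in>c_roots a cs v. pos (\<rho> (inv w) x))"
proof
  assume "proj cs w = v"
  then have "c_roots a cs v = c_roots a cs w" using proj_proj[OF assms(1,3)] by metis
  then show "\<forall>x\<in>c_roots a cs v. pos (\<rho> (inv w) x)" using c_roots_pos assms by blast
next
  assume "\<forall>x\<in>c_roots a cs v. pos (\<rho> (inv w) x)"
  then have "same_fibre cs v w" using same_of_pos assms by blast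
  then show "proj cs w = v" using assms(4) by (simp add: same_fibre_def)
qed

end

section \<open>Independence of the Coxeter word\<close>

text \<open>If \<open>s\<close> were missing, solving for it would put \<open>s\<close> into the
  parabolic subgroup of the other letters, which has no element above \<open>s\<close>.\<close>

lemma letters_needed:
  assumes "cox_word cs" "set u \<subseteq> S" "wp u = wp cs" shows "set cs \<subseteq> set u"
proof (rule ccontr)
  assume "\<not> ?thesis"
  then obtain s where s: "s \<in> set cs" "s \<notin> set u" by blast
  then obtain p q where cs: "cs = p @ s # q" by (metis split_list)
  let ?J = "S - {s}"
  have c: "s \<in> S" "set p \<subseteq> ?J" "set q \<subseteq> ?J" "set u \<subseteq> ?J" using assms cs s by (auto simp: cox_word_def)
  have i: "wp p \<in> W ?J" "wp q \<in> W ?J" "wp u \<in> W ?J" using c by (auto intro: W_wp)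
  have cl: "wp p \<in> carrier G" "wp q \<in> carrier G" using i W_closed[of ?J] by auto
  have "set p \<subseteq> S" "set (s # q) \<subseteq> S" using c by auto
  then have "wp cs = wp p \<otimes> (s \<otimes> wp q)" unfolding cs by (simp only: wp_append_S wp_Cons)
  then have "s = inv (wp p) \<otimes> (wp u \<otimes> inv (wp q))"
    using cl c assms(3) by (simp add: m_assoc)
  moreover have "inv (wp p) \<otimes> (wp u \<otimes> inv (wp q)) \<in> W ?J"
    using i by (intro W_mult W_inv) auto
  ultimately have "s \<in> W ?J" by simp
  then show False using not_lower_W[of ?J s s] c(1) by (auto simp: lower_def len_S)
qed

lemma len_coxeter: "cox_word cs \<Longrightarrow> \<ell> (wp cs) = length cs"
proof -
  assume g: "cox_word cs"
  have "set cs \<subseteq> S" using g cox_word_subset by blast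
  then obtain u where u: "set u \<subseteq> S" "wp u = wp cs" "length u = \<ell> (wp cs)"
    using reduced_exists[OF wp_closed_S] by blast
  have "length cs = card (set cs)" using g by (simp add: cox_word_def distinct_card)
  also have "\<dots> \<le> card (set u)" using letters_needed[OF g u(1,2)] by (intro card_mono) auto
  also have "\<dots> \<le> length u" by (rule card_length)
  finally show ?thesis using u(3) len_le[of cs] cox_word_subset[OF g] by simp
qed

lemma reduced_coxeter:
  assumes "cox_word cs" "set u \<subseteq> S" "wp u = wp cs" "length u = \<ell> (wp cs)"
  shows "cox_word u" "set u = set cs"
proof -
  have l: "length u = card (set cs)" using assms len_coxeter by (simp add: cox_word_def distinct_card)
  have sub: "set cs \<subseteq> set u" using letters_needed assms by blast
  have "card (set u) \<le> card (set cs)" using card_length[of u] l by simp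
  then show e: "set u = set cs" using sub by (metis card_seteq finite_set)
  then have "distinct u" using l by (intro card_distinct) simp
  then show "cox_word u" using assms(2) by (simp add: cox_word_def)
qed

text \<open>If the leading letter \<open>a\<close> did not fix \<open>n s\<close>, then
  \<open>\<sigma> a (n s)\<close> would have a positive coordinate at \<open>a\<close>. The rest of
  the word does not contain \<open>a\<close>, so the root would stay positive and \<open>s\<close>
  would not be a left descent.\<close>

lemma initial_commutes:
  "cox_word (p @ s # q) \<Longrightarrow> lower s (wp (p @ s # q)) \<Longrightarrow> t \<in> set p \<Longrightarrow> s \<otimes> t = t \<otimes> s \<and> \<sigma> t (n s) = n s"
proof (induction p)
  case (Cons a p)
  let ?c = "wp (p @ s # q)"
  have g: "cox_word (p @ s # q)" and a: "a \<in> S" "a \<notin> set (p @ s # q)" and s: "s \<in> S"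
    using Cons.prems by (auto simp: cox_word_def)
  have c: "?c \<in> carrier G" "?c \<in> W (set (p @ s # q))" using wp_closed_S cox_word_subset[OF g] W_wp by blast+
  have ic: "inv ?c \<in> W (set (p @ s # q))" using W_inv[OF cox_word_subset[OF g] c(2)] .
  have np: "\<not> pos (\<rho> (inv ?c) (\<sigma> a (n s)))"
    using Cons.prems(2) lower_iff[of "a \<otimes> ?c" s] a s c by (simp add: inv_mult_group rho_mult)
  have "b a s = 0"
  proof (rule ccontr)
    assume "b a s \<noteq> 0"
    moreover have "b a s \<le> 0" using b_nonpos a s by auto
    ultimately have "cf a (\<sigma> a (n s)) > 0" using a s by (auto simp: cf_\<sigma>_self bf_n cf_n)
    then have "cf a (\<rho> (inv ?c) (\<sigma> a (n s))) > 0"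
      using cf_rho_W[OF cox_word_subset[OF g] ic] a by simp
    moreover have "root (\<rho> (inv ?c) (\<sigma> a (n s)))" using root_rho[OF _ root_rho[OF _ root_n[OF s]], of "inv ?c" a] a c by simp
    ultimately show False using pos_by_coord a np by blast
  qed
  then have fix_n: "\<sigma> a (n s) = n s" using s by (simp add: \<sigma>_def bf_n)
  then have com: "s \<otimes> a = a \<otimes> s" using conj_eq_mult[of a s s] a s by simp
  have "lower s ?c" using np fix_n lower_iff c s by simp
  then show ?case using Cons.IH[OF g] Cons.prems(3) fix_n com by auto
qed simp

lemma wp_commute: "set p \<subseteq> S \<Longrightarrow> s \<in> S \<Longrightarrow> (\<And>t. t \<in> set p \<Longrightarrow> s \<otimes> t = t \<otimes> s) \<Longrightarrow> wp p \<otimes> s = s \<otimes> wp p"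
proof (induction p)
  case (Cons t p)
  have c: "t \<in> S" "wp p \<in> carrier G" using Cons.prems wp_closed_S by auto
  have "wp (t # p) \<otimes> s = t \<otimes> (s \<otimes> wp p)" using Cons c by (simp add: m_assoc)
  also have "\<dots> = s \<otimes> wp (t # p)" using Cons.prems c by (simp add: m_assoc[symmetric])
  finally show ?case .
qed simp

text \<open>The recursion treats the commuting letters independently. Only when both lie below
  \<open>w\<close> do different words remain, with the swap now at their ends; this case is left to
  \<open>IH\<close>.\<close>

lemma commuting_swap:
  assumes g: "cox_word (s # t # z)" and w: "w \<in> W (set (s # t # z))" and com: "s \<otimes> t = t \<otimes> s"
    and fix_n: "\<sigma> s (n t) = n t" "\<sigma> t (n s) = n s" "\<sigma> s (a t) = a t" "\<sigma> t (a s) = a s"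
    and IH: "lower s w \<Longrightarrow> lower t w \<Longrightarrow> proj (z @ [s] @ [t]) (s \<otimes> (t \<otimes> w)) = proj (z @ [t] @ [s]) (s \<otimes> (t \<otimes> w)) \<and>
      c_roots a (z @ [s] @ [t]) (s \<otimes> (t \<otimes> w)) = c_roots a (z @ [t] @ [s]) (s \<otimes> (t \<otimes> w))"
  shows "proj (s # t # z) w = proj (t # s # z) w \<and> c_roots a (s # t # z) w = c_roots a (t # s # z) w"
proof -
  note c = cox_word_ctx[OF g w]
  have t: "t \<in> S" "t \<notin> set z" "set z \<subseteq> S" "s \<notin> set z" "s \<noteq> t" using g by (auto simp: cox_word_def)
  have lst: "lower t (s \<otimes> w) = lower t w" "lower s (t \<otimes> w) = lower s w"
    using lower_iff[of "s \<otimes> w" t] lower_iff[of w t] lower_iff[of "t \<otimes> w" s] lower_iff[of w s] c t fix_n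
    by (simp_all add: inv_mult_group rho_mult)
  have ss: "s \<otimes> (t \<otimes> v) = t \<otimes> (s \<otimes> v)" if "v \<in> carrier G" for v
    using com that c t by (metis S_in_carrier m_assoc)
  have sub: "insert s (set z) \<subseteq> S" "insert t (set z) \<subseteq> S" using c t by auto
  have lp: "lower t (par (insert t (set z)) v) = lower t v" "lower s (par (insert s (set z)) v) = lower s v"
    if "v \<in> carrier G" for v using lower_par sub that by auto
  have pm: "par (insert t (set z)) (t \<otimes> w) = t \<otimes> par (insert t (set z)) w"
    "par (insert s (set z)) (s \<otimes> w) = s \<otimes> par (insert s (set z)) w"
    using par_mult[OF sub(2) c(1) W_incl] par_mult[OF sub(1) c(1) W_incl] by auto
  have pp: "par (set z) (par (insert t (set z)) w) = par (set z) w"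
    "par (set z) (par (insert s (set z)) w) = par (set z) w"
    using par_par[OF _ sub(2) c(1)] par_par[OF _ sub(1) c(1)] by auto
  have \<sigma>\<sigma>: "\<sigma> s (\<sigma> t x) = \<sigma> t (\<sigma> s x)" for x
    using rho_mult[of s t x] rho_mult[of t s x] com c t by simp
  show ?thesis
  proof (cases "lower s w"; cases "lower t w")
    assume l: "lower s w" "lower t w"
    have gz: "cox_word (z @ [s] @ [t])" "s \<otimes> (t \<otimes> w) \<in> W (set (z @ [s] @ [t]))"
      using g w W_mult[OF W_incl[of s] W_mult[OF W_incl[of t] w]] by (auto simp: cox_word_def insert_commute)
    have "proj (z @ [s] @ [t]) (s \<otimes> (t \<otimes> w)) \<in> carrier G" using proj_carrier[OF gz] .
    then show ?thesis
      using l lst IH[OF l] ss[OF c(1)] ss[of "proj (z @ [s] @ [t]) (s \<otimes> (t \<otimes> w))"]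
      by (simp add: proj_lower c_roots_lower image_image \<sigma>\<sigma>)
  next
    assume l: "lower s w" "\<not> lower t w"
    then show ?thesis
      using lst lp c pm by (simp add: proj_lower proj_not_lower c_roots_lower c_roots_not_lower fix_n image_image)
  next
    assume l: "\<not> lower s w" "lower t w"
    then show ?thesis
      using lst lp c pm by (simp add: proj_lower proj_not_lower c_roots_lower c_roots_not_lower fix_n)
  next
    assume l: "\<not> lower s w" "\<not> lower t w"
    then show ?thesis
      using lst lp c pp by (simp add: proj_not_lower c_roots_not_lower insert_commute)
  qed
qed

text \<open>With equal first letters the recursion applies. Otherwise the first letter
  \<open>s'\<close> of the second word commutes with all that precedes it in the first word, so it
  can be moved up next to \<open>s\<close>; the two words are then linked through words starting
  with \<open>s # s'\<close> and \<open>s' # s\<close> and having the same rest.\<close>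

theorem word_independent:
  assumes scale: "\<And>s. s \<in> S \<Longrightarrow> \<exists>r>0. a s = r *\<^sub>R n s"
  shows "cox_word cs \<Longrightarrow> cox_word cs' \<Longrightarrow> wp cs = wp cs' \<Longrightarrow> w \<in> W (set cs) \<Longrightarrow>
    proj cs w = proj cs' w \<and> c_roots a cs w = c_roots a cs' w"
proof (induction "length cs + \<ell> w" arbitrary: cs cs' w rule: less_induct)
  case less
  have same_set: "set us = set vs" "length us = length vs" if "cox_word us" "cox_word vs" "wp us = wp vs" for us vs
    using letters_needed[of us vs] letters_needed[of vs us] len_coxeter[of us] len_coxeter[of vs]
      that cox_word_subset by auto
  have head: "proj (s # us) w = proj (s # vs) w \<and> c_roots a (s # us) w = c_roots a (s # vs) w"
    if g: "cox_word (s # us)" "cox_word (s # vs)" and e: "wp (s # us) = wp (s # vs)" and l: "length (s # us) = length cs"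
      and w: "w \<in> W (set (s # us))" for s us vs
  proof -
    note c = cox_word_ctx[OF g(1) w]
    have S: "set us \<subseteq> S" "set vs \<subseteq> S" using g by (auto simp: cox_word_def)
    have "s \<otimes> (s \<otimes> wp us) = s \<otimes> (s \<otimes> wp vs)" using e by simp
    then have e': "wp us = wp vs" using c S wp_closed_S by simp
    have gu: "cox_word us" "cox_word vs" using g by (auto simp: cox_word_def)
    have su: "set us = set vs" using same_set[OF gu e'] by simp
    show ?thesis
    proof (cases "lower s w")
      case True
      have "wp (us @ [s]) = wp (vs @ [s])" using e' S c by (simp add: wp_append_S)
      moreover have "length (us @ [s]) + \<ell> (s \<otimes> w) < length cs + \<ell> w" using True l by (simp add: lower_def)
      ultimately have "proj (us @ [s]) (s \<otimes> w) = proj (vs @ [s]) (s \<otimes> w) \<and>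
          c_roots a (us @ [s]) (s \<otimes> w) = c_roots a (vs @ [s]) (s \<otimes> w)"
        using less.hyps cox_word_rotate[OF g(1)] cox_word_rotate[OF g(2)] W_Cons_mult[OF w] by blast
      then show ?thesis using True by (simp add: proj_lower c_roots_lower)
    next
      case False
      have "length us + \<ell> (par (set us) w) < length cs + \<ell> w" using l len_par[of "set us" w] by simp
      then have "proj us (par (set us) w) = proj vs (par (set us) w) \<and>
          c_roots a us (par (set us) w) = c_roots a vs (par (set us) w)"
        using less.hyps gu e' par_in[OF S(1) c(1)] by blast
      then show ?thesis using False su by (simp add: proj_not_lower c_roots_not_lower)
    qed
  qed
  note ss = same_set[OF less.prems(1-3)]
  show ?case
  proof (cases cs)
    case Nil
    then show ?thesis using ss by simp
  next
    case (Cons s ds)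
    then obtain s' ds' where cs': "cs' = s' # ds'" using ss by (cases cs') auto
    note g = less.prems(1)[unfolded Cons] and g' = less.prems(2)[unfolded cs']
    have e: "wp (s # ds) = wp (s' # ds')" using less.prems(3) Cons cs' by simp
    have w: "w \<in> W (set (s # ds))" "w \<in> W (set (s' # ds'))" using less.prems(4) ss Cons cs' by auto
    show ?thesis
    proof (cases "s = s'")
      case True
      then show ?thesis using head[of s ds ds'] g g' e w Cons cs' by simp
    next
      case False
      have "s' \<in> set ds" using ss Cons cs' False by auto
      then obtain p q where ds: "ds = p @ s' # q" by (metis split_list)
      have S: "s \<in> S" "s' \<in> S" "set p \<subseteq> S" "set q \<subseteq> S" "set ds' \<subseteq> S"
        using g g' by (auto simp: cox_word_def ds)
      have low: "lower s' (wp ((s # p) @ s' # q))"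
        using e S wp_closed_S[of ds'] len_coxeter[OF g'] len_le[of ds'] by (simp add: lower_def ds)
      have gp: "cox_word ((s # p) @ s' # q)" using g ds by simp
      note com = initial_commutes[OF gp low]
      let ?z = "p @ q"
      have gz: "cox_word (s # s' # ?z)" "cox_word (s' # s # ?z)" using g by (auto simp: cox_word_def ds)
      have cl: "wp p \<in> carrier G" "wp q \<in> carrier G" using S wp_closed_S by auto
      have "wp p \<otimes> s' = s' \<otimes> wp p" using wp_commute[OF S(3,2)] com by auto
      then have e1: "wp (s # ds) = wp (s # s' # ?z)"
        unfolding ds using S cl by (simp add: wp_append_S m_assoc[symmetric])
      have sc: "s' \<otimes> s = s \<otimes> s'" "\<sigma> s (n s') = n s'" using com[of s] by auto
      have "b s s' *\<^sub>R n s = 0" using sc(2) S by (simp add: \<sigma>_def bf_n)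
      then have "b s s' = 0" using root_nonzero[OF root_n[OF S(1)]] by simp
      then have f: "\<sigma> s' (n s) = n s" using S b_sym[of s' s] by (simp add: \<sigma>_def bf_n)
      have fa: "\<sigma> s (a s') = a s'" "\<sigma> s' (a s) = a s" using scale[OF S(1)] scale[OF S(2)] sc(2) f by auto
      have zc: "wp ?z \<in> carrier G" using S wp_closed_S by auto
      have e2: "wp (s # s' # ?z) = wp (s' # s # ?z)"
        using sc(1) S zc by (simp add: m_assoc[symmetric])
      have swap: "proj (s # s' # ?z) w = proj (s' # s # ?z) w \<and> c_roots a (s # s' # ?z) w = c_roots a (s' # s # ?z) w"
      proof (rule commuting_swap[OF gz(1) _ sc(1)[symmetric] sc(2) f fa])
        show wz: "w \<in> W (set (s # s' # ?z))"
          using w(1) by (simp add: ds insert_commute Un_commute)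
        assume l: "lower s w" "lower s' w"
        have c: "w \<in> carrier G" using cox_word_W[OF g w(1)] .
        have "\<ell> (s \<otimes> (s' \<otimes> w)) \<le> \<ell> (s' \<otimes> w) + 1" using len_S_mult_cases[of "s' \<otimes> w" s] S c by auto
        moreover have "lower s (s' \<otimes> w)"
          using lower_iff[of "s' \<otimes> w" s] lower_iff[of w s] l S c f by (simp add: inv_mult_group rho_mult)
        ultimately have "length (?z @ [s] @ [s']) + \<ell> (s \<otimes> (s' \<otimes> w)) < length cs + \<ell> w"
          using l Cons ds by (simp add: lower_def)
        moreover have "cox_word (?z @ [s] @ [s'])" "cox_word (?z @ [s'] @ [s])" using gz by (auto simp: cox_word_def)
        moreover have "wp (?z @ [s] @ [s']) = wp (?z @ [s'] @ [s])"
          using S zc sc(1) by (simp add: wp_append_S m_assoc)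
        moreover have "s \<otimes> (s' \<otimes> w) \<in> W (set (?z @ [s] @ [s']))"
          using wz W_mult[OF W_incl[of s] W_mult[OF W_incl[of s'] wz]] by (simp add: insert_commute)
        ultimately show "proj (?z @ [s] @ [s']) (s \<otimes> (s' \<otimes> w)) = proj (?z @ [s'] @ [s]) (s \<otimes> (s' \<otimes> w)) \<and>
          c_roots a (?z @ [s] @ [s']) (s \<otimes> (s' \<otimes> w)) = c_roots a (?z @ [s'] @ [s]) (s \<otimes> (s' \<otimes> w))"
          using less.hyps by blast
      qed
      have "proj (s # ds) w = proj (s # s' # ?z) w \<and> c_roots a (s # ds) w = c_roots a (s # s' # ?z) w"
        using head[OF g gz(1) e1 _ w(1)] Cons by simp
      moreover have "proj (s' # s # ?z) w = proj (s' # ds') w \<and> c_roots a (s' # s # ?z) w = c_roots a (s' # ds') w"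
      proof (rule head[OF gz(2) g'])
        show "wp (s' # s # ?z) = wp (s' # ds')" using e e1 e2 by simp
        show "length (s' # s # ?z) = length cs" using Cons ds by simp
        show "w \<in> W (set (s' # s # ?z))" using w(1) by (simp add: ds insert_commute Un_commute)
      qed
      ultimately show ?thesis using swap Cons cs' by simp
    qed
  qed
qed

section \<open>Inversions by reflections\<close>

text \<open>Replacing \<open>x\<close> by \<open>x \<otimes> s\<close> negates the root and keeps
  the reflection; \<open>len_reflection\<close> asks for a positive root.\<close>

lemma reflection_root:
  assumes "K \<subseteq> S" "x \<in> W K" "s \<in> K"
  obtains y where "y \<in> W K" "x \<otimes> s \<otimes> inv x = y \<otimes> s \<otimes> inv y" "pos (\<rho> y (n s))"
    "\<rho> y (n s) = \<rho> x (n s) \<or> \<rho> y (n s) = - \<rho> x (n s)"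
proof (cases "pos (\<rho> x (n s))")
  case True
  then show ?thesis using that assms by blast
next
  case False
  have c: "x \<in> carrier G" "s \<in> S" using assms W_closed[OF assms(1)] by auto
  have "x \<otimes> s \<in> W K" using W_mult[OF assms(2) W_incl[OF assms(3)]] .
  moreover have "x \<otimes> s \<otimes> inv x = (x \<otimes> s) \<otimes> s \<otimes> inv (x \<otimes> s)"
    using c by (simp add: inv_mult_group m_assoc)
  moreover have e: "\<rho> (x \<otimes> s) (n s) = - \<rho> x (n s)" using c by (simp add: rho_mult \<sigma>_n)
  moreover have "pos (- \<rho> x (n s))" using False root_cases[OF root_rho[OF c(1) root_n[OF c(2)]]] by blast
  ultimately show ?thesis using that by metis
qed

lemma reflections_W: "K \<subseteq> S \<Longrightarrow> t \<in> reflections G K \<Longrightarrow> t \<in> W K"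
proof -
  assume K: "K \<subseteq> S" and "t \<in> reflections G K"
  then obtain x s where t: "t = x \<otimes> s \<otimes> inv x" and x: "x \<in> W K" and s: "s \<in> K"
    by (auto simp: reflections_def)
  show ?thesis unfolding t by (rule W_mult[OF W_mult[OF x W_incl[OF s]] W_inv[OF K x]])
qed

lemma inversions_iff:
  assumes "K \<subseteq> S" "w \<in> W K"
  shows "t \<in> inversions G K w \<longleftrightarrow> t \<in> reflections G K \<and> \<ell> (t \<otimes> w) < \<ell> w"
proof -
  have "cox_length G K (t \<otimes> w) = \<ell> (t \<otimes> w)" if "t \<in> reflections G K"
    using len_parabolic[OF assms(1) W_mult[OF reflections_W[OF assms(1) that] assms(2)]] .
  then show ?thesis using len_parabolic[OF assms] by (auto simp: inversions_def)
qed

lemma simple_reflection: "s \<in> K \<Longrightarrow> K \<subseteq> S \<Longrightarrow> s \<in> reflections G K"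
proof -
  assume "s \<in> K" "K \<subseteq> S"
  then have "s = \<one> \<otimes> s \<otimes> inv \<one>" "\<one> \<in> W K" using W_one[of G K] by auto
  with \<open>s \<in> K\<close> show ?thesis unfolding reflections_def by blast
qed

lemma weak_le_iff:
  assumes "K \<subseteq> S" "s \<in> K" "w \<in> W K" shows "weak_le G K s w \<longleftrightarrow> lower s w"
proof -
  have s: "s \<in> S" "s \<in> W K" using assms W_incl by auto
  have "t = s" if "t \<in> reflections G K" "\<ell> (t \<otimes> s) < \<ell> s" for t
  proof -
    have t: "t \<in> carrier G" using that reflections_W W_closed assms by blast
    have "t \<otimes> s = \<one>" using that(2) s t len_0_iff[of "t \<otimes> s"] by (simp add: len_S)
    then have "t \<otimes> s \<otimes> s = s" using s by simp
    then show ?thesis using t s by simp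
  qed
  then have "inversions G K s = {s}"
    using inversions_iff[OF assms(1) s(2)] simple_reflection[OF assms(2,1)] s by (auto simp: len_S)
  then show ?thesis
    using inversions_iff[OF assms(1,3)] simple_reflection[OF assms(2,1)] by (auto simp: weak_le_def lower_def)
qed

lemma supp_reflection:
  assumes "J \<subseteq> S" "y \<in> carrier G" "s \<in> S" "y \<otimes> s \<otimes> inv y \<in> W J" shows "supp J (\<rho> y (n s))"
proof -
  let ?x = "\<rho> y (n s)"
  have "\<rho> (y \<otimes> s \<otimes> inv y) ?x = - ?x" using assms by (simp add: rho_mult \<sigma>_n)
  then have "supp J (- ?x - ?x)" using rho_W_diff[OF assms(1,4), of ?x] by simp
  then show ?thesis by (auto simp: supp_def)
qed

text \<open>By exchange, \<open>t \<otimes> u\<close> arises from a reduced word in \<open>J\<close>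
  by deleting a letter, so it lies in \<open>W J\<close>, and \<open>t\<close> with it.\<close>

lemma reflection_in_W:
  assumes "J \<subseteq> S" "u \<in> W J" "t \<in> reflections G S" "\<ell> (t \<otimes> u) < \<ell> u" shows "t \<in> W J"
proof -
  obtain x s where "t = x \<otimes> s \<otimes> inv x" "x \<in> W S" "s \<in> S" using assms(3) by (auto simp: reflections_def)
  then obtain y where y: "y \<in> W S" "t = y \<otimes> s \<otimes> inv y" "pos (\<rho> y (n s))"
    using reflection_root[OF subset_refl] by metis
  have c: "y \<in> carrier G" "s \<in> S" "u \<in> carrier G" using y W_S \<open>s \<in> S\<close> W_closed[OF assms(1,2)] by auto
  obtain v where v: "set v \<subseteq> J" "wp v = u" "length v = \<ell> u" by (rule W_reduced[OF assms(1,2)])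
  have "\<not> pos (\<rho> (inv u) (\<rho> y (n s)))" using len_reflection[OF c y(3)] assms(4) y(2) by simp
  then obtain i where i: "t \<otimes> u = wp (take i v @ drop (Suc i) v)"
    using exchange_word[of v y s] v c assms(1) y by auto
  have "set (take i v @ drop (Suc i) v) \<subseteq> J"
    using v set_take_subset[of i v] set_drop_subset[of "Suc i" v] by auto
  then have "t \<otimes> u \<in> W J" unfolding i by (rule W_wp)
  then have "t \<otimes> u \<otimes> inv u \<in> W J" by (rule W_mult[OF _ W_inv[OF assms(1,2)]])
  then show ?thesis using c y by (simp add: m_assoc)
qed

lemma reflections_mono: "J \<subseteq> K \<Longrightarrow> reflections G J \<subseteq> reflections G K"
proof -
  assume "J \<subseteq> K"
  then have "W J \<subseteq> W K" by (rule mono_generate)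
  then show ?thesis using \<open>J \<subseteq> K\<close> unfolding reflections_def by blast
qed

text \<open>Together with \<open>inversions_inj\<close> this identifies the definition by inversions
  with the factor of the coset decomposition. A reflection in \<open>W J\<close> has its root in the
  span of \<open>J\<close>, where \<open>w\<close> and \<open>par J w\<close> have the same
  signs.\<close>

lemma inversions_par:
  assumes "J \<subseteq> K" "K \<subseteq> S" "w \<in> W K"
  shows "inversions G K (par J w) = inversions G K w \<inter> W J"
proof -
  have J: "J \<subseteq> S" using assms by auto
  have w: "w \<in> carrier G" using W_closed assms by blast
  let ?u = "par J w"
  have u: "?u \<in> W J" "?u \<in> W K" using par_in[OF J w] W_mono[OF assms(1)] by auto
  have *: "\<ell> (t \<otimes> ?u) < \<ell> ?u \<longleftrightarrow> \<ell> (t \<otimes> w) < \<ell> w" if t: "t \<in> reflections G K" "t \<in> W J" for t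
  proof -
    obtain x s where "t = x \<otimes> s \<otimes> inv x" "x \<in> W K" "s \<in> K" using t(1) by (auto simp: reflections_def)
    then obtain y where y: "y \<in> W K" "t = y \<otimes> s \<otimes> inv y" "pos (\<rho> y (n s))"
      using reflection_root[OF assms(2)] by metis
    have c: "y \<in> carrier G" "s \<in> S" using y W_closed assms \<open>s \<in> K\<close> by auto
    have "supp J (\<rho> y (n s))" using supp_reflection[OF J c] t(2) y(2) by simp
    then show ?thesis
      using len_reflection[OF c w y(3)] len_reflection[OF c _ y(3), of ?u] par_closed[OF J w]
        par_pos_iff[OF J w root_rho[OF c(1) root_n[OF c(2)]]] y(2) by simp
  qed
  have "t \<in> W J" if "t \<in> reflections G K" "\<ell> (t \<otimes> ?u) < \<ell> ?u" for t
    using reflection_in_W[OF J u(1)] that reflections_mono[OF assms(2)] by blast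
  then show ?thesis
    using * inversions_iff[OF assms(2) u(2)] inversions_iff[OF assms(2,3)] by blast
qed

text \<open>A left descent \<open>j\<close> of \<open>inv u \<otimes> v\<close> yields the root
  \<open>\<rho> u (n j)\<close>, whose wall bounds the chamber of \<open>u\<close> and separates it
  from that of \<open>v\<close>. Its reflection is an inversion of exactly one of the two.\<close>

lemma inversions_inj:
  assumes "J \<subseteq> K" "K \<subseteq> S" "u \<in> W J" "v \<in> W J" "inversions G K u = inversions G K v" shows "u = v"
proof (rule ccontr)
  assume ne: "u \<noteq> v"
  have J: "J \<subseteq> S" using assms by auto
  have c: "u \<in> carrier G" "v \<in> carrier G" using W_closed[OF J] assms by auto
  have K: "u \<in> W K" "v \<in> W K" using W_mono[OF assms(1)] assms by auto
  let ?g = "inv u \<otimes> v"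
  have g: "?g \<in> W J" using W_mult[OF W_inv[OF J assms(3)] assms(4)] .
  have "?g \<noteq> \<one>" using ne c by (metis inv_closed inv_equality inv_inv)
  then obtain j where j: "j \<in> J" "lower j ?g" by (rule W_lower[OF J g])
  have jS: "j \<in> S" "j \<in> K" using j J assms by auto
  have np: "\<not> pos (\<rho> (inv v) (\<rho> u (n j)))"
    using j(2) lower_iff[of ?g j] c jS by (simp add: inv_mult_group rho_mult)
  have r: "root (\<rho> (inv v) (\<rho> u (n j)))" using root_rho root_n c jS by simp
  obtain y where y: "y \<in> W K" "u \<otimes> j \<otimes> inv u = y \<otimes> j \<otimes> inv y" "pos (\<rho> y (n j))"
    "\<rho> y (n j) = \<rho> u (n j) \<or> \<rho> y (n j) = - \<rho> u (n j)"
    by (rule reflection_root[OF assms(2) K(1) jS(2)])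
  let ?t = "y \<otimes> j \<otimes> inv y"
  have yc: "y \<in> carrier G" using y W_closed assms by blast
  have t: "?t \<in> reflections G K" using y jS by (auto simp: reflections_def)
  have "\<ell> (?t \<otimes> u) < \<ell> u \<longleftrightarrow> \<not> pos (\<rho> (inv u) (\<rho> y (n j)))"
    "\<ell> (?t \<otimes> v) < \<ell> v \<longleftrightarrow> \<not> pos (\<rho> (inv v) (\<rho> y (n j)))"
    using len_reflection[OF yc jS(1) _ y(3)] c by auto
  moreover have "pos (\<rho> (inv u) (\<rho> y (n j))) \<longleftrightarrow> \<not> pos (\<rho> (inv v) (\<rho> y (n j)))"
    using y(4)
  proof
    assume e: "\<rho> y (n j) = \<rho> u (n j)"
    then show ?thesis using np c jS pos_n by simp
  next
    assume e: "\<rho> y (n j) = - \<rho> u (n j)"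
    have "\<not> pos (- n j)" using root_not_both[OF root_n pos_n] jS by blast
    moreover have "pos (- \<rho> (inv v) (\<rho> u (n j)))" using root_cases[OF r] np by blast
    ultimately show ?thesis unfolding e using c by simp
  qed
  ultimately show False
    using t assms(5) inversions_iff[OF assms(2) K(1)] inversions_iff[OF assms(2) K(2)] by blast
qed

lemma parabolic_part_eq:
  assumes "J \<subseteq> K" "K \<subseteq> S" "w \<in> W K" shows "parabolic_part G K J w = par J w"
  unfolding parabolic_part_def
proof (rule the_equality)
  have "J \<subseteq> S" "w \<in> carrier G" using assms W_closed by auto
  then show "par J w \<in> W J \<and> inversions G K (par J w) = inversions G K w \<inter> W J"
    using par_in inversions_par[OF assms] by blast
  then show "x = par J w" if "x \<in> W J \<and> inversions G K x = inversions G K w \<inter> W J" for x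
    using that inversions_inj[OF assms(1,2), of x "par J w"] by simp
qed

section \<open>The recursions with arbitrary choices\<close>

lemma initial_word:
  assumes "cox_word cs" "initial_in G (set cs) (wp cs) s"
  obtains us where "cox_word (s # us)" "set (s # us) = set cs" "wp (s # us) = wp cs"
proof -
  obtain u where u: "s # u \<in> lists (set cs)" "wp (s # u) = wp cs" "length (s # u) = cox_length G (set cs) (wp cs)"
    using assms(2) by (auto simp: initial_in_def reduced_word_def)
  have K: "set cs \<subseteq> S" using cox_word_subset assms by blast
  have "cox_length G (set cs) (wp cs) = \<ell> (wp cs)" using len_parabolic[OF K W_wp] by simp
  moreover have "set (s # u) \<subseteq> S" using u(1) K by auto
  ultimately have "cox_word (s # u)" "set (s # u) = set cs" using reduced_coxeter[OF assms(1), of "s # u"] u by auto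
  then show thesis using that u(2) by blast
qed

lemma initial_head: "cox_word (s # cs) \<Longrightarrow> initial_in G (set (s # cs)) (wp (s # cs)) s"
proof -
  assume g: "cox_word (s # cs)"
  have "cox_length G (set (s # cs)) (wp (s # cs)) = length (s # cs)"
    using len_parabolic[OF cox_word_subset[OF g] W_wp[of "s # cs" "set (s # cs)"]] len_coxeter[OF g] by simp
  moreover have "s # cs \<in> lists (set (s # cs))" by auto
  ultimately show ?thesis unfolding initial_in_def reduced_word_def by metis
qed

lemma
  assumes "cox_word (s # cs)"
  shows wp_rotate: "wp (cs @ [s]) = s \<otimes> wp (s # cs) \<otimes> s" and wp_tail: "wp cs = s \<otimes> wp (s # cs)"
proof -
  have c: "s \<in> S" "set cs \<subseteq> S" "wp cs \<in> carrier G" using assms wp_closed_S[of cs] by (auto simp: cox_word_def)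
  show "wp cs = s \<otimes> wp (s # cs)" using c by simp
  show "wp (cs @ [s]) = s \<otimes> wp (s # cs) \<otimes> s" using c by (simp add: wp_append_S)
qed

lemma set_tail: "cox_word (s # cs) \<Longrightarrow> set (s # cs) - {s} = set cs"
  by (auto simp: cox_word_def)

lemma lower_one: "s \<in> S \<Longrightarrow> \<not> lower s \<one>"
  by (simp add: lower_def)

lemma proj_one: "cox_word cs \<Longrightarrow> proj cs \<one> = \<one>"
proof (induction cs)
  case (Cons s cs)
  then have "s \<in> S" "cox_word cs" "par (set cs) \<one> = \<one>"
    using par_id[OF cox_word_subset W_one] by (auto simp: cox_word_Cons)
  then show ?case using Cons lower_one by (simp add: proj_not_lower)
qed simp

text \<open>Every initial letter chosen in a derivation begins some word for \<open>c\<close>, and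
  \<open>word_independent\<close> permits the passage to that word at each step. This gives
  uniqueness of the value.\<close>

lemma pi_down_rel_proj:
  "pi_down_rel G K c w v \<Longrightarrow> cox_word cs \<Longrightarrow> set cs = K \<Longrightarrow> wp cs = c \<Longrightarrow> w \<in> W K \<Longrightarrow> v = proj cs w"
proof (induction arbitrary: cs rule: pi_down_rel.induct)
  case (one K c)
  then show ?case using proj_one by simp
next
  case (above K c s w v)
  obtain us where us: "cox_word (s # us)" "set (s # us) = set cs" "wp (s # us) = wp cs"
    using initial_word[OF above.prems(1), of s] above.hyps(1) above.prems(2,3) by auto
  have wW: "w \<in> W (set (s # us))" using above us by simp
  note c = cox_word_ctx[OF us(1) wW]
  have l: "lower s w" using above.hyps(2) weak_le_iff[of K s w] above.prems us cox_word_subset by auto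
  have "v = proj (us @ [s]) (s \<otimes> w)"
    using above.IH[OF cox_word_rotate[OF us(1)]] W_Cons_mult[OF wW] us(2,3) above.prems(2,3)
      wp_rotate[OF us(1)] by (metis set_rotate1 rotate1.simps(2))
  moreover have "proj cs w = proj (s # us) w"
    using word_independent[of n cs "s # us" w] above.prems us by (metis scaleR_one zero_less_one)
  ultimately show ?case using l by (simp add: proj_lower)
next
  case (not_above K c s w v)
  obtain us where us: "cox_word (s # us)" "set (s # us) = set cs" "wp (s # us) = wp cs"
    using initial_word[OF not_above.prems(1), of s] not_above.hyps(1) not_above.prems(2,3) by auto
  have wW: "w \<in> W (set (s # us))" using not_above us by simp
  note c = cox_word_ctx[OF us(1) wW]
  have K: "K \<subseteq> S" "K - {s} = set us" using not_above.prems us cox_word_subset set_tail[OF us(1)] by auto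
  have l: "\<not> lower s w" using not_above.hyps(2) weak_le_iff[of K s w] not_above.prems us K by auto
  have "parabolic_part G K (K - {s}) w = par (set us) w"
    using parabolic_part_eq[of "K - {s}" K w] K not_above.prems by auto
  then have "v = proj us (par (set us) w)"
    using not_above.IH[OF c(4) K(2)[symmetric]] par_in[OF c(5,1)] K(2) wp_tail[OF us(1)] us(3) not_above.prems(3)
    by metis
  moreover have "proj cs w = proj (s # us) w"
    using word_independent[of n cs "s # us" w] not_above.prems us by (metis scaleR_one zero_less_one)
  ultimately show ?case using l by (simp add: proj_not_lower)
qed

lemma pi_down_rel_exists:
  "cox_word cs \<Longrightarrow> w \<in> W (set cs) \<Longrightarrow> pi_down_rel G (set cs) (wp cs) w (proj cs w)"
proof (induction cs w rule: word_induct)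
  case (Nil w)
  then have "w = \<one>" using W_lower[of "{}" w] by blast
  then show ?case by (simp add: pi_down_rel.one)
next
  case (lower s cs w)
  note c = cox_word_ctx[OF lower(1,2)]
  have "weak_le G (set (s # cs)) s w" using weak_le_iff[OF cox_word_subset[OF lower(1)] _ lower(2)] lower(3) by simp
  moreover have "set (cs @ [s]) = set (s # cs)" by auto
  ultimately show ?case
    unfolding proj_lower[OF lower(3)]
    using pi_down_rel.above[OF initial_head[OF lower(1)], of w "proj (cs @ [s]) (s \<otimes> w)"]
      lower.IH wp_rotate[OF lower(1)] by metis
next
  case (not_lower s cs w)
  note c = cox_word_ctx[OF not_lower(1,2)]
  note K = cox_word_subset[OF not_lower(1)] set_tail[OF not_lower(1)]
  have "\<not> weak_le G (set (s # cs)) s w" using weak_le_iff[OF K(1) _ not_lower(2)] not_lower(3) by simp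
  moreover have "parabolic_part G (set (s # cs)) (set cs) w = par (set cs) w"
    using parabolic_part_eq[OF _ K(1) not_lower(2)] by auto
  ultimately show ?case
    unfolding proj_not_lower[OF not_lower(3)]
    using pi_down_rel.not_above[OF initial_head[OF not_lower(1)], of w "proj cs (par (set cs) w)"]
      not_lower.IH wp_tail[OF not_lower(1)] K(2) by metis
qed

lemma pi_down_eq:
  assumes "cox_word cs" "w \<in> W (set cs)" shows "pi_down G (set cs) (wp cs) w = proj cs w"
  unfolding pi_down_def
proof (rule the_equality)
  show "pi_down_rel G (set cs) (wp cs) w (proj cs w)" by (rule pi_down_rel_exists[OF assms])
  show "v = proj cs w" if "pi_down_rel G (set cs) (wp cs) w v" for v
    by (rule pi_down_rel_proj[OF that assms(1) HOL.refl HOL.refl assms(2)])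
qed

context
  fixes A :: "'w \<Rightarrow> 'w \<Rightarrow> real" and \<alpha> :: "'w \<Rightarrow> 'v"
  assumes scale: "\<And>s. s \<in> S \<Longrightarrow> \<exists>r>0. \<alpha> s = r *\<^sub>R n s"
    and refl_eq: "\<And>K s x. K \<subseteq> S \<Longrightarrow> s \<in> K \<Longrightarrow> supp K x \<Longrightarrow> simple_refl A \<alpha> K s x = \<sigma> s x"
begin

lemma refl_image:
  assumes "cox_word cs" "w \<in> W (set cs)" "s \<in> set cs"
  shows "simple_refl A \<alpha> (set cs) s ` c_roots \<alpha> cs w = \<sigma> s ` c_roots \<alpha> cs w"
proof (rule image_cong[OF HOL.refl])
  fix x assume "x \<in> c_roots \<alpha> cs w"
  then have "ray (set cs) x" using c_roots_ray[OF scale assms(1,2)] by blast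
  then obtain r y where "x = r *\<^sub>R y" "supp (set cs) y" unfolding ray_def by blast
  then have "supp (set cs) x" by simp
  then show "simple_refl A \<alpha> (set cs) s x = \<sigma> s x"
    using refl_eq[OF cox_word_subset[OF assms(1)] assms(3)] by blast
qed

text \<open>The rules of \<open>C_rel\<close> do not ask that \<open>v\<close> lie in
  \<open>W K\<close>. This comes out of the derivation, starting from the identity in rank zero, and
  is therefore part of the claim.\<close>

lemma C_rel_c_roots:
  "C_rel G A \<alpha> K c v X \<Longrightarrow> cox_word cs \<Longrightarrow> set cs = K \<Longrightarrow> wp cs = c \<Longrightarrow> v \<in> carrier G \<Longrightarrow> v \<in> W K \<and> X = c_roots \<alpha> cs v"
proof (induction arbitrary: cs rule: C_rel.induct)
  case rank_zero
  then show ?case by (simp add: W_one)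
next
  case (not_above K c s v X)
  obtain us where us: "cox_word (s # us)" "set (s # us) = set cs" "wp (s # us) = wp cs"
    using initial_word[OF not_above.prems(1), of s] not_above.hyps(1) not_above.prems(2,3) by auto
  have g: "cox_word us" "s \<in> S" "s \<notin> set us" "set us \<subseteq> S" using us(1) by (auto simp: cox_word_def)
  have K: "K - {s} = set us" "K = set (s # us)" using not_above.prems us set_tail[OF us(1)] by auto
  have ih: "v \<in> W (set us)" "X = c_roots \<alpha> us v"
    using not_above.IH[OF g(1) K(1)[symmetric]] K(1) wp_tail[OF us(1)] us(3) not_above.prems(3,4) by metis+
  have vW: "v \<in> W K" using ih(1) W_mono[of "set us" K] K by auto
  have nl: "\<not> lower s v" using not_lower_W[OF g(4) _ ih(1)] g by blast
  have "c_roots \<alpha> cs v = c_roots \<alpha> (s # us) v"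
    using word_independent[OF scale, of cs "s # us" v] not_above.prems us vW by simp
  then show ?case using nl vW ih par_id[OF g(4) ih(1)] by (simp add: c_roots_not_lower)
next
  case (above K c s v X)
  obtain us where us: "cox_word (s # us)" "set (s # us) = set cs" "wp (s # us) = wp cs"
    using initial_word[OF above.prems(1), of s] above.hyps(1) above.prems(2,3) by auto
  have sS: "s \<in> S" using us(1) by (simp add: cox_word_Cons)
  note g = cox_word_rotate[OF us(1)]
  have K: "set (us @ [s]) = K" "K \<subseteq> S" "s \<in> K" using us above.prems cox_word_subset by auto
  have ih: "s \<otimes> v \<in> W K" "X = c_roots \<alpha> (us @ [s]) (s \<otimes> v)"
    using above.IH[OF g K(1)] wp_rotate[OF us(1)] us(3) above.prems(3,4) m_closed[OF S_in_carrier[OF sS]]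
    by metis+
  have "s \<otimes> (s \<otimes> v) \<in> W K" using W_mult[OF W_incl[OF K(3)] ih(1)] .
  then have vW: "v \<in> W K" using sS above.prems by simp
  have l: "lower s v" using above.hyps(2) weak_le_iff[OF K(2,3) vW] by simp
  have "c_roots \<alpha> cs v = c_roots \<alpha> (s # us) v"
    using word_independent[OF scale, of cs "s # us" v] above.prems us vW by simp
  moreover have "simple_refl A \<alpha> K s ` X = \<sigma> s ` X"
    using refl_image[OF g, of "s \<otimes> v" s] K ih by simp
  ultimately show ?case using vW l ih(2) by (simp add: c_roots_lower)
qed

text \<open>The form with an arbitrary \<open>w\<close> lets the induction follow the recursion of
  \<open>proj\<close>; it is applied to elements fixed by the projection.\<close>

lemma C_rel_exists:
  "cox_word cs \<Longrightarrow> w \<in> W (set cs) \<Longrightarrow> C_rel G A \<alpha> (set cs) (wp cs) (proj cs w) (c_roots \<alpha> cs w)"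
proof (induction cs w rule: word_induct)
  case (Nil w)
  then show ?case by (simp add: C_rel.rank_zero)
next
  case (lower s cs w)
  note c = cox_word_ctx[OF lower(1,2)]
  have "weak_le G (set (s # cs)) s (proj (s # cs) w)"
    using weak_le_iff[OF cox_word_subset[OF lower(1)] _ proj_in[OF lower(1,2)]] lower_proj[OF lower(1,2)] lower(3) by simp
  moreover have "s \<otimes> proj (s # cs) w = proj (cs @ [s]) (s \<otimes> w)"
    using proj_carrier[OF lower(4,5)] c by (simp add: proj_lower[OF lower(3)])
  moreover have "simple_refl A \<alpha> (set (s # cs)) s ` c_roots \<alpha> (cs @ [s]) (s \<otimes> w) = c_roots \<alpha> (s # cs) w"
    using refl_image[OF lower(4,5), of s] by (simp add: c_roots_lower[OF lower(3)])
  moreover have "set (cs @ [s]) = set (s # cs)" by auto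
  ultimately show ?case
    using C_rel.above[OF initial_head[OF lower(1)], of "proj (s # cs) w" A \<alpha> "c_roots \<alpha> (cs @ [s]) (s \<otimes> w)"]
      lower.IH wp_rotate[OF lower(1)] by metis
next
  case (not_lower s cs w)
  note c = cox_word_ctx[OF not_lower(1,2)]
  have "\<not> weak_le G (set (s # cs)) s (proj (s # cs) w)"
    using weak_le_iff[OF cox_word_subset[OF not_lower(1)] _ proj_in[OF not_lower(1,2)]]
      lower_proj[OF not_lower(1,2)] not_lower(3) by simp
  moreover have "C_rel G A \<alpha> (set (s # cs) - {s}) (s \<otimes> wp (s # cs)) (proj (s # cs) w) (c_roots \<alpha> cs (par (set cs) w))"
    using not_lower.IH unfolding wp_tail[OF not_lower(1), symmetric] set_tail[OF not_lower(1)]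
      proj_not_lower[OF not_lower(3)] .
  ultimately have "C_rel G A \<alpha> (set (s # cs)) (wp (s # cs)) (proj (s # cs) w) (c_roots \<alpha> cs (par (set cs) w) \<union> {\<alpha> s})"
    by (rule C_rel.not_above[OF initial_head[OF not_lower(1)]])
  then show ?case unfolding c_roots_not_lower[OF not_lower(3)] by simp
qed

lemma C_set_eq:
  assumes "cox_word cs" "v \<in> W (set cs)" "proj cs v = v"
  shows "C_set G A \<alpha> (set cs) (wp cs) v = c_roots \<alpha> cs v"
  unfolding C_set_def
proof (rule the_equality)
  show "C_rel G A \<alpha> (set cs) (wp cs) v (c_roots \<alpha> cs v)"
    using C_rel_exists[OF assms(1,2)] assms(3) by simp
  show "X = c_roots \<alpha> cs v" if "C_rel G A \<alpha> (set cs) (wp cs) v X" for X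
    using C_rel_c_roots[OF that assms(1) HOL.refl HOL.refl cox_word_W[OF assms(1,2)]] by simp
qed

end

section \<open>Sortable elements are fixed by the projection\<close>

lemma sorted_filter_ge:
  fixes ps :: "nat list"
  assumes "sorted_wrt (<) ps"
  shows "filter (\<lambda>p. k \<le> p) ps = (if k \<in> set ps then k # filter (\<lambda>p. Suc k \<le> p) ps else filter (\<lambda>p. Suc k \<le> p) ps)"
  using assms
proof (induction ps)
  case (Cons p ps)
  show ?case
  proof (cases "p = k")
    case True
    then have "filter (\<lambda>q. k \<le> q) ps = ps" "filter (\<lambda>q. Suc k \<le> q) ps = ps"
      using Cons.prems by (auto intro!: filter_True)
    then show ?thesis using True by simp
  next
    case False
    moreover have "k \<notin> set ps" if "k < p" using that Cons.prems by auto
    ultimately show ?thesis using Cons by auto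
  qed
qed simp

lemma sorted_split:
  fixes ps :: "nat list"
  assumes "sorted_wrt (<) ps" shows "ps = filter (\<lambda>p. p < k) ps @ filter (\<lambda>p. k \<le> p) ps"
  using assms
proof (induction ps)
  case (Cons p ps)
  show ?case
  proof (cases "p < k")
    case True
    then show ?thesis using Cons by auto
  next
    case False
    then have "filter (\<lambda>q. q < k) ps = []" "filter (\<lambda>q. k \<le> q) ps = ps"
      using Cons.prems by (auto intro!: filter_True filter_False)
    then show ?thesis using False by simp
  qed
qed simp

text \<open>
  In the proof, \<open>word k\<close> is the Coxeter word that the recursion has reached at position \<open>k\<close>:
  the next \<open>N\<close> letters without those that have been skipped, where by the nesting of the copies
  \<open>ok j\<close> only needs to look one copy back.  The element reached is \<open>el k\<close>.
\<close>

lemma sortable_fixed: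
  assumes g: "cox_word cs" and sorted: "sorted_wrt (<) ps" and red: "reduced_word G (set cs) v (subword_at cs ps)"
    and dec: "\<And>k. copy_letters cs ps (Suc k) \<subseteq> copy_letters cs ps k"
  shows "v \<in> W (set cs)" "proj cs v = v"
proof -
  define N where "N = length cs"
  define L where "L i = cs ! (i mod N)" for i
  define ok where "ok j \<longleftrightarrow> j < N \<or> j - N \<in> set ps" for j
  define word where "word k = map L (filter ok [k..<k + N])" for k
  define el where "el k = wp (map L (filter (\<lambda>p. k \<le> p) ps))" for k
  have K: "set cs \<subseteq> S" using cox_word_subset g by blast
  have sub: "subword_at cs ps = map L ps" by (simp add: subword_at_def L_def N_def)
  have u: "set (map L ps) \<subseteq> set cs" "wp (map L ps) = v" "length ps = cox_length G (set cs) v"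
    using red unfolding reduced_word_def sub by auto
  show vW: "v \<in> W (set cs)" using W_wp[OF u(1)] u(2) by simp
  then have lv: "length ps = \<ell> v" using u(3) len_parabolic[OF K] by simp
  have "word 0 = map L [0..<N]" by (simp add: word_def ok_def filter_True)
  also have "\<dots> = map ((!) cs) [0..<N]" by (intro map_cong) (auto simp: L_def)
  also have "\<dots> = cs" by (simp add: N_def map_nth)
  finally have w0: "word 0 = cs" .
  have e0: "el 0 = v" using u(2) by (simp add: el_def)
  show "proj cs v = v"
  proof (cases "N = 0")
    case True
    then have "cs = []" by (simp add: N_def)
    then show ?thesis using u(1,2) by simp
  next
    case N: False
    have LN: "L (i + N) = L i" for i by (simp add: L_def)
    have Lc: "L i \<in> set cs" for i using N by (simp add: L_def N_def)
    \<comment> \<open>As the letters of \<open>cs\<close> are distinct, nested letter sets mean that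
      a position used in one copy is used in the copy before.\<close>
    have D: "i \<in> set ps" if "i + N \<in> set ps" for i
    proof -
      have "(i + N) div N = Suc (i div N)" using N by simp
      moreover have "cs ! ((i + N) mod N) = L i" by (simp add: L_def)
      ultimately have "L i \<in> copy_letters cs ps (Suc (i div N))"
        using that unfolding copy_letters_def N_def[symmetric] by (auto intro!: exI[of _ "i + N"])
      then have "L i \<in> copy_letters cs ps (i div N)" using dec by blast
      then obtain p where p: "p \<in> set ps" "p div N = i div N" "cs ! (p mod N) = cs ! (i mod N)"
        by (auto simp: copy_letters_def L_def N_def)
      have "p mod N < length cs" "i mod N < length cs" using N by (simp_all add: N_def)
      then have "p mod N = i mod N" using p(3) g nth_eq_iff_index_eq by (auto simp: cox_word_def)
      then have "p = i" using p(2) by (metis div_mult_mod_eq)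
      then show ?thesis using p by simp
    qed
    have D': "ok k" if "k \<in> set ps" for k
      using D[of "k - N"] that by (cases "k < N") (auto simp: ok_def)
    have gw: "cox_word (word k)" for k
    proof -
      have "inj_on L {k..<k + N}"
      proof (rule inj_onI)
        fix i j assume ij: "i \<in> {k..<k + N}" "j \<in> {k..<k + N}" "L i = L j"
        have "i mod N < length cs" "j mod N < length cs" using N by (simp_all add: N_def)
        then have "i mod N = j mod N" using ij(3) g nth_eq_iff_index_eq by (auto simp: L_def cox_word_def)
        moreover have "i < j + N" "j < i + N" using ij by auto
        ultimately show "i = j"
          by (metis linorder_neqE_nat mod_eq_dvd_iff_nat nat_dvd_not_less less_diff_conv2 add.commute less_imp_le zero_less_diff)
      qed
      then have "distinct (word k)"
        unfolding word_def by (subst distinct_map) (auto intro: inj_on_subset)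
      moreover have "set (word k) \<subseteq> set cs" using Lc by (auto simp: word_def)
      ultimately show ?thesis using K by (auto simp: cox_word_def)
    qed
    define M where "M k = map L (filter ok [Suc k..<k + N])" for k
    have up: "[k..<k + N] = k # [Suc k..<k + N]" "[Suc k..<Suc k + N] = [Suc k..<k + N] @ [k + N]" for k
      using N upt_conv_Cons[of k "k + N"] upt_Suc_append[of "Suc k" "k + N"] by simp_all
    have okN: "ok (k + N) \<longleftrightarrow> k \<in> set ps" for k by (simp add: ok_def)
    have wk: "word k = (if ok k then L k # M k else M k)" for k
      unfolding word_def M_def up(1) by simp
    \<comment> \<open>The window moves on by one. Its new entry \<open>k + N\<close> carries the
      letter \<open>L k\<close> and is kept exactly if position \<open>k\<close> was used: then the
      word is rotated, otherwise the letter is dropped.\<close>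
    have wS: "word (Suc k) = (if k \<in> set ps then M k @ [L k] else M k)" for k
      unfolding word_def M_def up(2) by (simp add: okN LN)
    \<comment> \<open>Suffixes of a reduced word are reduced.\<close>
    have lel: "length (filter (\<lambda>p. k \<le> p) ps) = \<ell> (el k)" for k
    proof -
      let ?a = "map L (filter (\<lambda>p. p < k) ps)" and ?b = "map L (filter (\<lambda>p. k \<le> p) ps)"
      have S: "set ?a \<subseteq> S" "set ?b \<subseteq> S" using Lc K by auto
      have "map L ps = ?a @ ?b" using sorted_split[OF sorted, of k] by (metis map_append)
      then have v: "v = wp ?a \<otimes> el k" using u(2) wp_append_S[OF S] by (simp add: el_def)
      have "\<ell> v \<le> \<ell> (wp ?a) + \<ell> (el k)"
        unfolding v using S by (intro len_mult_le) (auto simp: el_def wp_closed_S)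
      also have "\<ell> (wp ?a) \<le> length ?a" using len_le S by blast
      finally have "length ps \<le> length ?a + \<ell> (el k)" using lv by simp
      moreover have "length ps = length ?a + length ?b"
        using arg_cong[OF sorted_split[OF sorted, of k], of length] by simp
      moreover have "\<ell> (el k) \<le> length ?b" unfolding el_def using len_le S by blast
      ultimately show ?thesis by simp
    qed
    \<comment> \<open>Downward induction from a bound \<open>m\<close> beyond all positions, where
      the remaining element is the identity.\<close>
    have main: "el k \<in> W (set (word k)) \<and> proj (word k) (el k) = el k" if "k \<le> m" "\<forall>p\<in>set ps. p < m" for k m
      using that
    proof (induction rule: inc_induct)
      case base
      then have "filter (\<lambda>p. m \<le> p) ps = []" by (auto simp: filter_empty_conv)
      then show ?case using proj_one[OF gw] W_one by (simp add: el_def)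
    next
      case (step k)
      have ih: "el (Suc k) \<in> W (set (word (Suc k)))" "proj (word (Suc k)) (el (Suc k)) = el (Suc k)"
        using step by auto
      have c: "el (Suc k) \<in> carrier G" using cox_word_W[OF gw ih(1)] .
      show ?case
      proof (cases "k \<in> set ps")
        case True
        have Lk: "L k \<in> S" using Lc K by blast
        have f: "filter (\<lambda>p. k \<le> p) ps = k # filter (\<lambda>p. Suc k \<le> p) ps"
          using sorted_filter_ge[OF sorted, of k] True by simp
        then have e: "el k = L k \<otimes> el (Suc k)" by (simp add: el_def)
        have w: "word k = L k # M k" "word (Suc k) = M k @ [L k]" using wk wS True D' by auto
        have "\<ell> (el k) = \<ell> (el (Suc k)) + 1" using lel[of k] lel[of "Suc k"] f by simp
        then have l: "lower (L k) (el k)" using e c Lk by (simp add: lower_def)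
        have "el k \<in> W (set (word k))"
          using W_mult[OF W_incl[of "L k" "set (word k)"], of "el (Suc k)"] ih(1) w e by simp
        moreover have "proj (word k) (el k) = el k"
          unfolding w(1) proj_lower[OF l] using ih(2) w(2) e c Lk by simp
        ultimately show ?thesis by blast
      next
        case False
        have e: "el k = el (Suc k)" using sorted_filter_ge[OF sorted, of k] False by (simp add: el_def)
        have w: "word (Suc k) = M k" using wS False by simp
        show ?thesis
        proof (cases "ok k")
          case True
          have wk': "word k = L k # M k" using wk True by simp
          have g': "cox_word (L k # M k)" using gw[of k] wk' by simp
          have MS: "set (M k) \<subseteq> S" "L k \<in> S - set (M k)" using g' by (auto simp: cox_word_def)
          have "\<not> lower (L k) (el k)" using not_lower_W[OF MS] ih(1) w e by simp
          moreover have "par (set (M k)) (el k) = el k" using par_id[OF MS(1)] ih(1) w e by simp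
          moreover have "el k \<in> W (set (word k))" using W_mono[of "set (M k)" "set (word k)"] ih(1) w e wk' by auto
          ultimately show ?thesis using ih(2) w e wk' by (simp add: proj_not_lower)
        next
          case False
          then show ?thesis using ih w e wk by simp
        qed
      qed
    qed
    obtain m where "\<forall>p\<in>set ps. p < m" using finite_nat_set_iff_bounded[of "set ps"] by auto
    then show ?thesis using main[of 0 m] w0 e0 by simp
  qed
qed

text \<open>The coordinate functions \<open>cf s\<close> lie in the dominant chamber and test each
  coordinate. Conversely, a functional in that chamber is nonnegative on vectors with nonnegative
  coordinates.\<close>

lemma dual_act_subset_iff:
  assumes scale: "\<And>s. s \<in> S \<Longrightarrow> \<exists>r>0. \<alpha> s = r *\<^sub>R n s"
    and act: "\<And>x. act G S A \<alpha> (inv w) x = \<rho> (inv w) x"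
  shows "dual_act G S A \<alpha> w ` dominant_chamber S \<alpha> \<subseteq> {f. linear f \<and> (\<forall>x\<in>X. f x \<ge> 0)} \<longleftrightarrow>
    (\<forall>x\<in>X. pos (\<rho> (inv w) x))"
proof
  assume sub: "dual_act G S A \<alpha> w ` dominant_chamber S \<alpha> \<subseteq> {f. linear f \<and> (\<forall>x\<in>X. f x \<ge> 0)}"
  show "\<forall>x\<in>X. pos (\<rho> (inv w) x)"
    unfolding pos_def
  proof (intro ballI)
    fix x s assume x: "x \<in> X" and s: "s \<in> S"
    have "cf s (\<alpha> t) \<ge> 0" if t: "t \<in> S" for t
      using scale[OF t] s t by (auto simp: cf_n)
    then have "cf s \<in> dominant_chamber S \<alpha>" using linear_cf[OF s] by (simp add: dominant_chamber_def)
    then have "dual_act G S A \<alpha> w (cf s) x \<ge> 0" using sub x by blast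
    then show "cf s (\<rho> (inv w) x) \<ge> 0" by (simp add: dual_act_def act)
  qed
next
  assume p: "\<forall>x\<in>X. pos (\<rho> (inv w) x)"
  show "dual_act G S A \<alpha> w ` dominant_chamber S \<alpha> \<subseteq> {f. linear f \<and> (\<forall>x\<in>X. f x \<ge> 0)}"
  proof (intro image_subsetI CollectI conjI ballI)
    fix f assume f: "f \<in> dominant_chamber S \<alpha>"
    then have lf: "linear f" by (simp add: dominant_chamber_def)
    show "linear (dual_act G S A \<alpha> w f)"
      unfolding dual_act_def act by (intro linearI) (simp_all add: linear_add[OF lf] linear_cmul[OF lf])
    have fn: "f (n s) \<ge> 0" if s: "s \<in> S" for s
    proof -
      obtain r where r: "r > 0" "\<alpha> s = r *\<^sub>R n s" using scale[OF s] by blast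
      have "f (\<alpha> s) \<ge> 0" using f s by (simp add: dominant_chamber_def)
      then show ?thesis using r linear_cmul[OF lf] by (simp add: zero_le_mult_iff)
    qed
    fix x assume "x \<in> X"
    then have px: "pos (\<rho> (inv w) x)" using p by blast
    have "f (\<rho> (inv w) x) = f (\<Sum>s\<in>S. cf s (\<rho> (inv w) x) *\<^sub>R n s)" using expand by metis
    also have "\<dots> = (\<Sum>s\<in>S. cf s (\<rho> (inv w) x) * f (n s))"
      by (simp add: linear_sum[OF lf] linear_cmul[OF lf])
    also have "\<dots> \<ge> 0" using px fn by (intro sum_nonneg mult_nonneg_nonneg) (auto simp: pos_def)
    finally show "dual_act G S A \<alpha> w f x \<ge> 0" by (simp add: dual_act_def act)
  qed
qed

lemma act_eq:
  assumes "w \<in> carrier G" and refl: "\<And>s x. s \<in> S \<Longrightarrow> simple_refl A \<alpha> S s x = \<sigma> s x"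
  shows "act G S A \<alpha> w x = \<rho> w x"
proof -
  have eq: "foldr (simple_refl A \<alpha> S) u x = \<rho> (wp u) x" if "set u \<subseteq> S" for u
  proof -
    have "foldr (simple_refl A \<alpha> S) u x = fold\<sigma> u x" using that by (induction u) (simp_all add: refl)
    then show ?thesis using rho_wp[OF that] by simp
  qed
  obtain u where u: "set u \<subseteq> S" "w = wp u" using assms(1) by (rule carrier_words)
  show ?thesis
    unfolding act_def
  proof (rule the_equality)
    show "\<exists>u\<in>lists S. wp u = w \<and> \<rho> w x = foldr (simple_refl A \<alpha> S) u x"
      using u eq[of u] by (intro bexI[of _ u]) auto
    show "y = \<rho> w x" if "\<exists>u\<in>lists S. wp u = w \<and> y = foldr (simple_refl A \<alpha> S) u x" for y
      using that eq by auto
  qed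
qed

theorem pi_down_iff:
  assumes scale: "\<And>s. s \<in> S \<Longrightarrow> \<exists>r>0. \<alpha> s = r *\<^sub>R n s"
    and refl: "\<And>K s x. K \<subseteq> S \<Longrightarrow> s \<in> K \<Longrightarrow> supp K x \<Longrightarrow> simple_refl A \<alpha> K s x = \<sigma> s x"
    and v: "sortable G S c v" and w: "w \<in> carrier G"
  shows "pi_down G S c w = v \<longleftrightarrow> dual_act G S A \<alpha> w ` dominant_chamber S \<alpha> \<subseteq> Cone G A \<alpha> S c v"
proof -
  obtain cs ps where cs: "coxeter_word G S c cs" and ps: "sorting_positions G S cs v ps"
    and dec: "\<And>k. copy_letters cs ps (Suc k) \<subseteq> copy_letters cs ps k"
    using v by (auto simp: sortable_def)
  have g: "cox_word cs" "set cs = S" "wp cs = c" using cs by (auto simp: coxeter_word_def cox_word_def)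
  have v: "v \<in> W (set cs)" "proj cs v = v"
    using sortable_fixed[OF g(1), of ps v] ps dec g(2) by (auto simp: sorting_positions_def)
  have w': "w \<in> W (set cs)" using w W_S g(2) by simp
  have act: "act G S A \<alpha> (inv w) x = \<rho> (inv w) x" for x
    using w by (intro act_eq refl) (auto simp: supp_def)
  have "pi_down G S c w = v \<longleftrightarrow> proj cs w = v" using pi_down_eq[OF g(1) w'] g by simp
  also have "\<dots> \<longleftrightarrow> (\<forall>x\<in>c_roots \<alpha> cs v. pos (\<rho> (inv w) x))"
    by (rule fibre_iff[OF scale g(1) v(1) w' v(2)])
  also have "\<dots> \<longleftrightarrow> dual_act G S A \<alpha> w ` dominant_chamber S \<alpha> \<subseteq> Cone G A \<alpha> S c v"
    unfolding Cone_def using dual_act_subset_iff[OF scale act, of "c_roots \<alpha> cs v"]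
      C_set_eq[OF scale refl g(1) v] g by simp
  finally show ?thesis .
qed

end

theorem theorem6p3:
  fixes G :: "('w, 'r) monoid_scheme" and S :: "'w set"
    and A :: "'w \<Rightarrow> 'w \<Rightarrow> real" and \<alpha> :: "'w \<Rightarrow> 'v::real_vector"
    and c v w :: 'w
  assumes "coxeter_system G S"
    and "symmetrizable_gcm G S A"
    and "root_basis S \<alpha>"
    and "coxeter_element G S c"
    and "sortable G S c v"
    and "w \<in> carrier G"
  shows "pi_down G S c w = v \<longleftrightarrow>
    dual_act G S A \<alpha> w ` dominant_chamber S \<alpha> \<subseteq> Cone G A \<alpha> S c v"
proof -
  have fin: "finite S" and grp: "group G" and ord2: "\<And>s. s \<in> S \<Longrightarrow> group.ord G s = 2"
    and S: "S \<subseteq> carrier G"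
    using assms(1) by (simp_all add: coxeter_system_def)
  interpret group G by (rule grp)
  note gcm = assms(2)[unfolded symmetrizable_gcm_def Let_def]
  obtain \<delta> where d: "\<forall>s\<in>S. \<delta> s > (0::real)" "\<forall>s\<in>S. \<forall>t\<in>S. \<delta> s * A s t = \<delta> t * A t s"
    using gcm[THEN conjunct2, THEN conjunct2] by (elim exE conjE) (rule that)
  note \<delta> = d(1)[rule_format] and \<delta>A = d(2)[rule_format]
  have diag: "\<And>s. s \<in> S \<Longrightarrow> A s s = 2"
    and neg: "\<And>s t. s \<in> S \<Longrightarrow> t \<in> S \<Longrightarrow> s \<noteq> t \<Longrightarrow> A s t \<le> 0"
    and fin_ord: "\<And>s t. s \<in> S \<Longrightarrow> t \<in> S \<Longrightarrow> s \<noteq> t \<Longrightarrow> ord (s \<otimes>\<^bsub>G\<^esub> t) \<noteq> 0 \<Longrightarrow>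
      A s t * A t s = 4 * (cos (pi / real (ord (s \<otimes>\<^bsub>G\<^esub> t))))\<^sup>2"
    and inf_ord: "\<And>s t. s \<in> S \<Longrightarrow> t \<in> S \<Longrightarrow> s \<noteq> t \<Longrightarrow> ord (s \<otimes>\<^bsub>G\<^esub> t) = 0 \<Longrightarrow> A s t * A t s \<ge> 4"
    using gcm[THEN conjunct1] gcm[THEN conjunct2, THEN conjunct1] by (simp_all split: if_splits)
  have inj: "inj_on \<alpha> S" and ind: "independent (\<alpha> ` S)" and sp: "span (\<alpha> ` S) = UNIV"
    using assms(3) by (simp_all add: root_basis_def)
  \<comment> \<open>In the form with values \<open>\<delta> s * A s t / 2\<close> on the simple
    roots, \<open>\<alpha> s\<close> has squared norm \<open>\<delta> s\<close>; dividing by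
    \<open>q s\<close> normalises it.\<close>
  define q where "q s = sqrt (\<delta> s)" for s
  have q: "q s > 0" "q s * q s = \<delta> s" if "s \<in> S" for s using \<delta>[OF that] by (simp_all add: q_def)
  define n where "n s = (1 / q s) *\<^sub>R \<alpha> s" for s
  define rep where "rep s x = representation (\<alpha> ` S) x (\<alpha> s)" for s x
  define cf where "cf s x = q s * rep s x" for s x
  \<comment> \<open>The Gram matrix of the \<open>n s\<close>. The value 0 outside \<open>S\<close>
    makes it symmetric for all arguments.\<close>
  define b where "b s t = (if s \<in> S \<and> t \<in> S then \<delta> s * A s t / (2 * q s * q t) else 0)" for s t
  have rep_lin: "rep s (x + y) = rep s x + rep s y" "rep s (r *\<^sub>R x) = r * rep s x" for s x y r
    using representation_add[OF ind, of y x] representation_scale[OF ind, of x r] sp by (simp_all add: rep_def)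
  have rep_\<alpha>: "rep s (\<alpha> t) = (if s = t then 1 else 0)" if "s \<in> S" "t \<in> S" for s t
    using representation_basis[OF ind, of "\<alpha> t"] that inj by (auto simp: rep_def inj_on_eq_iff)
  have expand_\<alpha>: "(\<Sum>s\<in>S. rep s x *\<^sub>R \<alpha> s) = x" for x
    using sum_representation_eq[OF ind, of x "\<alpha> ` S"] sp fin
    by (simp add: sum.reindex[OF inj] rep_def)
  have cn: "cf s x *\<^sub>R n s = rep s x *\<^sub>R \<alpha> s" if "s \<in> S" for s x
    using q[OF that] by (simp add: cf_def n_def)
  have b_sym: "b s t = b t s" for s t
    using \<delta>A[of s t] by (simp add: b_def mult_ac)
  have b_sq: "4 * (b s t * b s t) = A s t * A t s" and b_neg: "s \<noteq> t \<Longrightarrow> b s t \<le> 0"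
    if "s \<in> S" "t \<in> S" for s t
  proof -
    have "4 * (b s t * b s t) = (\<delta> s * A s t) * (\<delta> s * A s t) / (q s * q s * (q t * q t))"
      using that by (simp add: b_def field_simps)
    also have "\<dots> = (\<delta> s * A s t) * (\<delta> t * A t s) / (\<delta> s * \<delta> t)"
      using q[OF that(1)] q[OF that(2)] \<delta>A[OF that] by simp
    also have "\<dots> = A s t * A t s" using \<delta>[OF that(1)] \<delta>[OF that(2)] by (simp add: field_simps)
    finally show "4 * (b s t * b s t) = A s t * A t s" .
    show "b s t \<le> 0" if "s \<noteq> t"
      using neg[OF \<open>s \<in> S\<close> \<open>t \<in> S\<close> that] q[OF \<open>s \<in> S\<close>] q[OF \<open>t \<in> S\<close>] \<delta>[OF \<open>s \<in> S\<close>]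
      by (auto simp: b_def intro!: divide_nonpos_pos mult_nonneg_nonpos)
  qed
  have b_cos: "b s t = - cos (pi / real (ord (s \<otimes>\<^bsub>G\<^esub> t)))"
    if st: "s \<in> S" "t \<in> S" "s \<noteq> t" "ord (s \<otimes>\<^bsub>G\<^esub> t) \<noteq> 0" for s t
  proof -
    let ?m = "ord (s \<otimes>\<^bsub>G\<^esub> t)" let ?c = "cos (pi / real ?m)"
    have c: "s \<in> carrier G" "t \<in> carrier G" using st S by auto
    have "?m \<noteq> 1"
    proof
      assume "?m = 1"
      then have "s \<otimes>\<^bsub>G\<^esub> t = \<one>\<^bsub>G\<^esub>" using ord_eq_1[of "s \<otimes>\<^bsub>G\<^esub> t"] c by simp
      moreover have "t \<otimes>\<^bsub>G\<^esub> t = \<one>\<^bsub>G\<^esub>"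
        using pow_ord_eq_1[OF c(2)] ord2[OF st(2)] c by (simp add: numeral_2_eq_2)
      ultimately show False using st(3) c by (metis inv_equality)
    qed
    then have m: "?m \<ge> 2" using st(4) by linarith
    have "pi / real ?m \<le> pi / 2" using m by (intro divide_left_mono) auto
    then have c0: "?c \<ge> 0" by (intro cos_ge_zero) (use pi_ge_zero divide_nonneg_nonneg[of pi "real ?m"] in linarith)+
    \<comment> \<open>The Cartan matrix fixes \<open>b s t\<close> up to sign. The sign comes from
      \<open>A s t \<le> 0\<close> and from \<open>?c \<ge> 0\<close>, which holds as
      \<open>?m \<ge> 2\<close>.\<close>
    have "(b s t)\<^sup>2 = ?c\<^sup>2" using b_sq[OF st(1,2)] fin_ord[OF st] by (simp add: power2_eq_square)
    then have "b s t = ?c \<or> b s t = - ?c" by (simp add: power2_eq_iff)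
    then show ?thesis using b_neg[OF st(1-3)] c0 by auto
  qed
  have b_inf: "b s t \<le> - 1" if st: "s \<in> S" "t \<in> S" "s \<noteq> t" "ord (s \<otimes>\<^bsub>G\<^esub> t) = 0" for s t
  proof (rule ccontr)
    assume "\<not> ?thesis"
    then have "- b s t < 1" "- b s t \<ge> 0" using b_neg[OF st(1-3)] by auto
    then have "(- b s t) * (- b s t) < 1 * 1" by (intro mult_strict_mono') auto
    then show False using b_sq[OF st(1,2)] inf_ord[OF st] by simp
  qed
  interpret coxeter_rep G S n cf b
  proof (intro coxeter_rep.intro coxeter_rep_axioms.intro grp)
    show "coxeter_system G S" by (rule assms(1))
    show "linear (cf s)" if "s \<in> S" for s
      by (intro linearI) (simp_all add: cf_def rep_lin algebra_simps)
    show "cf s (n t) = (if s = t then 1 else 0)" if "s \<in> S" "t \<in> S" for s t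
      using that q(1)[OF that(2)] by (simp add: cf_def n_def rep_lin rep_\<alpha>)
    show "x = (\<Sum>s\<in>S. cf s x *\<^sub>R n s)" for x
      using expand_\<alpha>[of x] cn by simp
    show "b s t = b t s" for s t by (rule b_sym)
    show "b s s = 1" if "s \<in> S" for s
      using that q[OF that] \<delta>[OF that] by (simp add: b_def diag mult.assoc)
  qed (use b_cos b_inf in auto)
  have scale: "\<exists>r>0. \<alpha> s = r *\<^sub>R n s" if "s \<in> S" for s
    using q[OF that] by (intro exI[of _ "q s"]) (simp add: n_def)
  have refl: "simple_refl A \<alpha> K s x = \<sigma> s x" if K: "K \<subseteq> S" "s \<in> K" "supp K x" for K s x
  proof -
    have s: "s \<in> S" using K by auto
    have z: "rep t x = 0" if "t \<in> S - K" for t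
    proof -
      have "cf t x = 0" using K(3) that by (simp add: supp_def)
      then show ?thesis using q(1)[of t] that by (simp add: cf_def)
    qed
    \<comment> \<open>The support condition puts \<open>x\<close> into the span of the simple roots
      in \<open>K\<close>, so its coordinates in the smaller basis agree with those in the full
      one.\<close>
    have "x = (\<Sum>t\<in>K. rep t x *\<^sub>R \<alpha> t)"
      using expand_\<alpha>[of x] z K(1) fin sum.mono_neutral_right[of S K "\<lambda>t. rep t x *\<^sub>R \<alpha> t"] by simp
    then have "x \<in> span (\<alpha> ` K)" by (metis (no_types, lifting) imageI span_base span_scale span_sum)
    then have "representation (\<alpha> ` K) x = representation (\<alpha> ` S) x"
      using representation_extend[OF ind, of x "\<alpha> ` K"] K(1) by (simp add: image_mono)
    then have "(\<Sum>t\<in>K. A s t * representation (\<alpha> ` K) x (\<alpha> t)) = (\<Sum>t\<in>K. A s t * rep t x)"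
      by (simp add: rep_def)
    also have "\<dots> = (\<Sum>t\<in>S. A s t * rep t x)"
      using z K(1) fin by (intro sum.mono_neutral_left) auto
    also have "\<dots> = (\<Sum>t\<in>S. 2 * (b s t * cf t x) / q s)"
    proof (rule sum.cong[OF HOL.refl])
      fix t assume t: "t \<in> S"
      have "2 * (b s t * cf t x) / q s = (\<delta> s / (q s * q s)) * (A s t * rep t x)"
        using s t q(1)[OF t] by (simp add: b_def cf_def)
      then show "A s t * rep t x = 2 * (b s t * cf t x) / q s" using q[OF s] \<delta>[OF s] by simp
    qed
    also have "\<dots> = 2 * bf s x / q s" by (simp add: bf_def sum_distrib_left sum_divide_distrib)
    finally show ?thesis unfolding simple_refl_def \<sigma>_def by (simp add: n_def)
  qed
  show ?thesis by (rule pi_down_iff[OF scale refl assms(5,6)])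
qed

end
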